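(* Let $N_\lambda=\mathcal D_{n-1}v_\lambda\subset B=\mathbb C[x_1,\dots,x_n]$ be a simple $\mathcal D_{n-1}$-module corresponding to the partition $\lambda\vdash n-1$, where $\mathbb C v_\lambda=\mathrm{Ann}_{\mathcal D_{n-1}^-}(N_\lambda)$, and let $\mathrm{res}(N_\lambda)$ denote its restriction to a $\mathcal D_n$-module. (1) Then $\mathrm{res}(N_\lambda)=\bigoplus_\mu N_\mu$ is multiplicity-free, and the simple direct summands $N_\mu$ correspond to all partitions $\mu\vdash n$ that can be formed by adding a box to $\lambda$. (2) Assume that $N_\mu$ corresponds to adding a box to the $r$th row of the Young diagram of $\lambda$. Then the decomposition in (1) is determined by submodules $N_\mu\subset N_\lambda$, where $N_\mu$ is generated by a homogeneous lowest weight polynomial of the form $v_\mu=x_n^av_\lambda+v_a'\in\mathrm{Ann}_{\mathcal D_n^-}(N_\lambda)$, where $a=\lambda(r)$ and $v_a'$ is of lower order than $a$ in $x_n$. We have $\deg(v_\mu)=\sum_i i\,\lambda(i)+a-l$, where $l$ is the number of $i$ such that $\lambda(i)\neq0$.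
   Context: $\mathcal D_B$ is the Weyl algebra on $B=\mathbb C[x_1,\dots,x_n]$, graded by $\deg x_i=1$, $\deg\partial_i=-1$. For $1\le m\le n$, the symmetric group $S_m$ permutes $x_1,\dots,x_m$ and fixes $x_{m+1},\dots,x_n$, and $\mathcal D_m=\mathcal D_B^{S_m}$ is the ring of invariant differential operators; thus $\mathcal D_n\subset\mathcal D_{n-1}$. $\mathcal D_m^-$ is the sum of the parts of $\mathcal D_m$ of strictly negative degree, and $\mathrm{Ann}_{\mathcal D_m^-}(N)=\{y\in N:\mathcal D_m^-y=0\}$. A partition $\lambda\vdash m$ is a non-increasing function $\lambda:\{1,2,\dots\}\to\mathbb N$ with sum $m$, identified with its Young diagram with rows of lengths $\lambda(1),\lambda(2),\dots$; adding a box to row $r$ means replacing $\lambda(r)$ by $\lambda(r)+1$, allowed when the result is again non-increasing ($\lambda(r)=0$ is allowed). For a set partition $P=\{P_j\}$ of $\{1,\dots,m\}$ the Specht polynomial is $s_P=\prod_j\prod_{k<l,\ k,l\in P_j}(x_k-x_l)$. The module $\mathcal D_ms_P$ is simple, $\mathcal D_ms_P\cong\mathcal D_ms_Q$ if and only if $P$ and $Q$ have the same block sizes, and every simple $\mathcal D_m$-submodule of $B$ is isomorphic to some $\mathcal D_ms_P$. A simple $\mathcal D_m$-submodule of $B$ corresponds to $\lambda\vdash m$ if it is isomorphic to $\mathcal D_ms_P$ with $P$ having block sizes the nonzero $\lambda(1),\lambda(2),\dots$.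
   Formalization: The printed degree formula is false (for n=3, λ=(1,1), r=3 it gives 1, but v_μ is a nonzero constant of degree 0); the formal statement proves instead the correct value deg(v_μ) = Σ_i binom(λ(i),2) + a, with a = λ(r). *)

theory Defs
  imports
    Complex_Main
    "HOL-Library.Poly_Mapping"
    "HOL-Library.Function_Algebras"
    "HOL-Library.Disjoint_Sets"
    "HOL-Library.FuncSet"
    "HOL-Library.Multiset"
    "HOL-Combinatorics.Permutations"
begin

section \<open>Polynomials\<close>

text \<open>
  Polynomials are finitely supported functions on exponent vectors. The type has infinitely many
  variables \<open>x\<^sub>0, x\<^sub>1, \<dots>\<close>; \<open>\<complex>[x\<^sub>1,\<dots>,x\<^sub>n]\<close> is the subset \<open>polys n\<close>.
\<close>

type_synonym cpoly = "(nat \<Rightarrow>\<^sub>0 nat) \<Rightarrow>\<^sub>0 complex"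

definition polys :: "nat \<Rightarrow> cpoly set" where
  "polys n = {p. \<forall>m \<in> Poly_Mapping.keys p. Poly_Mapping.keys m \<subseteq> {1..n}}"

definition X :: "nat \<Rightarrow> cpoly" where
  "X i = Poly_Mapping.single (Poly_Mapping.single i 1) 1"

definition cscale :: "complex \<Rightarrow> cpoly \<Rightarrow> cpoly" where
  "cscale c p = Poly_Mapping.single 0 c * p"

definition pd :: "nat \<Rightarrow> cpoly \<Rightarrow> cpoly" where
  "pd i p = (\<Sum>m \<in> Poly_Mapping.keys p.
     Poly_Mapping.single (m - Poly_Mapping.single i 1)
       (of_nat (Poly_Mapping.lookup m i) * Poly_Mapping.lookup p m))"

text \<open>
  The substitution \<open>x\<^sub>i \<mapsto> x\<^bsub>\<sigma> i\<^esub>\<close> for a permutation \<open>\<sigma>\<close>: the coefficient of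
  \<open>perm_vars \<sigma> p\<close> at the exponent vector \<open>m\<close> is that of \<open>p\<close> at \<open>m \<circ> \<sigma>\<close>.
\<close>
definition perm_vars :: "(nat \<Rightarrow> nat) \<Rightarrow> cpoly \<Rightarrow> cpoly" where
  "perm_vars \<sigma> = Poly_Mapping.map_key (Poly_Mapping.map_key \<sigma>)"

definition mon_degree :: "(nat \<Rightarrow>\<^sub>0 nat) \<Rightarrow> nat" where
  "mon_degree m = (\<Sum>i \<in> Poly_Mapping.keys m. Poly_Mapping.lookup m i)"

text \<open>The total degree; the zero polynomial is given degree 0.\<close>
definition poly_degree :: "cpoly \<Rightarrow> nat" where
  "poly_degree p = Max (insert 0 (mon_degree ` Poly_Mapping.keys p))"

definition homogeneous :: "cpoly \<Rightarrow> bool" where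
  "homogeneous p \<longleftrightarrow>
     (\<forall>m \<in> Poly_Mapping.keys p. \<forall>m' \<in> Poly_Mapping.keys p. mon_degree m = mon_degree m')"

text \<open>All powers of \<open>x\<^sub>i\<close> occurring in \<open>p\<close> are below \<open>a\<close>; for \<open>a = 0\<close> this means \<open>p = 0\<close>.\<close>
definition lower_order :: "nat \<Rightarrow> nat \<Rightarrow> cpoly \<Rightarrow> bool" where
  "lower_order i a p \<longleftrightarrow> (\<forall>m \<in> Poly_Mapping.keys p. Poly_Mapping.lookup m i < a)"


section \<open>The Weyl algebra and its invariants\<close>

text \<open>
  In characteristic 0 the Weyl algebra acts faithfully on polynomials, so it is taken to be the
  algebra of operators generated by the \<open>x\<^sub>i\<close> and \<open>\<partial>\<^sub>i\<close> for \<open>1 \<le> i \<le> n\<close>, that is, the linear span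
  of all words in these generators. These operators are linear over the remaining variables, so
  that letting them act on the whole type \<^typ>\<open>cpoly\<close> rather than on \<^term>\<open>polys n\<close> does not
  change the algebra.
\<close>

definition op_scale :: "complex \<Rightarrow> (cpoly \<Rightarrow> cpoly) \<Rightarrow> cpoly \<Rightarrow> cpoly" where
  "op_scale c D = (\<lambda>p. cscale c (D p))"

interpretation oper: vector_space op_scale
  by standard
    (auto simp: op_scale_def cscale_def fun_eq_iff plus_fun_def distrib_left distrib_right
       single_add mult.assoc[symmetric] mult_single)

text \<open>\<open>weyl_word n d D\<close>: the operator \<open>D\<close> is a word of degree \<open>d\<close> in the generators.\<close>
inductive weyl_word :: "nat \<Rightarrow> int \<Rightarrow> (cpoly \<Rightarrow> cpoly) \<Rightarrow> bool" for n where
  one: "weyl_word n 0 id"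
| mult: "weyl_word n d D \<Longrightarrow> i \<in> {1..n} \<Longrightarrow> weyl_word n (d + 1) (\<lambda>p. X i * D p)"
| deriv: "weyl_word n d D \<Longrightarrow> i \<in> {1..n} \<Longrightarrow> weyl_word n (d - 1) (\<lambda>p. pd i (D p))"

definition weyl :: "nat \<Rightarrow> (cpoly \<Rightarrow> cpoly) set" where
  "weyl n = oper.span {D. \<exists>d. weyl_word n d D}"

definition weyl_part :: "nat \<Rightarrow> int \<Rightarrow> (cpoly \<Rightarrow> cpoly) set" where
  "weyl_part n d = oper.span {D. weyl_word n d D}"

definition inv_ops :: "nat \<Rightarrow> nat \<Rightarrow> (cpoly \<Rightarrow> cpoly) set" where
  "inv_ops n m =
     {D \<in> weyl n. \<forall>\<sigma>. \<sigma> permutes {1..m} \<longrightarrow> perm_vars \<sigma> \<circ> D \<circ> perm_vars (inv \<sigma>) = D}"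

definition inv_ops_neg :: "nat \<Rightarrow> nat \<Rightarrow> (cpoly \<Rightarrow> cpoly) set" where
  "inv_ops_neg n m = oper.span (\<Union>d \<in> {d. d < 0}. inv_ops n m \<inter> weyl_part n d)"


section \<open>Submodules of the polynomial ring\<close>

text \<open>
  In the following \<open>n\<close> is the number of variables and the acting ring is \<^term>\<open>inv_ops n m\<close>.
  Restricting to a smaller ring of invariants leaves the underlying set of a submodule unchanged.
\<close>

definition submod :: "nat \<Rightarrow> nat \<Rightarrow> cpoly set \<Rightarrow> bool" where
  "submod n m M \<longleftrightarrow> M \<subseteq> polys n \<and> 0 \<in> M \<and> (\<forall>p \<in> M. \<forall>q \<in> M. p + q \<in> M) \<and>
     (\<forall>D \<in> inv_ops n m. \<forall>p \<in> M. D p \<in> M)"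

definition simple_submod :: "nat \<Rightarrow> nat \<Rightarrow> cpoly set \<Rightarrow> bool" where
  "simple_submod n m M \<longleftrightarrow> submod n m M \<and> M \<noteq> {0} \<and>
     (\<forall>K. submod n m K \<and> K \<subseteq> M \<longrightarrow> K = {0} \<or> K = M)"

definition cyclic :: "nat \<Rightarrow> nat \<Rightarrow> cpoly \<Rightarrow> cpoly set" where
  "cyclic n m v = {D v | D. D \<in> inv_ops n m}"

definition submod_iso :: "nat \<Rightarrow> nat \<Rightarrow> cpoly set \<Rightarrow> cpoly set \<Rightarrow> bool" where
  "submod_iso n m M N \<longleftrightarrow> (\<exists>f. bij_betw f M N \<and> (\<forall>p \<in> M. \<forall>q \<in> M. f (p + q) = f p + f q) \<and>
     (\<forall>D \<in> inv_ops n m. \<forall>p \<in> M. f (D p) = D (f p)))"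

definition ann_neg :: "nat \<Rightarrow> nat \<Rightarrow> cpoly set \<Rightarrow> cpoly set" where
  "ann_neg n m N = {y \<in> N. \<forall>D \<in> inv_ops_neg n m. D y = 0}"

definition direct_sum_of :: "'i set \<Rightarrow> ('i \<Rightarrow> cpoly set) \<Rightarrow> cpoly set \<Rightarrow> bool" where
  "direct_sum_of I F N \<longleftrightarrow> finite I \<and> (\<forall>i \<in> I. F i \<subseteq> N) \<and>
     (\<forall>f \<in> Pi\<^sub>E I F. (\<Sum>i \<in> I. f i) \<in> N) \<and>
     (\<forall>y \<in> N. \<exists>!f. f \<in> Pi\<^sub>E I F \<and> y = (\<Sum>i \<in> I. f i))"


section \<open>Partitions and Specht polynomials\<close>

text \<open>
  Rows are numbered from 1. The irrelevant value at 0 is fixed to be 0, so that distinct functions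
  are distinct partitions.
\<close>
definition is_partition :: "nat \<Rightarrow> (nat \<Rightarrow> nat) \<Rightarrow> bool" where
  "is_partition m lam \<longleftrightarrow> lam 0 = 0 \<and> (\<forall>i j. 1 \<le> i \<and> i \<le> j \<longrightarrow> lam j \<le> lam i) \<and>
     finite {i. lam i \<noteq> 0} \<and> (\<Sum>i | lam i \<noteq> 0. lam i) = m"

definition add_box :: "(nat \<Rightarrow> nat) \<Rightarrow> nat \<Rightarrow> nat \<Rightarrow> nat" where
  "add_box lam r = lam(r := lam r + 1)"

definition box_extensions :: "nat \<Rightarrow> (nat \<Rightarrow> nat) \<Rightarrow> (nat \<Rightarrow> nat) set" where
  "box_extensions n lam = {\<mu>. is_partition n \<mu> \<and> (\<exists>r \<ge> 1. \<mu> = add_box lam r)}"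

definition specht :: "nat set set \<Rightarrow> cpoly" where
  "specht P = (\<Prod>A \<in> P. \<Prod>(k, l) \<in> {(k, l). k \<in> A \<and> l \<in> A \<and> k < l}. X k - X l)"

definition has_block_sizes :: "nat set set \<Rightarrow> (nat \<Rightarrow> nat) \<Rightarrow> bool" where
  "has_block_sizes P lam \<longleftrightarrow>
     image_mset card (mset_set P) = image_mset lam (mset_set {i. lam i \<noteq> 0})"

definition corresponds :: "nat \<Rightarrow> nat \<Rightarrow> cpoly set \<Rightarrow> (nat \<Rightarrow> nat) \<Rightarrow> bool" where
  "corresponds n m M lam \<longleftrightarrow> simple_submod n m M \<and> is_partition m lam \<and>
     (\<exists>P. partition_on {1..m} P \<and> has_block_sizes P lam \<and>
        submod_iso n m M (cyclic n m (specht P)))"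

end

theory Submission
  imports Defs
begin

text \<open>
  Put \<open>m = n - 1\<close>. Through an isomorphism with \<open>\<D>\<^sub>m s\<^sub>P\<close>, where \<open>P\<close> has the block sizes \<open>\<lambda>(i)\<close>, the
  theorem becomes a statement on the lowest weight vectors of \<open>N\<close>, that is, the vectors that are
  killed by \<open>\<D>\<^sub>n\<^sup>-\<close>.
  
  The main tool is the Fischer inner product, for which distinct monomials are orthogonal and \<open>x\<^sub>i\<close> is
  adjoint to \<open>\<partial>\<^sub>i\<close>. The rings of invariant operators are closed under adjoints (\<open>inv_ops_adjoint\<close>), so
  that orthogonal complements of submodules are submodules. Since the Euler operator is invariant,
  submodules are graded (\<open>submod_hom_part\<close>), and a nonzero one contains a lowest weight vector, namely
  any nonzero element of minimal degree (\<open>exists_lowest\<close>).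
  
  Existence. An antisymmetric polynomial with respect to \<open>P\<close> has distinct exponents on each block.
  Hence its degree is at least that of \<open>s\<^sub>P\<close>, with equality only for the multiples of \<open>s\<^sub>P\<close>
  (\<open>antisym_degree\<close>, \<open>antisym_unique\<close>). As invariant operators preserve antisymmetry, \<open>s\<^sub>P\<close> is a
  lowest weight vector, and the module that it generates over the operators of its own symmetric
  group is simple (\<open>specht_simple\<close>). Now let \<open>Q\<close> arise from \<open>P\<close> by adding \<open>n\<close> to a block of size
  \<open>a\<close>, where \<open>a = 0\<close> means a new block. Then \<open>s\<^sub>Q\<close> is \<open>\<plusminus>x\<^sub>n\<^sup>a s\<^sub>P\<close> plus terms of lower order in \<open>x\<^sub>n\<close>, but it
  need not lie in \<open>\<D>\<^sub>m s\<^sub>P\<close>. Its orthogonal projection to this module does, and the projection commutes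
  with \<open>\<D>\<^sub>m\<close>; so it keeps the leading term and generates a copy of \<open>\<D>\<^sub>n s\<^sub>Q\<close> (\<open>projected_specht\<close>).
  
  Completeness. Let \<open>w \<in> N\<close> be a lowest weight vector for \<open>\<D>\<^sub>n\<close>, of order \<open>j\<close> in \<open>x\<^sub>n\<close>. Its leading
  coefficient is killed by \<open>\<D>\<^sub>m\<^sup>-\<close> (\<open>leading_coefficient_lowest\<close>), so that it is a multiple of \<open>v\<close>. The
  operators \<open>\<Sum>\<^sub>i x\<^sub>i\<^sup>a \<partial>\<^sub>i\<^bsup>a+1\<^esup>\<close> kill \<open>w\<close> as well, and this forces \<open>j\<close> to be \<open>0\<close> or a block size of \<open>P\<close>
  (\<open>order_is_block_size\<close>); the first row of that length can then be extended by a box. Subtracting a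
  multiple of the vector found for this row lowers the order but not the degree, while the degree
  determines the order; so \<open>w\<close> is that multiple. Therefore nothing in \<open>N\<close> is orthogonal to all the
  modules that were found, and these exhaust \<open>N\<close>.
  
  The rows that can be extended have different lengths, so that the lowest weight vectors have
  different degrees. This makes the modules orthogonal to each other (\<open>lowest_orthogonal\<close>) and
  pairwise non-isomorphic (\<open>not_iso_of_degree_less\<close>).
\<close>

abbreviation "lookup \<equiv> Poly_Mapping.lookup"
abbreviation "keys \<equiv> Poly_Mapping.keys"
abbreviation "single \<equiv> Poly_Mapping.single"

abbreviation unit_exp :: "nat \<Rightarrow> nat \<Rightarrow>\<^sub>0 nat" where
  "unit_exp i \<equiv> single i 1"

abbreviation transp :: "nat \<Rightarrow> nat \<Rightarrow> nat \<Rightarrow> nat" where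
  "transp \<equiv> Transposition.transpose"

(* keeps exponents such as unit_exp i in the form in which the lemmas state them *)
declare One_nat_def [simp del]

section \<open>Coefficients of the basic operations\<close>

lemma poly_mapping_as_sum: "p = (\<Sum>m\<in>keys p. single m (lookup p m))"
  by (rule poly_mapping_eqI)
    (simp add: lookup_sum lookup_single when_def not_in_keys_iff_lookup_eq_zero)

lemma lookup_single_mult:
  fixes p :: cpoly
  shows "lookup (single m c * p) \<gamma> =
    (if \<forall>i. lookup m i \<le> lookup \<gamma> i then c * lookup p (\<gamma> - m) else 0)"
proof -
  have "single m c * p = (\<Sum>k\<in>keys p. single (m + k) (c * lookup p k))"
    by (subst poly_mapping_as_sum[of p]) (simp add: sum_distrib_left mult_single)
  then have 1: "lookup (single m c * p) \<gamma> = (\<Sum>k\<in>keys p. (c * lookup p k when m + k = \<gamma>))"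
    by (simp add: lookup_sum lookup_single)
  show ?thesis
  proof (cases "\<forall>i. lookup m i \<le> lookup \<gamma> i")
    case True
    then have "m + k = \<gamma> \<longleftrightarrow> k = \<gamma> - m" for k
      by (auto simp: poly_mapping_eq_iff fun_eq_iff lookup_add lookup_minus)
        (metis add_diff_cancel_left')
    then show ?thesis
      using True 1 by (simp add: when_def not_in_keys_iff_lookup_eq_zero)
  next
    case False
    then have "m + k \<noteq> \<gamma>" for k
      by (metis le_add1 lookup_add)
    with 1 have "lookup (single m c * p) \<gamma> = 0"
      by simp
    then show ?thesis
      using False by (simp only: if_False)
  qed
qed

lemma lookup_cscale [simp]: "lookup (cscale c p) \<gamma> = c * lookup p \<gamma>"
  by (simp add: cscale_def lookup_single_mult)

lemma lookup_X_mult: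
  "lookup (X i * p) \<gamma> = (if lookup \<gamma> i = 0 then 0 else lookup p (\<gamma> - unit_exp i))"
proof -
  have "(\<forall>j. lookup (unit_exp i) j \<le> lookup \<gamma> j) \<longleftrightarrow> lookup \<gamma> i \<noteq> 0"
    by (auto simp: lookup_single when_def)
  then show ?thesis
    by (simp add: X_def lookup_single_mult)
qed

lemma lookup_pd: "lookup (pd i p) \<gamma> = of_nat (Suc (lookup \<gamma> i)) * lookup p (\<gamma> + unit_exp i)"
proof -
  have "lookup (pd i p) \<gamma> =
      (\<Sum>m\<in>keys p. (of_nat (lookup m i) * lookup p m when m - unit_exp i = \<gamma>))"
    by (simp add: pd_def lookup_sum lookup_single)
  also have "\<dots> = (\<Sum>m\<in>keys p. if m = \<gamma> + unit_exp i then of_nat (lookup m i) * lookup p m else 0)"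
  proof (rule sum.cong[OF refl])
    fix m
    have "m - unit_exp i = \<gamma> \<longleftrightarrow> m = \<gamma> + unit_exp i" if "lookup m i \<noteq> 0"
      using that
      by (auto simp: poly_mapping_eq_iff fun_eq_iff lookup_add lookup_minus lookup_single when_def)
    then show "(of_nat (lookup m i) * lookup p m when m - unit_exp i = \<gamma>) =
        (if m = \<gamma> + unit_exp i then of_nat (lookup m i) * lookup p m else 0)"
      by (cases "lookup m i = 0") (auto simp: when_def)
  qed
  also have "\<dots> = of_nat (Suc (lookup \<gamma> i)) * lookup p (\<gamma> + unit_exp i)"
    by (simp add: not_in_keys_iff_lookup_eq_zero lookup_add)
  finally show ?thesis .
qed

lemma lookup_map_key_bij:
  "bij \<sigma> \<Longrightarrow> lookup (Poly_Mapping.map_key \<sigma> \<gamma>) i = lookup \<gamma> (\<sigma> i)"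
  by (simp add: bij_is_inj map_key.rep_eq)

lemma inj_map_key:
  assumes "bij \<sigma>"
  shows "inj (Poly_Mapping.map_key \<sigma> :: (nat \<Rightarrow>\<^sub>0 nat) \<Rightarrow> nat \<Rightarrow>\<^sub>0 nat)"
proof (rule injI, rule poly_mapping_eqI)
  fix x y :: "nat \<Rightarrow>\<^sub>0 nat" and k
  assume "Poly_Mapping.map_key \<sigma> x = Poly_Mapping.map_key \<sigma> y"
  then have "lookup x (\<sigma> (inv \<sigma> k)) = lookup y (\<sigma> (inv \<sigma> k))"
    by (metis assms lookup_map_key_bij)
  then show "lookup x k = lookup y k"
    using assms by (simp add: bij_is_surj surj_f_inv_f)
qed

lemma lookup_perm_vars:
  "bij \<sigma> \<Longrightarrow> lookup (perm_vars \<sigma> p) \<gamma> = lookup p (Poly_Mapping.map_key \<sigma> \<gamma>)"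
  by (simp add: perm_vars_def inj_map_key map_key.rep_eq)

section \<open>Linear operators\<close>

interpretation cp: vector_space cscale
  by standard (auto simp: poly_mapping_eq_iff fun_eq_iff lookup_add algebra_simps)

definition lin :: "(cpoly \<Rightarrow> cpoly) \<Rightarrow> bool" where
  "lin D \<longleftrightarrow> (\<forall>p q. D (p + q) = D p + D q) \<and> (\<forall>c p. D (cscale c p) = cscale c (D p))"

lemma lin_add: "lin D \<Longrightarrow> D (p + q) = D p + D q"
  and lin_cscale: "lin D \<Longrightarrow> D (cscale c p) = cscale c (D p)"
  by (auto simp: lin_def)

lemma cscale_minus1: "cscale (-1) p = - p"
  by (simp add: poly_mapping_eq_iff fun_eq_iff)

lemma lin_zero: "lin D \<Longrightarrow> D 0 = 0"
  by (metis cp.scale_zero_left lin_cscale)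

lemma lin_uminus: "lin D \<Longrightarrow> D (- p) = - D p"
  by (metis cscale_minus1 lin_cscale)

lemma lin_diff: "lin D \<Longrightarrow> D (p - q) = D p - D q"
  using lin_add[of D p "- q"] by (simp add: lin_uminus)

lemma lin_sum: "lin D \<Longrightarrow> D (sum f I) = (\<Sum>i\<in>I. D (f i))"
  by (induction I rule: infinite_finite_induct) (simp_all add: lin_zero lin_add)

lemma lin_id: "lin id"
  by (simp add: lin_def)

lemma lin_comp: "lin D \<Longrightarrow> lin E \<Longrightarrow> lin (D \<circ> E)"
  by (simp add: lin_def)

lemma lin_X: "lin (\<lambda>p. X i * p)"
  by (simp add: lin_def distrib_left poly_mapping_eq_iff fun_eq_iff lookup_X_mult)

lemma lin_pd: "lin (pd i)"
  by (simp add: lin_def poly_mapping_eq_iff fun_eq_iff lookup_pd lookup_add algebra_simps)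

lemma lin_perm_vars: "bij \<sigma> \<Longrightarrow> lin (perm_vars \<sigma>)"
  by (simp add: lin_def poly_mapping_eq_iff fun_eq_iff lookup_perm_vars lookup_add)

lemma lin_zero_op: "lin 0"
  by (simp add: lin_def)

lemma lin_plus_op: "lin D \<Longrightarrow> lin E \<Longrightarrow> lin (D + E)"
  by (simp add: lin_def add.commute add.left_commute cp.scale_right_distrib)

lemma lin_op_scale: "lin D \<Longrightarrow> lin (op_scale c D)"
  by (simp add: lin_def op_scale_def cp.scale_right_distrib mult.commute)

lemma sum_op_apply: "(\<Sum>i\<in>I. F i) p = (\<Sum>i\<in>I. F i (p :: cpoly) :: cpoly)"
  by (induction I rule: infinite_finite_induct) simp_all

lemma span_op_induct [consumes 1, case_names base zero add scale]:
  assumes "D \<in> oper.span S" and "\<And>D. D \<in> S \<Longrightarrow> P D" and "P 0"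
    and "\<And>D E. P D \<Longrightarrow> P E \<Longrightarrow> P (D + E)" and "\<And>c D. P D \<Longrightarrow> P (op_scale c D)"
  shows "P D"
  using assms(1)
proof (induction rule: oper.span_induct_alt)
  case base
  show ?case by (rule assms(3))
next
  case (step c x y)
  then show ?case using assms(2,4,5) by blast
qed

lemma weyl_word_lin: "weyl_word n d D \<Longrightarrow> lin D"
proof (induction rule: weyl_word.induct)
  case one
  show ?case by (rule lin_id)
next
  case (mult d D i)
  show ?case using lin_comp[OF lin_X mult.IH] by (simp add: comp_def)
next
  case (deriv d D i)
  show ?case using lin_comp[OF lin_pd deriv.IH] by (simp add: comp_def)
qed

lemma weyl_part_subset: "weyl_part n d \<subseteq> weyl n"
  unfolding weyl_part_def weyl_def by (rule oper.span_mono) auto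

lemma weyl_lin: "D \<in> weyl n \<Longrightarrow> lin D"
  unfolding weyl_def
  by (induction rule: span_op_induct) (blast intro: weyl_word_lin lin_zero_op lin_plus_op lin_op_scale)+

lemma weyl_part_lin: "D \<in> weyl_part n d \<Longrightarrow> lin D"
  using weyl_lin weyl_part_subset by blast

lemma weyl_part_0: "0 \<in> weyl_part n d"
  and weyl_part_add: "D \<in> weyl_part n d \<Longrightarrow> E \<in> weyl_part n d \<Longrightarrow> D + E \<in> weyl_part n d"
  and weyl_part_scale: "D \<in> weyl_part n d \<Longrightarrow> op_scale c D \<in> weyl_part n d"
  and weyl_part_sum: "(\<And>i. i \<in> I \<Longrightarrow> F i \<in> weyl_part n d) \<Longrightarrow> (\<Sum>i\<in>I. F i) \<in> weyl_part n d"
  and weyl_part_word: "weyl_word n d D \<Longrightarrow> D \<in> weyl_part n d"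
  unfolding weyl_part_def
  by (auto intro: oper.span_zero oper.span_add oper.span_scale oper.span_sum oper.span_base)

lemma weyl_0: "0 \<in> weyl n"
  and weyl_add: "D \<in> weyl n \<Longrightarrow> E \<in> weyl n \<Longrightarrow> D + E \<in> weyl n"
  and weyl_scale: "D \<in> weyl n \<Longrightarrow> op_scale c D \<in> weyl n"
  and weyl_sum: "(\<And>i. i \<in> I \<Longrightarrow> F i \<in> weyl n) \<Longrightarrow> (\<Sum>i\<in>I. F i) \<in> weyl n"
  unfolding weyl_def
  by (auto intro: oper.span_zero oper.span_add oper.span_scale oper.span_sum)

lemma comp_plus_left: "(D + E) \<circ> F = (D \<circ> F) + (E \<circ> (F :: cpoly \<Rightarrow> cpoly))"
  by (simp add: fun_eq_iff)

lemma comp_scale_left: "op_scale c D \<circ> F = op_scale c (D \<circ> F)"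
  by (simp add: fun_eq_iff op_scale_def)

lemma comp_plus_right: "lin D \<Longrightarrow> D \<circ> (E + F) = (D \<circ> E) + (D \<circ> F)"
  by (simp add: fun_eq_iff lin_add)

lemma comp_scale_right: "lin D \<Longrightarrow> D \<circ> op_scale c E = op_scale c (D \<circ> E)"
  by (simp add: fun_eq_iff op_scale_def lin_cscale)

lemma comp_span:
  assumes L: "lin L" and "\<And>D. D \<in> S \<Longrightarrow> L \<circ> D \<in> oper.span T" and "D \<in> oper.span S"
  shows "L \<circ> D \<in> oper.span T"
  using assms(3)
proof (induction rule: span_op_induct)
  case (base D)
  then show ?case by (rule assms(2))
next
  case zero
  have "L \<circ> 0 = (0 :: cpoly \<Rightarrow> cpoly)" by (simp add: fun_eq_iff lin_zero[OF L])
  then show ?case by (simp only: oper.span_zero)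
qed (simp_all only: comp_plus_right[OF L] comp_scale_right[OF L] oper.span_add oper.span_scale)

lemma weyl_part_X_comp:
  assumes "i \<in> {1..n}" and "D \<in> weyl_part n d"
  shows "(\<lambda>p. X i * p) \<circ> D \<in> weyl_part n (d + 1)"
  using assms(2) unfolding weyl_part_def
  by (rule comp_span[OF lin_X, rotated])
    (use weyl_word.mult[OF _ assms(1)] in \<open>auto simp: comp_def intro: oper.span_base\<close>)

lemma weyl_part_pd_comp:
  assumes "i \<in> {1..n}" and "D \<in> weyl_part n d"
  shows "pd i \<circ> D \<in> weyl_part n (d - 1)"
  using assms(2) unfolding weyl_part_def
  by (rule comp_span[OF lin_pd, rotated])
    (use weyl_word.deriv[OF _ assms(1)] in \<open>auto simp: comp_def intro: oper.span_base\<close>)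

lemma weyl_word_comp:
  "weyl_word n d D \<Longrightarrow> E \<in> weyl_part n e \<Longrightarrow> D \<circ> E \<in> weyl_part n (d + e)"
proof (induction rule: weyl_word.induct)
  case one
  then show ?case by simp
next
  case (mult d D i)
  then show ?case
    using weyl_part_X_comp[of i n "D \<circ> E" "d + e"] by (simp add: comp_def add.commute add.left_commute)
next
  case (deriv d D i)
  then show ?case
    using weyl_part_pd_comp[of i n "D \<circ> E" "d + e"] by (simp add: comp_def algebra_simps)
qed

lemma weyl_part_comp:
  assumes "D \<in> weyl_part n d" and "E \<in> weyl_part n e"
  shows "D \<circ> E \<in> weyl_part n (d + e)"
  using assms(1) unfolding weyl_part_def[of n d]
proof (induction rule: span_op_induct)
  case zero
  have "0 \<circ> E = (0 :: cpoly \<Rightarrow> cpoly)" by (simp add: fun_eq_iff)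
  then show ?case by (simp only: weyl_part_0)
next
  case (base D)
  then show ?case using weyl_word_comp assms(2) by blast
qed (simp_all only: comp_plus_left comp_scale_left weyl_part_add weyl_part_scale)

lemma weyl_graded:
  assumes "D \<in> weyl n"
  obtains I G where "finite I" and "\<And>d. d \<in> I \<Longrightarrow> G d \<in> weyl_part n d" and "D = (\<Sum>d\<in>I. G d)"
proof -
  have "\<exists>I G. finite I \<and> (\<forall>d. G d \<in> weyl_part n d) \<and> D = (\<Sum>d\<in>I. G d)"
    using assms unfolding weyl_def
  proof (induction rule: span_op_induct)
    case (base D)
    then obtain d where "weyl_word n d D" by auto
    then show ?case
      by (intro exI[of _ "{d}"] exI[of _ "\<lambda>e. if e = d then D else 0"])
        (simp add: weyl_part_word weyl_part_0)
  next
    case zero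
    show ?case by (intro exI[of _ "{}"] exI[of _ "\<lambda>_. 0"]) (simp only: finite.emptyI weyl_part_0 sum.empty simp_thms)
  next
    case (add D E)
    then obtain I G J H where 1: "finite I" "\<forall>d. G d \<in> weyl_part n d" "D = (\<Sum>d\<in>I. G d)"
      "finite J" "\<forall>d. H d \<in> weyl_part n d" "E = (\<Sum>d\<in>J. H d)" by blast
    define K where "K d = (if d \<in> I then G d else 0) + (if d \<in> J then H d else 0)" for d
    have "D = (\<Sum>d\<in>I \<union> J. if d \<in> I then G d else 0)" "E = (\<Sum>d\<in>I \<union> J. if d \<in> J then H d else 0)"
      using 1 by (auto intro!: sum.mono_neutral_cong_left)
    then have "D + E = (\<Sum>d\<in>I \<union> J. K d)"
      unfolding K_def by (simp add: sum.distrib)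
    moreover have "\<forall>d. K d \<in> weyl_part n d"
      using 1 unfolding K_def by (auto simp del: plus_fun_apply intro: weyl_part_add weyl_part_0)
    moreover have "finite (I \<union> J)" using 1 by simp
    ultimately show ?case by blast
  next
    case (scale c D)
    then obtain I G where "finite I" "\<forall>d. G d \<in> weyl_part n d" "D = (\<Sum>d\<in>I. G d)" by blast
    then show ?case
      by (intro exI[of _ I] exI[of _ "\<lambda>d. op_scale c (G d)"])
        (auto simp: oper.scale_sum_right intro: weyl_part_scale)
  qed
  then show ?thesis using that by blast
qed

lemma weyl_comp:
  assumes "D \<in> weyl n" and "E \<in> weyl n"
  shows "D \<circ> E \<in> weyl n"
proof -
  obtain I G where I: "finite I" "\<And>d. d \<in> I \<Longrightarrow> G d \<in> weyl_part n d" "D = (\<Sum>d\<in>I. G d)"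
    using weyl_graded[OF assms(1)] by blast
  obtain J H where J: "finite J" "\<And>d. d \<in> J \<Longrightarrow> H d \<in> weyl_part n d" "E = (\<Sum>d\<in>J. H d)"
    using weyl_graded[OF assms(2)] by blast
  have "D \<circ> E = (\<Sum>d\<in>I. \<Sum>e\<in>J. G d \<circ> H e)"
    by (rule ext) (simp add: I(3) J(3) sum_op_apply lin_sum[OF weyl_part_lin[OF I(2)]])
  moreover have "G d \<circ> H e \<in> weyl n" if "d \<in> I" "e \<in> J" for d e
    using weyl_part_comp[OF I(2)[OF that(1)] J(2)[OF that(2)]] weyl_part_subset by blast
  ultimately show ?thesis
    by (auto intro!: weyl_sum)
qed

section \<open>Permutations and invariant operators\<close>

lemma perm_vars_comp:
  assumes "bij \<sigma>" and "bij \<tau>"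
  shows "perm_vars \<sigma> (perm_vars \<tau> p) = perm_vars (\<sigma> \<circ> \<tau>) p"
  using assms
  by (auto simp: poly_mapping_eq_iff fun_eq_iff lookup_perm_vars bij_comp bij_is_inj map_key_compose)

lemma perm_vars_id [simp]: "perm_vars id p = p"
  by (simp add: poly_mapping_eq_iff fun_eq_iff lookup_perm_vars)
    (metis comp_apply eq_id_iff map_key_id)

lemma perm_vars_inv [simp]:
  assumes "bij \<sigma>"
  shows "perm_vars \<sigma> (perm_vars (inv \<sigma>) p) = p" and "perm_vars (inv \<sigma>) (perm_vars \<sigma> p) = p"
  using assms
  by (simp_all add: perm_vars_comp bij_imp_bij_inv)
    (metis bij_is_surj perm_vars_id surj_iff, metis bij_is_inj inv_o_cancel perm_vars_id)

lemma map_key_minus_unit: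
  assumes "bij \<sigma>"
  shows "Poly_Mapping.map_key \<sigma> (\<gamma> - unit_exp (\<sigma> i)) = Poly_Mapping.map_key \<sigma> \<gamma> - unit_exp i"
    and "Poly_Mapping.map_key \<sigma> (\<gamma> + unit_exp (\<sigma> i)) = Poly_Mapping.map_key \<sigma> \<gamma> + unit_exp i"
  using assms
  by (auto simp: poly_mapping_eq_iff fun_eq_iff lookup_map_key_bij lookup_minus lookup_add
      lookup_single when_def inj_eq bij_is_inj)

lemma perm_vars_X_mult:
  assumes "bij \<sigma>"
  shows "perm_vars \<sigma> (X i * p) = X (\<sigma> i) * perm_vars \<sigma> p"
  using assms
  by (simp add: poly_mapping_eq_iff fun_eq_iff lookup_perm_vars lookup_X_mult map_key_minus_unit
      lookup_map_key_bij)

lemma perm_vars_pd: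
  assumes "bij \<sigma>"
  shows "perm_vars \<sigma> (pd i p) = pd (\<sigma> i) (perm_vars \<sigma> p)"
  using assms
  by (simp add: poly_mapping_eq_iff fun_eq_iff lookup_perm_vars lookup_pd map_key_minus_unit
      lookup_map_key_bij)

definition conj_op :: "(nat \<Rightarrow> nat) \<Rightarrow> (cpoly \<Rightarrow> cpoly) \<Rightarrow> cpoly \<Rightarrow> cpoly" where
  "conj_op \<sigma> D = perm_vars \<sigma> \<circ> D \<circ> perm_vars (inv \<sigma>)"

lemma conj_op_0: "bij \<sigma> \<Longrightarrow> conj_op \<sigma> 0 = 0"
  and conj_op_add: "bij \<sigma> \<Longrightarrow> conj_op \<sigma> (D + E) = conj_op \<sigma> D + conj_op \<sigma> E"
  and conj_op_scale: "bij \<sigma> \<Longrightarrow> conj_op \<sigma> (op_scale c D) = op_scale c (conj_op \<sigma> D)"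
  and conj_op_comp: "bij \<sigma> \<Longrightarrow> conj_op \<sigma> (D \<circ> E) = conj_op \<sigma> D \<circ> conj_op \<sigma> E"
  and conj_op_id: "bij \<sigma> \<Longrightarrow> conj_op \<sigma> id = id"
  by (auto simp: conj_op_def fun_eq_iff op_scale_def lin_zero lin_perm_vars lin_add lin_cscale)

lemma conj_op_sum: "bij \<sigma> \<Longrightarrow> conj_op \<sigma> (\<Sum>i\<in>I. F i) = (\<Sum>i\<in>I. conj_op \<sigma> (F i))"
proof (induction I rule: infinite_finite_induct)
  case (insert x I)
  then show ?case by (simp only: sum.insert conj_op_add not_False_eq_True simp_thms)
qed (simp_all only: sum.infinite sum.empty conj_op_0 not_False_eq_True)

lemma conj_op_conj_op:
  assumes "bij \<sigma>" and "bij \<tau>"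
  shows "conj_op \<sigma> (conj_op \<tau> D) = conj_op (\<sigma> \<circ> \<tau>) D"
  using assms
  by (simp add: conj_op_def fun_eq_iff perm_vars_comp bij_imp_bij_inv bij_comp o_inv_distrib)

lemma weyl_word_conj:
  assumes "\<sigma> permutes {1..n}" and "weyl_word n d D"
  shows "weyl_word n d (conj_op \<sigma> D)"
  using assms(2)
proof (induction rule: weyl_word.induct)
  case one
  then show ?case
    by (simp only: conj_op_id permutes_bij[OF assms(1)] weyl_word.one)
next
  case (mult d D i)
  have "conj_op \<sigma> (\<lambda>p. X i * D p) = (\<lambda>p. X (\<sigma> i) * conj_op \<sigma> D p)"
    by (simp add: conj_op_def fun_eq_iff perm_vars_X_mult permutes_bij[OF assms(1)])
  moreover have "\<sigma> i \<in> {1..n}"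
    using mult.hyps(2) by (simp only: permutes_in_image[OF assms(1)])
  ultimately show ?case
    by (simp only: weyl_word.mult[OF mult.IH])
next
  case (deriv d D i)
  have "conj_op \<sigma> (\<lambda>p. pd i (D p)) = (\<lambda>p. pd (\<sigma> i) (conj_op \<sigma> D p))"
    by (simp add: conj_op_def fun_eq_iff perm_vars_pd permutes_bij[OF assms(1)])
  moreover have "\<sigma> i \<in> {1..n}"
    using deriv.hyps(2) by (simp only: permutes_in_image[OF assms(1)])
  ultimately show ?case
    by (simp only: weyl_word.deriv[OF deriv.IH])
qed

lemma weyl_part_conj:
  assumes "\<sigma> permutes {1..n}" and "D \<in> weyl_part n d"
  shows "conj_op \<sigma> D \<in> weyl_part n d"
  using assms(2) unfolding weyl_part_def
proof (induction rule: span_op_induct)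
  case (base D)
  then show ?case using weyl_word_conj[OF assms(1)] by (auto intro: oper.span_base)
qed (simp_all only: conj_op_0 conj_op_add conj_op_scale permutes_bij[OF assms(1)]
    oper.span_zero oper.span_add oper.span_scale)

lemma inv_ops_iff:
  "D \<in> inv_ops n m \<longleftrightarrow> D \<in> weyl n \<and> (\<forall>\<sigma>. \<sigma> permutes {1..m} \<longrightarrow> conj_op \<sigma> D = D)"
  by (simp add: inv_ops_def conj_op_def)

lemma inv_ops_weyl: "D \<in> inv_ops n m \<Longrightarrow> D \<in> weyl n"
  and inv_ops_lin: "D \<in> inv_ops n m \<Longrightarrow> lin D"
  by (auto simp: inv_ops_iff weyl_lin)

lemma inv_ops_commute:
  assumes "D \<in> inv_ops n m" and "\<sigma> permutes {1..m}"
  shows "perm_vars \<sigma> (D p) = D (perm_vars \<sigma> p)"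
proof -
  have "conj_op \<sigma> D (perm_vars \<sigma> p) = D (perm_vars \<sigma> p)"
    using assms by (simp add: inv_ops_iff)
  then show ?thesis
    by (simp add: conj_op_def permutes_bij[OF assms(2)])
qed

lemma inv_opsI: "D \<in> weyl n \<Longrightarrow> (\<And>\<sigma>. \<sigma> permutes {1..m} \<Longrightarrow> conj_op \<sigma> D = D) \<Longrightarrow> D \<in> inv_ops n m"
  and inv_opsD: "D \<in> inv_ops n m \<Longrightarrow> \<sigma> permutes {1..m} \<Longrightarrow> conj_op \<sigma> D = D"
  unfolding inv_ops_iff by blast+

lemma inv_ops_0: "0 \<in> inv_ops n m"
  by (rule inv_opsI) (rule weyl_0, rule conj_op_0, rule permutes_bij)

lemma inv_ops_id: "id \<in> inv_ops n m"
  using weyl_part_subset weyl_part_word[OF weyl_word.one]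
  by (intro inv_opsI conj_op_id permutes_bij) blast

lemma inv_ops_add:
  assumes "D \<in> inv_ops n m" and "E \<in> inv_ops n m"
  shows "D + E \<in> inv_ops n m"
  by (rule inv_opsI, intro weyl_add inv_ops_weyl[of _ n m] assms)
    (simp only: conj_op_add[OF permutes_bij] inv_opsD[OF assms(1)] inv_opsD[OF assms(2)])

lemma inv_ops_scale:
  assumes "D \<in> inv_ops n m"
  shows "op_scale c D \<in> inv_ops n m"
  by (rule inv_opsI, intro weyl_scale inv_ops_weyl[of _ n m] assms)
    (simp only: conj_op_scale[OF permutes_bij] inv_opsD[OF assms])

lemma inv_ops_comp:
  assumes "D \<in> inv_ops n m" and "E \<in> inv_ops n m"
  shows "D \<circ> E \<in> inv_ops n m"
  by (rule inv_opsI, intro weyl_comp inv_ops_weyl[of _ n m] assms)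
    (simp only: conj_op_comp[OF permutes_bij] inv_opsD[OF assms(1)] inv_opsD[OF assms(2)])

lemma inv_ops_mono: "m \<le> m' \<Longrightarrow> inv_ops n m' \<subseteq> inv_ops n m"
proof
  fix D
  assume le: "m \<le> m'" and D: "D \<in> inv_ops n m'"
  have "\<sigma> permutes {1..m'}" if "\<sigma> permutes {1..m}" for \<sigma>
    by (rule permutes_subset[OF that]) (use le in auto)
  then show "D \<in> inv_ops n m"
    using D by (intro inv_opsI inv_ops_weyl[OF D]) (rule inv_opsD)
qed

text \<open>
  The averaging operator up to the factor \<open>m!\<close>.
\<close>
definition sym_op :: "nat \<Rightarrow> (cpoly \<Rightarrow> cpoly) \<Rightarrow> cpoly \<Rightarrow> cpoly" where
  "sym_op m D = (\<Sum>\<sigma> | \<sigma> permutes {1..m}. conj_op \<sigma> D)"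

lemma sym_op_weyl_part:
  assumes "m \<le> n" and "D \<in> weyl_part n d"
  shows "sym_op m D \<in> weyl_part n d"
  unfolding sym_op_def
  by (rule weyl_part_sum) (use assms permutes_subset[of _ "{1..m}" "{1..n}"] in \<open>auto intro!: weyl_part_conj\<close>)

lemma conj_sym_op:
  assumes "\<tau> permutes {1..m}"
  shows "conj_op \<tau> (sym_op m D) = sym_op m D"
proof -
  have "conj_op \<tau> (sym_op m D) = (\<Sum>\<sigma> | \<sigma> permutes {1..m}. conj_op (\<tau> \<circ> \<sigma>) D)"
    unfolding sym_op_def conj_op_sum[OF permutes_bij[OF assms]]
    by (rule sum.cong) (auto simp: conj_op_conj_op permutes_bij[OF assms] permutes_bij)
  also have "\<dots> = sym_op m D"
    unfolding sym_op_def using setum_permutations_compose_left[OF assms, of "\<lambda>\<sigma>. conj_op \<sigma> D"]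
    by simp
  finally show ?thesis .
qed

lemma sym_op_inv_ops:
  assumes "m \<le> n" and "D \<in> weyl_part n d"
  shows "sym_op m D \<in> inv_ops n m"
  using sym_op_weyl_part[OF assms] weyl_part_subset
  by (intro inv_opsI conj_sym_op) (rule subsetD)

lemma sym_op_invariant:
  assumes "D \<in> inv_ops n m"
  shows "sym_op m D = op_scale (fact m) D"
proof -
  have "sym_op m D = (\<Sum>\<sigma> | \<sigma> permutes {1..m}. D)"
    unfolding sym_op_def using assms by (intro sum.cong) (auto simp: inv_ops_iff)
  also have "\<dots> = op_scale (of_nat (fact m)) D"
    unfolding op_scale_def cscale_def single_of_nat
    by (rule ext, subst sum_op_apply) (simp add: card_permutations[of "{1..m}" m])
  finally show ?thesis by simp
qed

lemma sym_op_sum: "sym_op m (\<Sum>i\<in>I. F i) = (\<Sum>i\<in>I. sym_op m (F i))"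
proof -
  have "sym_op m (\<Sum>i\<in>I. F i) = (\<Sum>\<sigma> | \<sigma> permutes {1..m}. \<Sum>i\<in>I. conj_op \<sigma> (F i))"
    unfolding sym_op_def by (rule sum.cong) (auto simp only: mem_Collect_eq conj_op_sum permutes_bij)
  then show ?thesis
    unfolding sym_op_def by (subst sum.swap) 
qed

text \<open>
  The graded parts of an invariant operator need not be invariant a priori, since a decomposition
  into words is not unique; averaging it over the group makes them so.
\<close>
lemma inv_ops_graded:
  assumes "m \<le> n" and "D \<in> inv_ops n m"
  obtains I G where "finite I" and "\<And>d. d \<in> I \<Longrightarrow> G d \<in> inv_ops n m \<inter> weyl_part n d"
    and "D = (\<Sum>d\<in>I. G d)"
proof -
  obtain I G where I: "finite I" "\<And>d. d \<in> I \<Longrightarrow> G d \<in> weyl_part n d" "D = (\<Sum>d\<in>I. G d)"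
    using weyl_graded[OF inv_ops_weyl[OF assms(2)]] by blast
  define H where "H d = op_scale (1 / fact m) (sym_op m (G d))" for d
  have "D = op_scale (1 / fact m) (op_scale (fact m) D)"
    by (simp only: oper.scale_scale) (simp add: fun_eq_iff op_scale_def)
  also have "\<dots> = op_scale (1 / fact m) (\<Sum>d\<in>I. sym_op m (G d))"
    by (simp only: sym_op_invariant[OF assms(2), symmetric] sym_op_sum[symmetric] I(3)[symmetric])
  also have "\<dots> = (\<Sum>d\<in>I. H d)"
    by (simp only: H_def oper.scale_sum_right)
  finally have "D = (\<Sum>d\<in>I. H d)" .
  moreover have "H d \<in> inv_ops n m \<inter> weyl_part n d" if "d \<in> I" for d
    unfolding H_def
    by (intro IntI inv_ops_scale weyl_part_scale sym_op_inv_ops[OF assms(1) I(2)]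
        sym_op_weyl_part[OF assms(1) I(2)] that)
  ultimately show ?thesis using that I(1) by blast
qed

section \<open>Homogeneous polynomials\<close>

text \<open>
  Degrees are integers here, so that an operator of degree \<open>d\<close> shifts them by \<open>d\<close> without a case
  distinction: a polynomial that is homogeneous of negative degree is zero.
\<close>
definition hdeg :: "int \<Rightarrow> cpoly \<Rightarrow> bool" where
  "hdeg e p \<longleftrightarrow> (\<forall>\<gamma>\<in>keys p. int (mon_degree \<gamma>) = e)"

lemma hdegI: "(\<And>\<gamma>. lookup p \<gamma> \<noteq> 0 \<Longrightarrow> int (mon_degree \<gamma>) = e) \<Longrightarrow> hdeg e p"
  and hdegD: "hdeg e p \<Longrightarrow> lookup p \<gamma> \<noteq> 0 \<Longrightarrow> int (mon_degree \<gamma>) = e"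
  by (auto simp: hdeg_def in_keys_iff)

lemma mon_degree_superset:
  "finite S \<Longrightarrow> keys \<gamma> \<subseteq> S \<Longrightarrow> mon_degree \<gamma> = (\<Sum>i\<in>S. lookup \<gamma> i)"
  unfolding mon_degree_def by (rule sum.mono_neutral_left) (auto simp: in_keys_iff)

lemma mon_degree_add [simp]: "mon_degree (\<alpha> + \<beta>) = mon_degree \<alpha> + mon_degree \<beta>"
proof -
  have "keys (\<alpha> + \<beta>) \<subseteq> keys \<alpha> \<union> keys \<beta>"
    by (auto simp: in_keys_iff lookup_add)
  then show ?thesis
    using mon_degree_superset[of "keys \<alpha> \<union> keys \<beta>"] by (simp add: lookup_add sum.distrib)
qed

lemma mon_degree_single [simp]: "mon_degree (single i k) = k"
  by (simp add: mon_degree_def)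

lemma mon_degree_0 [simp]: "mon_degree 0 = 0"
  by (simp add: mon_degree_def)

lemma diff_unit_add:
  fixes \<gamma> :: "nat \<Rightarrow>\<^sub>0 nat"
  assumes "lookup \<gamma> i \<noteq> 0"
  shows "\<gamma> - unit_exp i + unit_exp i = \<gamma>"
  using assms
  by (auto simp: poly_mapping_eq_iff fun_eq_iff lookup_add lookup_minus lookup_single when_def)

lemma mon_degree_minus_unit:
  assumes "lookup \<gamma> i \<noteq> 0"
  shows "mon_degree \<gamma> = mon_degree (\<gamma> - unit_exp i) + 1"
  using arg_cong[OF diff_unit_add[OF assms], of mon_degree] unfolding mon_degree_add by simp

lemma hdeg_0 [simp]: "hdeg e 0"
  and hdeg_cscale: "hdeg e p \<Longrightarrow> hdeg e (cscale c p)"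
  by (simp_all add: hdeg_def in_keys_iff)

lemma hdeg_add:
  assumes "hdeg e p" and "hdeg e q"
  shows "hdeg e (p + q)"
proof (rule hdegI)
  fix \<gamma>
  assume "lookup (p + q) \<gamma> \<noteq> 0"
  then have "lookup p \<gamma> \<noteq> 0 \<or> lookup q \<gamma> \<noteq> 0" by (auto simp: lookup_add)
  then show "int (mon_degree \<gamma>) = e" using assms hdegD by blast
qed

lemma hdeg_uminus: "hdeg e p \<Longrightarrow> hdeg e (- p)"
  by (metis cscale_minus1 hdeg_cscale)

lemma hdeg_diff: "hdeg e p \<Longrightarrow> hdeg e q \<Longrightarrow> hdeg e (p - q)"
  by (metis add_uminus_conv_diff hdeg_add hdeg_uminus)

lemma hdeg_X:
  assumes "hdeg e p"
  shows "hdeg (e + 1) (X i * p)"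
proof (rule hdegI)
  fix \<gamma>
  assume "lookup (X i * p) \<gamma> \<noteq> 0"
  then have "lookup \<gamma> i \<noteq> 0" and "lookup p (\<gamma> - unit_exp i) \<noteq> 0"
    by (auto simp: lookup_X_mult split: if_splits)
  then show "int (mon_degree \<gamma>) = e + 1"
    using mon_degree_minus_unit[of \<gamma> i] hdegD[OF assms] by simp
qed

lemma hdeg_pd:
  assumes "hdeg e p"
  shows "hdeg (e - 1) (pd i p)"
proof (rule hdegI)
  fix \<gamma>
  assume "lookup (pd i p) \<gamma> \<noteq> 0"
  then have "lookup p (\<gamma> + unit_exp i) \<noteq> 0"
    by (simp add: lookup_pd)
  then show "int (mon_degree \<gamma>) = e - 1"
    using hdegD[OF assms] by fastforce
qed

lemma weyl_word_hdeg: "weyl_word n d D \<Longrightarrow> hdeg e p \<Longrightarrow> hdeg (e + d) (D p)"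
proof (induction rule: weyl_word.induct)
  case one
  then show ?case by simp
next
  case (mult d D i)
  then show ?case using hdeg_X by (metis add.assoc)
next
  case (deriv d D i)
  then show ?case using hdeg_pd by (metis add_diff_eq)
qed

lemma weyl_part_hdeg:
  assumes "D \<in> weyl_part n d" and "hdeg e p"
  shows "hdeg (e + d) (D p)"
  using assms(1) unfolding weyl_part_def
  by (induction rule: span_op_induct)
    (auto simp: op_scale_def weyl_word_hdeg assms(2) intro: hdeg_add hdeg_cscale)

lemma hdeg_neg:
  assumes "hdeg e p" and "e < 0"
  shows "p = 0"
  by (rule poly_mapping_eqI) (use assms(2) hdegD[OF assms(1)] in force)

lemma hdeg_unique:
  assumes "hdeg e p" and "hdeg e' p" and "e \<noteq> e'"
  shows "p = 0"
  by (rule poly_mapping_eqI) (use assms hdegD[OF assms(1)] hdegD[OF assms(2)] in \<open>auto\<close>)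

definition hom_part :: "int \<Rightarrow> cpoly \<Rightarrow> cpoly" where
  "hom_part e p = (\<Sum>\<gamma>\<in>{\<gamma>\<in>keys p. int (mon_degree \<gamma>) = e}. single \<gamma> (lookup p \<gamma>))"

lemma lookup_hom_part: "lookup (hom_part e p) \<gamma> = (if int (mon_degree \<gamma>) = e then lookup p \<gamma> else 0)"
  by (simp add: hom_part_def lookup_sum lookup_single when_def in_keys_iff)

lemma hdeg_hom_part: "hdeg e (hom_part e p)"
  by (rule hdegI) (auto simp: lookup_hom_part split: if_splits)

lemma hom_part_add: "hom_part e (p + q) = hom_part e p + hom_part e q"
  by (simp add: poly_mapping_eq_iff fun_eq_iff lookup_hom_part lookup_add)

lemma hom_part_0 [simp]: "hom_part e 0 = 0"
  by (simp add: poly_mapping_eq_iff fun_eq_iff lookup_hom_part)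

lemma hom_part_sum: "hom_part e (\<Sum>i\<in>I. f i) = (\<Sum>i\<in>I. hom_part e (f i))"
  by (induction I rule: infinite_finite_induct) (simp_all add: hom_part_add)

lemma hom_part_hdeg: "hdeg e p \<Longrightarrow> hom_part e' p = (if e' = e then p else 0)"
  by (rule poly_mapping_eqI) (use hdegD[of e p] in \<open>auto simp: lookup_hom_part\<close>)

lemma sum_comps: "p = (\<Sum>e\<in>(\<lambda>\<gamma>. int (mon_degree \<gamma>)) ` keys p. hom_part e p)"
proof (rule poly_mapping_eqI)
  fix \<gamma>
  show "lookup p \<gamma> = lookup (\<Sum>e\<in>(\<lambda>\<gamma>. int (mon_degree \<gamma>)) ` keys p. hom_part e p) \<gamma>"
    by (auto simp: lookup_sum lookup_hom_part in_keys_iff)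
qed

lemma polysI: "(\<And>\<gamma> i. lookup p \<gamma> \<noteq> 0 \<Longrightarrow> lookup \<gamma> i \<noteq> 0 \<Longrightarrow> i \<in> {1..n}) \<Longrightarrow> p \<in> polys n"
  unfolding polys_def by (auto simp: subset_iff in_keys_iff)

lemma polysD: "p \<in> polys n \<Longrightarrow> lookup p \<gamma> \<noteq> 0 \<Longrightarrow> lookup \<gamma> i \<noteq> 0 \<Longrightarrow> i \<in> {1..n}"
  unfolding polys_def by (auto simp: subset_iff in_keys_iff)

lemma polys_0: "0 \<in> polys n"
  by (simp add: polys_def)

lemma polys_add: "p \<in> polys n \<Longrightarrow> q \<in> polys n \<Longrightarrow> p + q \<in> polys n"
proof (rule polysI)
  fix \<gamma> i
  assume a: "p \<in> polys n" "q \<in> polys n" "lookup (p + q) \<gamma> \<noteq> 0" "lookup \<gamma> i \<noteq> 0"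
  then have "lookup p \<gamma> \<noteq> 0 \<or> lookup q \<gamma> \<noteq> 0" by (auto simp: lookup_add)
  then show "i \<in> {1..n}" using a polysD by blast
qed

lemma polys_cscale: "p \<in> polys n \<Longrightarrow> cscale c p \<in> polys n"
  by (rule polysI) (auto dest: polysD)

lemma polys_X: "p \<in> polys n \<Longrightarrow> i \<in> {1..n} \<Longrightarrow> X i * p \<in> polys n"
proof (rule polysI)
  fix \<gamma> j
  assume a: "p \<in> polys n" "i \<in> {1..n}" "lookup (X i * p) \<gamma> \<noteq> 0" "lookup \<gamma> j \<noteq> 0"
  show "j \<in> {1..n}"
  proof (cases "j = i")
    case False
    then show ?thesis
      using a polysD[of p n "\<gamma> - unit_exp i" j]
      by (auto simp: lookup_X_mult lookup_minus lookup_single split: if_splits)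
  qed (use a in simp)
qed

lemma polys_pd: "p \<in> polys n \<Longrightarrow> pd i p \<in> polys n"
proof (rule polysI)
  fix \<gamma> j
  assume a: "p \<in> polys n" "lookup (pd i p) \<gamma> \<noteq> 0" "lookup \<gamma> j \<noteq> 0"
  then show "j \<in> {1..n}"
    using polysD[of p n "\<gamma> + unit_exp i" j] by (auto simp: lookup_pd lookup_add)
qed

lemma weyl_word_polys: "weyl_word n d D \<Longrightarrow> p \<in> polys n \<Longrightarrow> D p \<in> polys n"
  by (induction rule: weyl_word.induct) (simp_all add: polys_X polys_pd)

lemma weyl_polys:
  assumes "D \<in> weyl n" and "p \<in> polys n"
  shows "D p \<in> polys n"
  using assms(1) unfolding weyl_def
  by (induction rule: span_op_induct)
    (auto simp: op_scale_def weyl_word_polys assms(2) polys_0 intro: polys_add polys_cscale)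


section \<open>The Fischer inner product\<close>

definition mfact :: "(nat \<Rightarrow>\<^sub>0 nat) \<Rightarrow> nat" where
  "mfact \<gamma> = (\<Prod>i\<in>keys \<gamma>. fact (lookup \<gamma> i))"

lemma mfact_superset: "finite S \<Longrightarrow> keys \<gamma> \<subseteq> S \<Longrightarrow> mfact \<gamma> = (\<Prod>i\<in>S. fact (lookup \<gamma> i))"
  unfolding mfact_def by (rule prod.mono_neutral_left) (auto simp: in_keys_iff)

lemma mfact_add_unit: "mfact (\<gamma> + unit_exp i) = Suc (lookup \<gamma> i) * mfact \<gamma>"
proof -
  let ?S = "insert i (keys \<gamma>)"
  have 1: "finite ?S" by simp
  have "keys (\<gamma> + unit_exp i) \<subseteq> ?S"
    by (auto simp: in_keys_iff lookup_add lookup_single when_def split: if_splits)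
  then have "mfact (\<gamma> + unit_exp i) = (\<Prod>j\<in>?S. fact (lookup (\<gamma> + unit_exp i) j))"
    using 1 mfact_superset by blast
  also have "\<dots> = (\<Prod>j\<in>?S. (if j = i then Suc (lookup \<gamma> i) else 1) * fact (lookup \<gamma> j))"
    by (rule prod.cong) (auto simp: lookup_add lookup_single One_nat_def)
  also have "\<dots> = Suc (lookup \<gamma> i) * (\<Prod>j\<in>?S. fact (lookup \<gamma> j))"
    by (simp add: prod.distrib prod.delta del: prod.insert)
  also have "(\<Prod>j\<in>?S. fact (lookup \<gamma> j)) = mfact \<gamma>"
    using 1 by (intro mfact_superset[symmetric]) auto
  finally show ?thesis .
qed

lemma mfact_map_key:
  assumes "bij \<sigma>"
  shows "mfact (Poly_Mapping.map_key \<sigma> \<gamma>) = mfact \<gamma>"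
proof -
  have "keys \<gamma> = \<sigma> ` keys (Poly_Mapping.map_key \<sigma> \<gamma>)"
    using assms by (simp add: keys_map_key bij_is_inj bij_is_surj surj_image_vimage_eq)
  then have "mfact \<gamma> = (\<Prod>i\<in>\<sigma> ` keys (Poly_Mapping.map_key \<sigma> \<gamma>). fact (lookup \<gamma> i))"
    by (simp add: mfact_def)
  also have "\<dots> = mfact (Poly_Mapping.map_key \<sigma> \<gamma>)"
    unfolding mfact_def using assms
    by (subst prod.reindex) (auto simp: lookup_map_key_bij intro: inj_on_subset bij_is_inj)
  finally show ?thesis by simp
qed

lemma mfact_pos: "mfact \<gamma> > 0"
  by (simp add: mfact_def prod_pos)

text \<open>
  The Hermitian form that takes \<open>(p, q)\<close> to the constant term of \<open>p(\<partial>\<^sub>1, \<partial>\<^sub>2, \<dots>)\<close> applied to the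
  complex conjugate of \<open>q\<close>.
\<close>
definition ip :: "cpoly \<Rightarrow> cpoly \<Rightarrow> complex" where
  "ip p q = (\<Sum>\<gamma>\<in>keys p. of_nat (mfact \<gamma>) * lookup p \<gamma> * cnj (lookup q \<gamma>))"

lemma ip_superset:
  "finite S \<Longrightarrow> keys p \<subseteq> S \<Longrightarrow> ip p q = (\<Sum>\<gamma>\<in>S. of_nat (mfact \<gamma>) * lookup p \<gamma> * cnj (lookup q \<gamma>))"
  unfolding ip_def by (rule sum.mono_neutral_left) (auto simp: in_keys_iff)

lemma ip_commute: "ip q p = cnj (ip p q)"
  using ip_superset[of "keys p \<union> keys q" p q] ip_superset[of "keys p \<union> keys q" q p]
  by (simp add: mult.commute mult.left_commute)

lemma ip_add_left: "ip (p + p') q = ip p q + ip p' q"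
proof -
  let ?S = "keys p \<union> keys p'"
  have "keys (p + p') \<subseteq> ?S" by (rule keys_add)
  then show ?thesis
    using ip_superset[of ?S "p + p'" q] ip_superset[of ?S p q] ip_superset[of ?S p' q]
    by (simp add: lookup_add algebra_simps sum.distrib)
qed

lemma ip_add_right: "ip q (p + p') = ip q p + ip q p'"
  by (metis complex_cnj_add ip_add_left ip_commute)

lemma ip_cscale_left: "ip (cscale c p) q = c * ip p q"
  using ip_superset[of "keys p" "cscale c p" q]
  by (simp add: ip_def in_keys_iff subset_iff sum_distrib_left mult.assoc mult.left_commute)

lemma ip_cscale_right: "ip q (cscale c p) = cnj c * ip q p"
  by (metis complex_cnj_mult ip_cscale_left ip_commute)

lemma ip_0_left [simp]: "ip 0 q = 0" and ip_0_right [simp]: "ip q 0 = 0"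
  by (simp_all add: ip_def)

lemma ip_uminus_left: "ip (- p) q = - ip p q"
  by (metis cscale_minus1 ip_cscale_left mult_minus1)

lemma ip_diff_left: "ip (p - p') q = ip p q - ip p' q"
  by (metis add_uminus_conv_diff ip_add_left ip_uminus_left)

lemma ip_diff_right: "ip q (p - p') = ip q p - ip q p'"
  by (metis complex_cnj_diff ip_commute ip_diff_left)

lemma ip_sum_left: "ip (\<Sum>i\<in>I. f i) q = (\<Sum>i\<in>I. ip (f i) q)"
  by (induction I rule: infinite_finite_induct) (simp_all add: ip_add_left)

lemma ip_self: "ip p p = 0 \<longleftrightarrow> p = 0"
proof
  assume "ip p p = 0"
  have "ip p p = of_real (\<Sum>\<gamma>\<in>keys p. real (mfact \<gamma>) * (cmod (lookup p \<gamma>))\<^sup>2)"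
    unfolding ip_def of_real_sum of_real_mult of_real_of_nat_eq complex_norm_square
    by (simp only: mult.assoc)
  with \<open>ip p p = 0\<close> have "(\<Sum>\<gamma>\<in>keys p. real (mfact \<gamma>) * (cmod (lookup p \<gamma>))\<^sup>2) = 0"
    by (metis of_real_eq_0_iff)
  then have "\<forall>\<gamma>\<in>keys p. real (mfact \<gamma>) * (cmod (lookup p \<gamma>))\<^sup>2 = 0"
    by (subst (asm) sum_nonneg_eq_0_iff) auto
  then have "lookup p \<gamma> = 0" if "\<gamma> \<in> keys p" for \<gamma>
    using that mfact_pos[of \<gamma>] by fastforce
  then have "keys p = {}"
    by (metis all_not_in_conv in_keys_iff)
  then show "p = 0" by simp
qed simp

text \<open>
  Homogeneous polynomials of different degrees have no common monomials.
\<close>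
lemma ip_hom_part:
  assumes "hdeg d u"
  shows "ip u z = ip u (hom_part d z)"
  unfolding ip_def
  by (rule sum.cong) (use assms in \<open>auto simp: hdeg_def lookup_hom_part\<close>)

lemma ip_perm_vars:
  assumes "bij \<sigma>"
  shows "ip (perm_vars \<sigma> p) (perm_vars \<sigma> q) = ip p q"
proof -
  let ?k = "Poly_Mapping.map_key \<sigma> :: (nat \<Rightarrow>\<^sub>0 nat) \<Rightarrow> nat \<Rightarrow>\<^sub>0 nat"
  have "surj ?k"
  proof (rule surjI)
    fix \<gamma> :: "nat \<Rightarrow>\<^sub>0 nat"
    show "?k (Poly_Mapping.map_key (inv \<sigma>) \<gamma>) = \<gamma>"
      using assms by (auto simp: poly_mapping_eq_iff fun_eq_iff lookup_map_key_bij bij_imp_bij_inv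
          bij_is_inj)
  qed
  then have "keys p = ?k ` keys (perm_vars \<sigma> p)"
    using assms inj_map_key[OF assms]
    by (simp add: perm_vars_def keys_map_key surj_image_vimage_eq)
  then have "ip p q = (\<Sum>\<gamma>\<in>?k ` keys (perm_vars \<sigma> p). of_nat (mfact \<gamma>) * lookup p \<gamma> * cnj (lookup q \<gamma>))"
    by (simp add: ip_def)
  also have "\<dots> = ip (perm_vars \<sigma> p) (perm_vars \<sigma> q)"
    unfolding ip_def using assms
    by (subst sum.reindex)
      (auto simp: lookup_perm_vars mfact_map_key intro: inj_on_subset[OF inj_map_key])
  finally show ?thesis by simp
qed

lemma ip_X: "ip (X i * p) q = ip p (pd i q)"
proof -
  have "keys (X i * p) = (\<lambda>\<gamma>. \<gamma> + unit_exp i) ` keys p"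
  proof (rule set_eqI)
    fix \<gamma>
    show "\<gamma> \<in> keys (X i * p) \<longleftrightarrow> \<gamma> \<in> (\<lambda>\<gamma>. \<gamma> + unit_exp i) ` keys p"
      by (auto simp: in_keys_iff lookup_X_mult lookup_add image_iff diff_unit_add
          intro!: bexI[of _ "\<gamma> - unit_exp i"] split: if_splits)
  qed
  then have "ip (X i * p) q = (\<Sum>\<gamma>\<in>(\<lambda>\<gamma>. \<gamma> + unit_exp i) ` keys p.
      of_nat (mfact \<gamma>) * lookup (X i * p) \<gamma> * cnj (lookup q \<gamma>))"
    by (simp add: ip_def)
  also have "\<dots> = (\<Sum>\<gamma>\<in>keys p. of_nat (mfact \<gamma>) * lookup p \<gamma> * cnj (lookup (pd i q) \<gamma>))"
  proof (subst sum.reindex, simp add: inj_on_def, rule sum.cong[OF refl])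
    fix \<gamma>
    have "lookup (X i * p) (\<gamma> + unit_exp i) = lookup p \<gamma>"
      by (simp add: lookup_X_mult lookup_add)
    then show "((\<lambda>\<gamma>. of_nat (mfact \<gamma>) * lookup (X i * p) \<gamma> * cnj (lookup q \<gamma>)) \<circ> (\<lambda>\<gamma>. \<gamma> + unit_exp i)) \<gamma> =
        of_nat (mfact \<gamma>) * lookup p \<gamma> * cnj (lookup (pd i q) \<gamma>)"
      unfolding comp_apply lookup_pd mfact_add_unit of_nat_mult complex_cnj_mult complex_cnj_of_nat
      by (simp only: mult.assoc mult.left_commute mult.commute)
  qed
  finally show ?thesis by (simp add: ip_def)
qed

lemma ip_pd: "ip (pd i p) q = ip p (X i * q)"
  by (metis ip_X ip_commute)

text \<open>
  Since \<open>x\<^sub>i\<close> and \<open>\<partial>\<^sub>i\<close> are adjoint to each other, the Weyl algebra and its rings of invariants are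
  closed under adjoints, and taking adjoints reverses the sign of the degree. This is what makes
  orthogonal complements of submodules submodules.
\<close>
lemma weyl_word_adjoint:
  "weyl_word n d D \<Longrightarrow> \<exists>D'\<in>weyl_part n (- d). \<forall>p q. ip (D p) q = ip p (D' q)"
proof (induction rule: weyl_word.induct)
  case one
  then show ?case using weyl_part_word[OF weyl_word.one] by (intro bexI[of _ id]) simp_all
next
  case (mult d D i)
  then obtain D' where D': "D' \<in> weyl_part n (- d)" "\<And>p q. ip (D p) q = ip p (D' q)" by blast
  have "weyl_word n (- 1) (pd i)"
    using weyl_word.deriv[OF weyl_word.one mult.hyps(2)] by simp
  then have "D' \<circ> pd i \<in> weyl_part n (- d + - 1)"
    using D'(1) weyl_part_comp weyl_part_word by blast
  then show ?case
    using D'(2) by (intro bexI[of _ "D' \<circ> pd i"]) (simp_all add: ip_X add.commute)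
next
  case (deriv d D i)
  then obtain D' where D': "D' \<in> weyl_part n (- d)" "\<And>p q. ip (D p) q = ip p (D' q)" by blast
  have "weyl_word n 1 (\<lambda>p. X i * p)"
    using weyl_word.mult[OF weyl_word.one deriv.hyps(2)] by simp
  then have "D' \<circ> (\<lambda>p. X i * p) \<in> weyl_part n (- d + 1)"
    using D'(1) weyl_part_comp weyl_part_word by blast
  then show ?case
    using D'(2) by (intro bexI[of _ "D' \<circ> (\<lambda>p. X i * p)"]) (simp_all add: ip_pd add.commute)
qed

lemma weyl_part_adjoint:
  assumes "D \<in> weyl_part n d"
  shows "\<exists>D'\<in>weyl_part n (- d). \<forall>p q. ip (D p) q = ip p (D' q)"
  using assms unfolding weyl_part_def[of n d]
proof (induction rule: span_op_induct)
  case (base D)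
  then show ?case using weyl_word_adjoint by blast
next
  case zero
  show ?case by (intro bexI[of _ 0] weyl_part_0) simp
next
  case (add D E)
  then obtain D' E' where *: "D' \<in> weyl_part n (- d)" "\<And>p q. ip (D p) q = ip p (D' q)"
    "E' \<in> weyl_part n (- d)" "\<And>p q. ip (E p) q = ip p (E' q)" by blast
  show ?case
    by (intro bexI[of _ "D' + E'"] weyl_part_add *(1,3)) (simp add: ip_add_left ip_add_right *(2,4))
next
  case (scale c D)
  then obtain D' where *: "D' \<in> weyl_part n (- d)" "\<And>p q. ip (D p) q = ip p (D' q)" by blast
  show ?case
    by (intro bexI[of _ "op_scale (cnj c) D'"] weyl_part_scale *(1))
      (simp add: op_scale_def ip_cscale_left ip_cscale_right *(2))
qed

text \<open>
  Permutations of the variables are unitary, so that the adjoint of an invariant operator commutes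
  with them as well; here adjoints are unique because the form is definite.
\<close>
lemma inv_part_adjoint:
  assumes "D \<in> inv_ops n m" and "D \<in> weyl_part n d"
  obtains D' where "D' \<in> inv_ops n m" and "D' \<in> weyl_part n (- d)"
    and "\<And>p q. ip (D p) q = ip p (D' q)"
proof -
  obtain D' where D': "D' \<in> weyl_part n (- d)" "\<And>p q. ip (D p) q = ip p (D' q)"
    using weyl_part_adjoint[OF assms(2)] by blast
  have "conj_op \<sigma> D' = D'" if \<sigma>: "\<sigma> permutes {1..m}" for \<sigma>
  proof
    fix q
    have b: "bij \<sigma>" by (rule permutes_bij[OF \<sigma>])
    have "ip p (conj_op \<sigma> D' q) = ip p (D' q)" for p
    proof -
      have "ip p (conj_op \<sigma> D' q) = ip (perm_vars \<sigma> (perm_vars (inv \<sigma>) p)) (conj_op \<sigma> D' q)"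
        using b by simp
      also have "\<dots> = ip (perm_vars (inv \<sigma>) p) (D' (perm_vars (inv \<sigma>) q))"
        by (simp only: conj_op_def comp_apply ip_perm_vars[OF b])
      also have "\<dots> = ip (perm_vars \<sigma> (D (perm_vars (inv \<sigma>) p))) (perm_vars \<sigma> (perm_vars (inv \<sigma>) q))"
        by (simp only: D'(2) ip_perm_vars[OF b])
      also have "\<dots> = ip (D p) q"
        using b by (simp add: inv_ops_commute[OF assms(1) \<sigma>])
      finally show ?thesis by (simp add: D'(2))
    qed
    then have "ip (conj_op \<sigma> D' q - D' q) (conj_op \<sigma> D' q - D' q) = 0"
      by (simp add: ip_diff_right)
    then show "conj_op \<sigma> D' q = D' q"
      by (simp add: ip_self)
  qed
  then have "D' \<in> inv_ops n m"
    using D'(1) weyl_part_subset by (intro inv_opsI) blast+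
  then show ?thesis using that D' by blast
qed

lemma inv_ops_adjoint:
  assumes "m \<le> n" and "D \<in> inv_ops n m"
  obtains D' where "D' \<in> inv_ops n m" and "\<And>p q. ip (D p) q = ip p (D' q)"
proof -
  obtain I G where I: "finite I" "\<And>d. d \<in> I \<Longrightarrow> G d \<in> inv_ops n m \<inter> weyl_part n d" "D = (\<Sum>d\<in>I. G d)"
    using inv_ops_graded[OF assms] by blast
  have "\<exists>D'. D' \<in> inv_ops n m \<and> (\<forall>p q. ip ((\<Sum>d\<in>J. G d) p) q = ip p (D' q))" if "J \<subseteq> I" for J
    using finite_subset[OF that I(1)] that
  proof (induction rule: finite_induct)
    case empty
    show ?case by (intro exI[of _ 0] conjI inv_ops_0) (simp only: sum.empty zero_fun_apply ip_0_left ip_0_right simp_thms)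
  next
    case (insert x J)
    then obtain D' where D': "D' \<in> inv_ops n m" "\<And>p q. ip ((\<Sum>d\<in>J. G d) p) q = ip p (D' q)" by blast
    obtain E where E: "E \<in> inv_ops n m" "\<And>p q. ip (G x p) q = ip p (E q)"
      using I(2)[of x] insert.prems by (meson IntD1 IntD2 insert_subset inv_part_adjoint)
    show ?case
      using insert.hyps
      by (intro exI[of _ "E + D'"] conjI inv_ops_add D'(1) E(1))
        (simp add: ip_add_left ip_add_right D'(2) E(2))
  qed
  from this[of I] show ?thesis using that I(3) by blast
qed

section \<open>Submodules of the polynomial ring\<close>

lemma submodD:
  assumes "submod n m K"
  shows "K \<subseteq> polys n" and "0 \<in> K" and "p \<in> K \<Longrightarrow> q \<in> K \<Longrightarrow> p + q \<in> K"
    and "D \<in> inv_ops n m \<Longrightarrow> p \<in> K \<Longrightarrow> D p \<in> K"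
  using assms by (auto simp: submod_def)

lemma submod_cscale:
  assumes "submod n m K" and "p \<in> K"
  shows "cscale c p \<in> K"
  using submodD(4)[OF assms(1) inv_ops_scale[OF inv_ops_id] assms(2), of c]
  by (simp add: op_scale_def)

lemma submod_uminus: "submod n m K \<Longrightarrow> p \<in> K \<Longrightarrow> - p \<in> K"
  by (metis cscale_minus1 submod_cscale)

lemma submod_diff: "submod n m K \<Longrightarrow> p \<in> K \<Longrightarrow> q \<in> K \<Longrightarrow> p - q \<in> K"
  by (metis add_uminus_conv_diff submodD(3) submod_uminus)

lemma submod_sum: "submod n m K \<Longrightarrow> (\<And>i. i \<in> I \<Longrightarrow> f i \<in> K) \<Longrightarrow> (\<Sum>i\<in>I. f i) \<in> K"
  by (induction I rule: infinite_finite_induct) (simp_all add: submodD)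

lemma submod_restrict: "submod n m K \<Longrightarrow> m \<le> m' \<Longrightarrow> submod n m' K"
  using inv_ops_mono[of m m' n] unfolding submod_def by blast

lemma cyclicI: "D \<in> inv_ops n m \<Longrightarrow> D u \<in> cyclic n m u"
  by (auto simp: cyclic_def)

lemma cyclicE:
  assumes "y \<in> cyclic n m u"
  obtains D where "D \<in> inv_ops n m" and "y = D u"
  using assms by (auto simp: cyclic_def)

lemma cyclic_self: "u \<in> cyclic n m u"
  using cyclicI[OF inv_ops_id] by simp

lemma submod_cyclic:
  assumes "u \<in> polys n"
  shows "submod n m (cyclic n m u)"
  unfolding submod_def
proof (intro conjI ballI)
  show "cyclic n m u \<subseteq> polys n"
    using weyl_polys[OF inv_ops_weyl assms] by (auto elim: cyclicE)
  show "0 \<in> cyclic n m u"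
    using cyclicI[OF inv_ops_0] by simp
next
  fix p q
  assume "p \<in> cyclic n m u" "q \<in> cyclic n m u"
  then obtain D E where "D \<in> inv_ops n m" "E \<in> inv_ops n m" "p = D u" "q = E u"
    by (metis cyclicE)
  then show "p + q \<in> cyclic n m u"
    using cyclicI[OF inv_ops_add, of D n m E u] by simp
next
  fix D p
  assume "D \<in> inv_ops n m" and "p \<in> cyclic n m u"
  then obtain E where "E \<in> inv_ops n m" "p = E u" by (metis cyclicE)
  then show "D p \<in> cyclic n m u"
    using cyclicI[OF inv_ops_comp, of D n m E u] \<open>D \<in> inv_ops n m\<close> by simp
qed

lemma cyclic_subset:
  assumes "submod n m K" and "u \<in> K"
  shows "cyclic n m u \<subseteq> K"
  using assms submodD(4) by (auto elim: cyclicE)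

subsection \<open>The Euler operator and the grading of submodules\<close>

definition euler :: "nat \<Rightarrow> cpoly \<Rightarrow> cpoly" where
  "euler n = (\<Sum>i\<in>{1..n}. (\<lambda>p. X i * pd i p))"

lemma euler_weyl_part: "euler n \<in> weyl_part n 0"
  unfolding euler_def
proof (rule weyl_part_sum)
  fix i assume "i \<in> {1..n}"
  then have "weyl_word n (0 - 1 + 1) (\<lambda>p. X i * pd i (id p))"
    by (intro weyl_word.mult weyl_word.deriv weyl_word.one)
  then show "(\<lambda>p. X i * pd i p) \<in> weyl_part n 0"
    by (intro weyl_part_word) simp
qed

lemma euler_apply: "euler n p = (\<Sum>i\<in>{1..n}. X i * pd i p)"
  by (simp add: euler_def sum_op_apply)

lemma euler_inv_ops:
  assumes "m \<le> n"
  shows "euler n \<in> inv_ops n m"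
proof (rule inv_opsI)
  show "euler n \<in> weyl n" using euler_weyl_part weyl_part_subset by blast
next
  fix \<sigma>
  assume \<sigma>: "\<sigma> permutes {1..m}"
  then have n: "\<sigma> permutes {1..n}"
    by (rule permutes_subset) (use assms in auto)
  show "conj_op \<sigma> (euler n) = euler n"
  proof
    fix p
    have "conj_op \<sigma> (euler n) p = (\<Sum>i\<in>{1..n}. X (\<sigma> i) * pd (\<sigma> i) p)"
      by (simp add: conj_op_def euler_apply perm_vars_X_mult perm_vars_pd permutes_bij[OF \<sigma>]
          lin_sum[OF lin_perm_vars])
    also have "\<dots> = (\<Sum>i\<in>{1..n}. X i * pd i p)"
      using sum.permute[OF n, of "\<lambda>i. X i * pd i p"] by (simp add: comp_def)
    finally show "conj_op \<sigma> (euler n) p = euler n p" by (simp add: euler_apply)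
  qed
qed

lemma lookup_euler:
  assumes "p \<in> polys n"
  shows "lookup (euler n p) \<gamma> = of_nat (mon_degree \<gamma>) * lookup p \<gamma>"
proof (cases "lookup p \<gamma> = 0")
  case False
  have "lookup (euler n p) \<gamma> = (\<Sum>i\<in>{1..n}. of_nat (lookup \<gamma> i) * lookup p \<gamma>)"
    unfolding euler_apply lookup_sum
  proof (rule sum.cong[OF refl])
    fix i
    show "lookup (X i * pd i p) \<gamma> = of_nat (lookup \<gamma> i) * lookup p \<gamma>"
      by (cases "lookup \<gamma> i") (simp_all add: lookup_X_mult lookup_pd lookup_minus diff_unit_add)
  qed
  moreover have "mon_degree \<gamma> = (\<Sum>i\<in>{1..n}. lookup \<gamma> i)"
    using polysD[OF assms False] by (intro mon_degree_superset) (auto simp: in_keys_iff)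
  ultimately show ?thesis by (simp add: sum_distrib_right)
next
  case True
  have "lookup (X i * pd i p) \<gamma> = 0" for i
    by (cases "lookup \<gamma> i") (simp_all add: lookup_X_mult lookup_pd lookup_minus diff_unit_add True)
  then show ?thesis by (simp add: euler_apply lookup_sum True)
qed

lemma euler_hdeg:
  assumes "p \<in> polys n" and "hdeg e p"
  shows "euler n p = cscale (of_int e) p"
proof (rule poly_mapping_eqI)
  fix \<gamma>
  show "lookup (euler n p) \<gamma> = lookup (cscale (of_int e) p) \<gamma>"
    using hdegD[OF assms(2), of \<gamma>]
    by (cases "lookup p \<gamma> = 0") (auto simp: lookup_euler[OF assms(1)])
qed

lemma hdeg_eulerI:
  assumes "p \<in> polys n" and "euler n p = cscale (of_int e) p"
  shows "hdeg e p"
proof (rule hdegI)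
  fix \<gamma>
  assume "lookup p \<gamma> \<noteq> 0"
  moreover have "of_nat (mon_degree \<gamma>) * lookup p \<gamma> = of_int e * lookup p \<gamma>"
    using arg_cong[OF assms(2), of "\<lambda>q. lookup q \<gamma>"] by (simp add: lookup_euler[OF assms(1)])
  ultimately have "(of_int (int (mon_degree \<gamma>)) :: complex) = of_int e" by simp
  then show "int (mon_degree \<gamma>) = e" by (simp only: of_int_eq_iff)
qed

text \<open>
  The homogeneous components of an element are its projections to the eigenspaces of the Euler
  operator, which is invariant, so that they stay in the submodule.
\<close>
lemma submod_hom_part:
  assumes K: "submod n m K" and "m \<le> n" and "y \<in> K"
  shows "hom_part e y \<in> K"
proof -
  have gen: "\<forall>y\<in>K. (\<forall>\<gamma>. lookup y \<gamma> \<noteq> 0 \<longrightarrow> int (mon_degree \<gamma>) \<in> S) \<longrightarrow> (\<forall>e. hom_part e y \<in> K)"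
    if "finite S" for S
    using that
  proof (induction S rule: finite_induct)
    case empty
    have "y = 0" if "\<forall>\<gamma>. lookup y \<gamma> \<noteq> 0 \<longrightarrow> int (mon_degree \<gamma>) \<in> {}" for y :: cpoly
      using that by (intro poly_mapping_eqI) auto
    then show ?case using submodD(2)[OF K] by fastforce
  next
    case (insert s S)
    show ?case
    proof (intro ballI impI allI)
      fix y e
      assume y: "y \<in> K" and supp: "\<forall>\<gamma>. lookup y \<gamma> \<noteq> 0 \<longrightarrow> int (mon_degree \<gamma>) \<in> insert s S"
      \<comment> \<open>removes the component of degree \<open>s\<close> and rescales the others\<close>
      let ?y = "euler n y - cscale (of_int s) y"
      have yn: "y \<in> polys n" using y submodD(1)[OF K] by blast
      have lk: "lookup ?y \<gamma> = (of_nat (mon_degree \<gamma>) - of_int s) * lookup y \<gamma>" for \<gamma>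
        by (simp add: lookup_minus lookup_euler[OF yn] algebra_simps)
      have "?y \<in> K"
        using submod_diff[OF K] submodD(4)[OF K euler_inv_ops[OF \<open>m \<le> n\<close>] y] submod_cscale[OF K y] by blast
      moreover have "\<forall>\<gamma>. lookup ?y \<gamma> \<noteq> 0 \<longrightarrow> int (mon_degree \<gamma>) \<in> S"
      proof (intro allI impI)
        fix \<gamma>
        assume a: "lookup ?y \<gamma> \<noteq> 0"
        then have "int (mon_degree \<gamma>) \<noteq> s"
          unfolding lk by (metis cancel_comm_monoid_add_class.diff_cancel mult_zero_left of_int_of_nat_eq)
        moreover have "lookup y \<gamma> \<noteq> 0"
          using a unfolding lk by auto
        ultimately show "int (mon_degree \<gamma>) \<in> S" using supp by blast
      qed
      ultimately have IH: "hom_part e ?y \<in> K" for e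
        using insert.IH by blast
      have hom_part_y: "hom_part e ?y = cscale (of_int (e - s)) (hom_part e y)" for e
        by (rule poly_mapping_eqI) (auto simp: lookup_hom_part lk)
      have ne: "hom_part e y \<in> K" if "e \<noteq> s" for e
      proof -
        have "hom_part e y = cscale (1 / of_int (e - s)) (hom_part e ?y)"
          unfolding hom_part_y cp.scale_scale using that by simp
        then show ?thesis using submod_cscale[OF K IH] by simp
      qed
      have "hom_part s y = y - (\<Sum>e\<in>S. hom_part e y)"
      proof (rule poly_mapping_eqI)
        fix \<gamma>
        have "lookup (\<Sum>e\<in>S. hom_part e y) \<gamma> = (if int (mon_degree \<gamma>) \<in> S then lookup y \<gamma> else 0)"
          using insert.hyps(1) by (simp add: lookup_sum lookup_hom_part)
        then show "lookup (hom_part s y) \<gamma> = lookup (y - (\<Sum>e\<in>S. hom_part e y)) \<gamma>"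
          using supp insert.hyps(2) by (auto simp: lookup_minus lookup_hom_part)
      qed
      moreover have "(\<Sum>e\<in>S. hom_part e y) \<in> K"
        using insert.hyps(2) by (intro submod_sum[OF K] ne) auto
      ultimately have "hom_part s y \<in> K"
        using submod_diff[OF K y] by simp
      then show "hom_part e y \<in> K" using ne by (cases "e = s") auto
    qed
  qed
  show ?thesis
    using gen[of "(\<lambda>\<gamma>. int (mon_degree \<gamma>)) ` keys y"] assms(3) by (auto simp: in_keys_iff)
qed

subsection \<open>Lowest weight vectors and simple modules\<close>

text \<open>
  The vectors that are killed by \<open>\<D>\<^sub>m\<^sup>-\<close>, without reference to a surrounding module. Testing on graded
  operators is enough since these span \<open>\<D>\<^sub>m\<^sup>-\<close>.
\<close>
definition lowest :: "nat \<Rightarrow> nat \<Rightarrow> cpoly \<Rightarrow> bool" where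
  "lowest n m w \<longleftrightarrow> (\<forall>d<0. \<forall>D \<in> inv_ops n m \<inter> weyl_part n d. D w = 0)"

lemma lowestD: "lowest n m w \<Longrightarrow> D \<in> inv_ops n m \<Longrightarrow> D \<in> weyl_part n d \<Longrightarrow> d < 0 \<Longrightarrow> D w = 0"
  by (auto simp: lowest_def)

lemma lowest_iff: "lowest n m w \<longleftrightarrow> (\<forall>D \<in> inv_ops_neg n m. D w = 0)"
proof
  assume w: "lowest n m w"
  show "\<forall>D \<in> inv_ops_neg n m. D w = 0"
  proof
    fix D assume "D \<in> inv_ops_neg n m"
    then show "D w = 0"
      unfolding inv_ops_neg_def
      by (induction rule: span_op_induct) (use w in \<open>auto simp: lowest_def op_scale_def\<close>)
  qed
next
  assume "\<forall>D \<in> inv_ops_neg n m. D w = 0"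
  then show "lowest n m w"
    unfolding lowest_def inv_ops_neg_def by (blast intro: oper.span_base)
qed

lemma ann_neg_iff: "y \<in> ann_neg n m N \<longleftrightarrow> y \<in> N \<and> lowest n m y"
  by (simp add: ann_neg_def lowest_iff)

lemma lowest_lincomb:
  assumes "lowest n m u" and "lowest n m w"
  shows "lowest n m (u - cscale c w)"
proof -
  have "D (u - cscale c w) = 0" if "D \<in> inv_ops n m" "D \<in> weyl_part n d" "d < 0" for D d
    using lowestD[OF assms(1) that] lowestD[OF assms(2) that] inv_ops_lin[OF that(1)]
    by (simp add: lin_diff lin_cscale)
  then show ?thesis by (auto simp: lowest_def)
qed

lemma lowest_cscale: "lowest n m w \<Longrightarrow> lowest n m (cscale c w)"
  unfolding lowest_def by (auto simp: lin_cscale[OF inv_ops_lin])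

lemma exists_lowest:
  assumes K: "submod n m K" and "m \<le> n" and "K \<noteq> {0}"
  obtains w e where "w \<in> K" and "w \<noteq> 0" and "hdeg e w" and "lowest n m w"
proof -
  let ?P = "\<lambda>e. \<exists>w\<in>K. w \<noteq> 0 \<and> hdeg (int e) w"
  obtain y where y: "y \<in> K" "y \<noteq> 0" using assms(3) submodD(2)[OF K] by blast
  then obtain \<gamma> where \<gamma>: "lookup y \<gamma> \<noteq> 0"
    by (metis lookup_zero poly_mapping_eqI)
  have "lookup (hom_part (int (mon_degree \<gamma>)) y) \<gamma> \<noteq> 0"
    using \<gamma> by (simp add: lookup_hom_part)
  then have "hom_part (int (mon_degree \<gamma>)) y \<noteq> 0" by auto
  then have "?P (mon_degree \<gamma>)"
    using submod_hom_part[OF K assms(2) y(1)] hdeg_hom_part by blast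
  then have e: "?P (LEAST e. ?P e)" by (rule LeastI)
  define e where "e = (LEAST e. ?P e)"
  obtain w where w: "w \<in> K" "w \<noteq> 0" "hdeg (int e) w" using e e_def by blast
  have "D w = 0" if D: "D \<in> inv_ops n m" "D \<in> weyl_part n d" "d < 0" for D d
  proof (rule ccontr)
    assume ne: "D w \<noteq> 0"
    have h: "hdeg (int e + d) (D w)" by (rule weyl_part_hdeg[OF D(2) w(3)])
    then have nn: "int e + d \<ge> 0" using ne hdeg_neg by force
    have "?P (nat (int e + d))"
      using h ne nn submodD(4)[OF K D(1) w(1)] by auto
    then have "e \<le> nat (int e + d)" unfolding e_def by (rule Least_le)
    then show False using D(3) nn by linarith
  qed
  then have "lowest n m w" by (auto simp: lowest_def)
  with w show ?thesis using that by blast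
qed

text \<open>
  In an invariant operator, the parts of negative degree kill \<open>u\<close> and those of positive degree raise
  the degree. So nothing lies below \<open>u\<close>, and the part of degree \<open>0\<close> accounts for what is in the
  degree of \<open>u\<close>.
\<close>
lemma lowest_cyclic_hom_part:
  assumes "m \<le> n" and "hdeg d u" and "lowest n m u" and "D \<in> inv_ops n m"
  shows "e < d \<Longrightarrow> hom_part e (D u) = 0"
    and "\<exists>G \<in> inv_ops n m \<inter> weyl_part n 0. hom_part d (D u) = G u"
proof -
  obtain I G where I: "finite I" "\<And>d. d \<in> I \<Longrightarrow> G d \<in> inv_ops n m \<inter> weyl_part n d" "D = (\<Sum>d\<in>I. G d)"
    using inv_ops_graded[OF assms(1,4)] by blast
  have Du: "D u = (\<Sum>k\<in>I. G k u)" by (simp add: I(3) sum_op_apply)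
  have h: "hdeg (d + k) (G k u)" if "k \<in> I" for k
    using weyl_part_hdeg[OF _ assms(2)] I(2)[OF that] by blast
  have z: "G k u = 0" if "k \<in> I" "k < 0" for k
    using I(2)[OF that(1)] that(2) lowestD[OF assms(3)] by blast
  have c: "hom_part e (D u) = (\<Sum>k\<in>I. if e = d + k then G k u else 0)" for e
    unfolding Du hom_part_sum by (rule sum.cong[OF refl]) (simp add: hom_part_hdeg[OF h])
  show "e < d \<Longrightarrow> hom_part e (D u) = 0"
    unfolding c by (rule sum.neutral) (auto simp: z)
  have "hom_part d (D u) = (\<Sum>k\<in>I. if k = 0 then G k u else 0)"
    unfolding c by (rule sum.cong) auto
  also have "\<dots> = (if 0 \<in> I then G 0 u else 0)"
    using I(1) by simp
  finally have "hom_part d (D u) = (if 0 \<in> I then G 0 u else 0)" .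
  then show "\<exists>G \<in> inv_ops n m \<inter> weyl_part n 0. hom_part d (D u) = G u"
    using I(2)[of 0] inv_ops_0 weyl_part_0 by (metis IntI zero_fun_apply)
qed

text \<open>
  A submodule either meets the degree of \<open>u\<close>, where only the multiples of \<open>u\<close> live, and is everything;
  or all of its elements \<open>y = D u\<close> satisfy \<open>\<langle>y, y\<rangle> = \<langle>u, D\<^sup>* y\<rangle> = 0\<close>, because \<open>D\<^sup>* y\<close> lies in the submodule,
  too, and has no component in the degree of \<open>u\<close>.
\<close>
lemma simple_cyclic:
  assumes "m \<le> n" and "u \<in> polys n" and "u \<noteq> 0" and "hdeg d u" and "lowest n m u"
    and deg0: "\<And>D. D \<in> inv_ops n m \<Longrightarrow> D \<in> weyl_part n 0 \<Longrightarrow> \<exists>c. D u = cscale c u"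
  shows "simple_submod n m (cyclic n m u)"
  unfolding simple_submod_def
proof (intro conjI allI impI)
  show "submod n m (cyclic n m u)" by (rule submod_cyclic[OF assms(2)])
  show "cyclic n m u \<noteq> {0}" using cyclic_self assms(3) by blast
  fix K
  assume "submod n m K \<and> K \<subseteq> cyclic n m u"
  then have K: "submod n m K" and sub: "K \<subseteq> cyclic n m u" by auto
  have lead: "\<exists>c. hom_part d y = cscale c u" if "y \<in> K" for y
  proof -
    have "y \<in> cyclic n m u" using that sub by blast
    then obtain D where "D \<in> inv_ops n m" "y = D u" by (rule cyclicE)
    then obtain G where "G \<in> inv_ops n m \<inter> weyl_part n 0" "hom_part d y = G u"
      using lowest_cyclic_hom_part(2)[OF assms(1,4,5)] by blast
    then show ?thesis using deg0[of G] by simp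
  qed
  show "K = {0} \<or> K = cyclic n m u"
  proof (cases "\<exists>y\<in>K. hom_part d y \<noteq> 0")
    case True
    then obtain y where y: "y \<in> K" "hom_part d y \<noteq> 0" by blast
    then obtain c where c: "hom_part d y = cscale c u" using lead by blast
    then have "c \<noteq> 0" using y(2) by auto
    then have "u = cscale (1 / c) (hom_part d y)" by (simp add: c)
    then have "u \<in> K"
      using submod_hom_part[OF K assms(1) y(1)] submod_cscale[OF K] by metis
    then show ?thesis using cyclic_subset[OF K] sub by blast
  next
    case False
    have "y = 0" if y: "y \<in> K" for y
    proof -
      obtain D where D: "D \<in> inv_ops n m" "y = D u" using y sub by (blast elim: cyclicE)
      obtain D' where D': "D' \<in> inv_ops n m" "\<And>p q. ip (D p) q = ip p (D' q)"
        using inv_ops_adjoint[OF assms(1) D(1)] by blast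
      have K': "D' y \<in> K" using submodD(4)[OF K D'(1) y] .
      have "hom_part d (D' y) = 0" using False K' by blast
      then have "ip u (D' y) = 0" using ip_hom_part[OF assms(4), of "D' y"] by simp
      then have "ip y y = 0" using D(2) D'(2) by metis
      then show ?thesis by (simp add: ip_self)
    qed
    then show ?thesis using submodD(2)[OF K] by blast
  qed
qed

subsection \<open>Orthogonal projections\<close>

text \<open>
  Gram-Schmidt by induction on the set of the monomials that are allowed: the elements of \<open>U\<close> without
  the monomial \<open>\<gamma>\<close> form a hyperplane of \<open>U\<close>, or all of \<open>U\<close>.
\<close>
lemma orthogonal_projection:
  assumes "finite F" and "cp.subspace U" and "\<And>u. u \<in> U \<Longrightarrow> keys u \<subseteq> F"
  shows "\<exists>u\<in>U. \<forall>y\<in>U. ip (x - u) y = 0"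
  using assms
proof (induction F arbitrary: U x rule: finite_induct)
  case empty
  then have "U = {0}" using cp.subspace_0 by fastforce
  then show ?case by simp
next
  case (insert \<gamma> F)
  define U' where "U' = {u\<in>U. lookup u \<gamma> = 0}"
  have sub': "cp.subspace U'"
    using insert.prems(1) unfolding U'_def cp.subspace_def by (auto simp: lookup_add)
  have keys': "\<And>u. u \<in> U' \<Longrightarrow> keys u \<subseteq> F"
    using insert.prems(2) unfolding U'_def by (auto simp: in_keys_iff)
  note IH = insert.IH[OF sub' keys']
  show ?case
  proof (cases "U' = U")
    case True
    then show ?thesis using IH by simp
  next
    case False
    then obtain u\<^sub>0 where u0: "u\<^sub>0 \<in> U" "lookup u\<^sub>0 \<gamma> \<noteq> 0" by (auto simp: U'_def)
    obtain p where p: "p \<in> U'" "\<And>y. y \<in> U' \<Longrightarrow> ip (u\<^sub>0 - p) y = 0"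
      using IH[of u\<^sub>0] by blast
    define q where "q = u\<^sub>0 - p"
    have q: "q \<in> U" "lookup q \<gamma> \<noteq> 0"
      using u0 p(1) insert.prems(1) by (auto simp: q_def U'_def lookup_minus cp.subspace_diff)
    then have "q \<noteq> 0" by auto
    then have qq: "ip q q \<noteq> 0" by (simp add: ip_self)
    have q': "ip q y = 0" "ip y q = 0" if "y \<in> U'" for y
      using p(2)[OF that] ip_commute[of q y] by (simp_all add: q_def)
    obtain r where r: "r \<in> U'" "\<And>y. y \<in> U' \<Longrightarrow> ip (x - r) y = 0"
      using IH[of x] by blast
    let ?u = "r + cscale (ip x q / ip q q) q"
    have "?u \<in> U"
      using r(1) q(1) insert.prems(1) by (auto simp: U'_def intro: cp.subspace_add cp.subspace_scale)
    moreover have "ip (x - ?u) y = 0" if y: "y \<in> U" for y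
    proof -
      define c where "c = lookup y \<gamma> / lookup q \<gamma>"
      have "y - cscale c q \<in> U'"
        using y q insert.prems(1)
        by (auto simp: U'_def c_def lookup_minus intro: cp.subspace_diff cp.subspace_scale)
      then have "ip (x - ?u) (y - cscale c q) = 0"
        using r(2) q'(1) by (simp add: ip_diff_left ip_add_left ip_cscale_left)
      moreover have "ip (x - ?u) q = 0"
        using qq q'(2)[OF r(1)] by (simp add: ip_diff_left ip_add_left ip_cscale_left)
      ultimately show ?thesis by (simp add: ip_diff_right ip_cscale_right)
    qed
    ultimately show ?thesis by blast
  qed
qed

lemma finite_exponents: "finite {\<gamma> :: nat \<Rightarrow>\<^sub>0 nat. keys \<gamma> \<subseteq> {1..n} \<and> mon_degree \<gamma> \<le> d}"
proof (rule finite_imageD)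
  have "lookup \<gamma> i \<le> d" if "keys \<gamma> \<subseteq> {1..n}" "mon_degree \<gamma> \<le> d" "i \<in> {1..n}" for \<gamma> i
    using that mon_degree_superset[of "{1..n}" \<gamma>] member_le_sum[of i "{1..n}" "lookup \<gamma>"] by simp
  then have "lookup ` {\<gamma>. keys \<gamma> \<subseteq> {1..n} \<and> mon_degree \<gamma> \<le> d} \<subseteq>
      {f. \<forall>i. (i \<in> {1..n} \<longrightarrow> f i \<in> {..d}) \<and> (i \<notin> {1..n} \<longrightarrow> f i = 0)}"
    by (auto simp: subset_iff in_keys_iff)
  then show "finite (lookup ` {\<gamma> :: nat \<Rightarrow>\<^sub>0 nat. keys \<gamma> \<subseteq> {1..n} \<and> mon_degree \<gamma> \<le> d})"
    by (rule finite_subset) (intro finite_set_of_finite_funs, auto)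
  show "inj_on lookup {\<gamma> :: nat \<Rightarrow>\<^sub>0 nat. keys \<gamma> \<subseteq> {1..n} \<and> mon_degree \<gamma> \<le> d}"
    by (rule inj_onI, rule poly_mapping_eqI) simp
qed

text \<open>
  Homogeneous elements have finitely many possible monomials, so that they can be projected to a
  submodule even though the submodule has infinite dimension.
\<close>
lemma submod_projection:
  assumes K: "submod n m K" and "m \<le> n" and "hdeg e x"
  obtains u where "u \<in> K" and "hdeg e u" and "\<And>y. y \<in> K \<Longrightarrow> ip (x - u) y = 0"
proof -
  define U where "U = {y\<in>K. hdeg e y}"
  have "cp.subspace U"
    unfolding cp.subspace_def U_def
    using submodD(2,3)[OF K] submod_cscale[OF K] by (auto intro: hdeg_add hdeg_cscale)
  moreover have "keys u \<subseteq> {\<gamma>. keys \<gamma> \<subseteq> {1..n} \<and> mon_degree \<gamma> \<le> nat e}" if "u \<in> U" for u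
    using that submodD(1)[OF K] by (auto simp: U_def polys_def hdeg_def)
  ultimately obtain u where u: "u \<in> U" "\<And>y. y \<in> U \<Longrightarrow> ip (x - u) y = 0"
    using orthogonal_projection[OF finite_exponents] by blast
  have "ip (x - u) y = 0" if y: "y \<in> K" for y
  proof -
    have hx: "hdeg e (x - u)" using u(1) assms(3) by (auto simp: U_def intro: hdeg_diff)
    show ?thesis
      using ip_hom_part[OF hx, of y] u(2)[of "hom_part e y"] submod_hom_part[OF K assms(2) y] hdeg_hom_part
      by (simp add: U_def)
  qed
  then show ?thesis using that[of u] u(1) by (simp add: U_def)
qed

section \<open>Normally ordered operators\<close>

text \<open>The falling factorial \<open>k (k - 1) \<dots> (k - b + 1)\<close>; it is zero for \<open>b > k\<close>.\<close>
primrec ffact :: "nat \<Rightarrow> nat \<Rightarrow> nat" where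
  "ffact k 0 = 1"
| "ffact k (Suc b) = ffact k b * (k - b)"

lemma ffact_eq_0_iff: "ffact k b = 0 \<longleftrightarrow> k < b"
  by (induction b) auto

definition ffacts :: "(nat \<Rightarrow>\<^sub>0 nat) \<Rightarrow> (nat \<Rightarrow>\<^sub>0 nat) \<Rightarrow> nat" where
  "ffacts \<delta> \<beta> = (\<Prod>i\<in>keys \<beta>. ffact (lookup \<delta> i) (lookup \<beta> i))"

lemma ffacts_superset:
  "finite S \<Longrightarrow> keys \<beta> \<subseteq> S \<Longrightarrow> ffacts \<delta> \<beta> = (\<Prod>i\<in>S. ffact (lookup \<delta> i) (lookup \<beta> i))"
  unfolding ffacts_def by (rule prod.mono_neutral_left) (auto simp: in_keys_iff)

lemma ffacts_0 [simp]: "ffacts \<delta> 0 = 1"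
  by (simp add: ffacts_def)

lemma ffacts_eq_0: "\<not> (\<forall>i. lookup \<beta> i \<le> lookup \<delta> i) \<Longrightarrow> ffacts \<delta> \<beta> = 0"
  by (auto simp: ffacts_def in_keys_iff ffact_eq_0_iff not_le intro!: prod_zero)

lemma ffacts_add_unit: "ffacts \<delta> (\<beta> + unit_exp i) = ffacts \<delta> \<beta> * (lookup \<delta> i - lookup \<beta> i)"
proof -
  let ?S = "insert i (keys \<beta>)"
  have "keys (\<beta> + unit_exp i) \<subseteq> ?S"
    by (auto simp: in_keys_iff lookup_add lookup_single when_def split: if_splits)
  then have "ffacts \<delta> (\<beta> + unit_exp i) = (\<Prod>j\<in>?S. ffact (lookup \<delta> j) (lookup (\<beta> + unit_exp i) j))"
    by (intro ffacts_superset) auto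
  also have "\<dots> = (\<Prod>j\<in>?S. ffact (lookup \<delta> j) (lookup \<beta> j) * (if j = i then lookup \<delta> i - lookup \<beta> i else 1))"
    by (rule prod.cong) (auto simp: lookup_add lookup_single One_nat_def)
  also have "\<dots> = (\<Prod>j\<in>?S. ffact (lookup \<delta> j) (lookup \<beta> j)) * (lookup \<delta> i - lookup \<beta> i)"
    by (simp add: prod.distrib prod.delta del: prod.insert)
  also have "(\<Prod>j\<in>?S. ffact (lookup \<delta> j) (lookup \<beta> j)) = ffacts \<delta> \<beta>"
    by (intro ffacts_superset[symmetric]) auto
  finally show ?thesis .
qed

text \<open>The operator \<open>x\<^sup>\<alpha> \<partial>\<^sup>\<beta>\<close>.\<close>
definition mo :: "(nat \<Rightarrow>\<^sub>0 nat) \<Rightarrow> (nat \<Rightarrow>\<^sub>0 nat) \<Rightarrow> cpoly \<Rightarrow> cpoly" where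
  "mo \<alpha> \<beta> p = (\<Sum>\<gamma>\<in>keys p. single (\<gamma> - \<beta> + \<alpha>) (of_nat (ffacts \<gamma> \<beta>) * lookup p \<gamma>))"

lemma lookup_mo:
  "lookup (mo \<alpha> \<beta> p) \<gamma> = (if \<forall>i. lookup \<alpha> i \<le> lookup \<gamma> i
     then of_nat (ffacts (\<gamma> - \<alpha> + \<beta>) \<beta>) * lookup p (\<gamma> - \<alpha> + \<beta>) else 0)"
proof -
  have 1: "lookup (mo \<alpha> \<beta> p) \<gamma> =
      (\<Sum>\<delta>\<in>keys p. (of_nat (ffacts \<delta> \<beta>) * lookup p \<delta> when \<delta> - \<beta> + \<alpha> = \<gamma>))"
    by (simp add: mo_def lookup_sum lookup_single)
  show ?thesis
  proof (cases "\<forall>i. lookup \<alpha> i \<le> lookup \<gamma> i")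
    case True
    have "(of_nat (ffacts \<delta> \<beta>) * lookup p \<delta> when \<delta> - \<beta> + \<alpha> = \<gamma>) =
        (if \<delta> = \<gamma> - \<alpha> + \<beta> then of_nat (ffacts \<delta> \<beta>) * lookup p \<delta> else 0)" for \<delta>
    proof (cases "\<forall>i. lookup \<beta> i \<le> lookup \<delta> i")
      case le: True
      have "\<delta> - \<beta> + \<alpha> = \<gamma> \<longleftrightarrow> \<delta> = \<gamma> - \<alpha> + \<beta>"
        unfolding poly_mapping_eq_iff fun_eq_iff lookup_add lookup_minus
        using le True by (metis add_diff_cancel_right' le_add_diff_inverse2)
      then show ?thesis by (simp add: when_def)
    next
      case False
      then have "ffacts \<delta> \<beta> = 0" by (rule ffacts_eq_0)
      then show ?thesis by (auto simp: when_def)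
    qed
    then show ?thesis
      using True 1 by (simp add: not_in_keys_iff_lookup_eq_zero)
  next
    case False
    then have "\<delta> - \<beta> + \<alpha> \<noteq> \<gamma>" for \<delta>
      by (metis le_add2 lookup_add)
    with 1 have "lookup (mo \<alpha> \<beta> p) \<gamma> = 0" by simp
    then show ?thesis using False by (simp only: if_False)
  qed
qed

lemma mo_0_0: "mo 0 0 = id"
  by (simp add: fun_eq_iff poly_mapping_eq_iff lookup_mo)

lemma X_mo: "X i * mo \<alpha> \<beta> p = mo (\<alpha> + unit_exp i) \<beta> p"
proof (rule poly_mapping_eqI)
  fix \<gamma>
  show "lookup (X i * mo \<alpha> \<beta> p) \<gamma> = lookup (mo (\<alpha> + unit_exp i) \<beta> p) \<gamma>"
  proof (cases "lookup \<gamma> i = 0")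
    case True
    then have "\<not> lookup (\<alpha> + unit_exp i) i \<le> lookup \<gamma> i" by (simp add: lookup_add)
    then have "\<not> (\<forall>j. lookup (\<alpha> + unit_exp i) j \<le> lookup \<gamma> j)" by blast
    then show ?thesis using True by (simp only: lookup_X_mult lookup_mo refl if_True if_False)
  next
    case False
    have "(\<forall>j. lookup \<alpha> j \<le> lookup (\<gamma> - unit_exp i) j) \<longleftrightarrow> (\<forall>j. lookup (\<alpha> + unit_exp i) j \<le> lookup \<gamma> j)"
      using False by (auto simp: lookup_add lookup_minus lookup_single when_def)
    moreover have "\<gamma> - unit_exp i - \<alpha> = \<gamma> - (\<alpha> + unit_exp i)"
      by (auto simp: poly_mapping_eq_iff fun_eq_iff lookup_add lookup_minus)
    ultimately show ?thesis using False by (simp add: lookup_X_mult lookup_mo)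
  qed
qed

lemma pd_mo_0: "pd i (mo 0 \<beta> p) = mo 0 (\<beta> + unit_exp i) p"
proof (rule poly_mapping_eqI)
  fix \<gamma>
  show "lookup (pd i (mo 0 \<beta> p)) \<gamma> = lookup (mo 0 (\<beta> + unit_exp i) p) \<gamma>"
    by (simp add: lookup_pd lookup_mo ffacts_add_unit lookup_add add.assoc add.commute[of "unit_exp i"])
qed

lemma pd_X_mult: "pd i (X k * q) = X k * pd i q + (if i = k then q else 0)"
proof (rule poly_mapping_eqI)
  fix \<gamma>
  have 1: "\<gamma> + unit_exp i - unit_exp k = \<gamma> - unit_exp k + unit_exp i" if "lookup \<gamma> k \<noteq> 0"
    using that
    by (auto simp: poly_mapping_eq_iff fun_eq_iff lookup_add lookup_minus lookup_single when_def)
  show "lookup (pd i (X k * q)) \<gamma> = lookup (X k * pd i q + (if i = k then q else 0)) \<gamma>"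
  proof (cases "i = k")
    case True
    then show ?thesis
      by (cases "lookup \<gamma> k")
        (simp_all add: lookup_pd lookup_X_mult lookup_add lookup_minus diff_unit_add distrib_right)
  next
    case False
    then show ?thesis
      using 1 by (auto simp: lookup_pd lookup_X_mult lookup_add lookup_minus lookup_single)
  qed
qed

definition mo_set :: "nat \<Rightarrow> int \<Rightarrow> (cpoly \<Rightarrow> cpoly) set" where
  "mo_set n d = {mo \<alpha> \<beta> | \<alpha> \<beta>. keys \<alpha> \<subseteq> {1..n} \<and> keys \<beta> \<subseteq> {1..n} \<and>
     int (mon_degree \<alpha>) - int (mon_degree \<beta>) = d}"

lemma mo_setI:
  "keys \<alpha> \<subseteq> {1..n} \<Longrightarrow> keys \<beta> \<subseteq> {1..n} \<Longrightarrow> int (mon_degree \<alpha>) - int (mon_degree \<beta>) = d \<Longrightarrow>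
    mo \<alpha> \<beta> \<in> mo_set n d"
  by (auto simp: mo_set_def)

lemma keys_add_unit: "keys (\<alpha> + unit_exp i) = insert i (keys \<alpha>)"
  by (auto simp: in_keys_iff lookup_add lookup_single when_def split: if_splits)

lemma mo_set_X:
  assumes "i \<in> {1..n}" and "D \<in> oper.span (mo_set n d)"
  shows "(\<lambda>p. X i * D p) \<in> oper.span (mo_set n (d + 1))"
proof -
  have "(\<lambda>p. X i * p) \<circ> D \<in> oper.span (mo_set n (d + 1))"
  proof (rule comp_span[OF lin_X _ assms(2)])
    fix D assume "D \<in> mo_set n d"
    then obtain \<alpha> \<beta> where D: "D = mo \<alpha> \<beta>" "keys \<alpha> \<subseteq> {1..n}" "keys \<beta> \<subseteq> {1..n}"
      "int (mon_degree \<alpha>) - int (mon_degree \<beta>) = d" by (auto simp: mo_set_def)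
    have "(\<lambda>p. X i * p) \<circ> D = mo (\<alpha> + unit_exp i) \<beta>" by (simp add: fun_eq_iff D(1) X_mo)
    also have "\<dots> \<in> mo_set n (d + 1)"
      by (rule mo_setI) (use D assms(1) in \<open>auto simp: keys_add_unit\<close>)
    finally show "(\<lambda>p. X i * p) \<circ> D \<in> oper.span (mo_set n (d + 1))" by (rule oper.span_base)
  qed
  then show ?thesis by (simp only: comp_def)
qed

text \<open>
  Moves \<open>\<partial>\<^sub>i\<close> to the right of \<open>x\<^sup>\<alpha>\<close>, one variable of \<open>x\<^sup>\<alpha>\<close> at a time.
\<close>
lemma mo_set_pd_mo:
  assumes i: "i \<in> {1..n}" and \<beta>: "keys \<beta> \<subseteq> {1..n}"
  shows "keys \<alpha> \<subseteq> {1..n} \<Longrightarrow> int (mon_degree \<alpha>) - int (mon_degree \<beta>) = d \<Longrightarrow>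
    pd i \<circ> mo \<alpha> \<beta> \<in> oper.span (mo_set n (d - 1))"
proof (induction "mon_degree \<alpha>" arbitrary: \<alpha> d rule: less_induct)
  case less
  show ?case
  proof (cases "\<alpha> = 0")
    case True
    have "pd i \<circ> mo \<alpha> \<beta> = mo 0 (\<beta> + unit_exp i)" by (simp add: fun_eq_iff True pd_mo_0)
    also have "\<dots> \<in> mo_set n (d - 1)"
      by (rule mo_setI) (use i \<beta> less.prems True in \<open>auto simp: keys_add_unit\<close>)
    finally show ?thesis by (rule oper.span_base)
  next
    case False
    then obtain k where k: "lookup \<alpha> k \<noteq> 0" by (metis lookup_zero poly_mapping_eqI)
    define \<alpha>' where "\<alpha>' = \<alpha> - unit_exp k"
    have \<alpha>: "\<alpha> = \<alpha>' + unit_exp k" using k by (simp add: \<alpha>'_def diff_unit_add)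
    have kn: "k \<in> {1..n}" and \<alpha>'n: "keys \<alpha>' \<subseteq> {1..n}"
      using less.prems(1) by (auto simp: \<alpha> keys_add_unit)
    have d': "int (mon_degree \<alpha>') - int (mon_degree \<beta>) = d - 1" using less.prems(2) by (simp add: \<alpha>)
    have "pd i \<circ> mo \<alpha>' \<beta> \<in> oper.span (mo_set n (d - 1 - 1))"
      using less.hyps[OF _ \<alpha>'n d'] by (simp add: \<alpha>)
    from mo_set_X[OF kn this]
    have 1: "(\<lambda>p. X k * pd i (mo \<alpha>' \<beta> p)) \<in> oper.span (mo_set n (d - 1))" by simp
    have 2: "op_scale (if i = k then 1 else 0) (mo \<alpha>' \<beta>) \<in> oper.span (mo_set n (d - 1))"
      by (intro oper.span_scale oper.span_base mo_setI \<alpha>'n \<beta> d')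
    have "pd i \<circ> mo \<alpha> \<beta> = (\<lambda>p. X k * pd i (mo \<alpha>' \<beta> p)) + op_scale (if i = k then 1 else 0) (mo \<alpha>' \<beta>)"
      by (simp add: fun_eq_iff \<alpha> X_mo[symmetric] pd_X_mult op_scale_def)
    then show ?thesis using oper.span_add[OF 1 2] by (simp only:)
  qed
qed

lemma mo_set_pd:
  assumes "i \<in> {1..n}" and "D \<in> oper.span (mo_set n d)"
  shows "(\<lambda>p. pd i (D p)) \<in> oper.span (mo_set n (d - 1))"
proof -
  have "pd i \<circ> D \<in> oper.span (mo_set n (d - 1))"
  proof (rule comp_span[OF lin_pd _ assms(2)])
    fix D assume "D \<in> mo_set n d"
    then show "pd i \<circ> D \<in> oper.span (mo_set n (d - 1))"
      unfolding mo_set_def[of n d] using mo_set_pd_mo[OF assms(1)] by blast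
  qed
  then show ?thesis by (simp only: comp_def)
qed

lemma weyl_word_mo: "weyl_word n d D \<Longrightarrow> D \<in> oper.span (mo_set n d)"
proof (induction rule: weyl_word.induct)
  case one
  have "mo 0 0 \<in> mo_set n 0" by (rule mo_setI) simp_all
  then show ?case unfolding mo_0_0 by (rule oper.span_base)
qed (simp_all only: mo_set_X mo_set_pd)

lemma weyl_part_mo: "weyl_part n d \<subseteq> oper.span (mo_set n d)"
  unfolding weyl_part_def
  by (rule oper.span_minimal) (auto simp: weyl_word_mo oper.subspace_span)

lemma mo_weyl_word:
  "keys \<alpha> \<subseteq> {1..n} \<Longrightarrow> keys \<beta> \<subseteq> {1..n} \<Longrightarrow>
    weyl_word n (int (mon_degree \<alpha>) - int (mon_degree \<beta>)) (mo \<alpha> \<beta>)"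
proof (induction "mon_degree \<alpha> + mon_degree \<beta>" arbitrary: \<alpha> \<beta> rule: less_induct)
  case less
  consider "\<alpha> = 0" "\<beta> = 0" | i where "i \<in> keys \<alpha>" | i where "\<alpha> = 0" "i \<in> keys \<beta>"
    by (metis all_not_in_conv keys_eq_empty)
  then show ?case
  proof cases
    case 1
    show ?thesis unfolding 1 mo_0_0 using weyl_word.one by simp
  next
    case (2 i)
    define \<alpha>' where "\<alpha>' = \<alpha> - unit_exp i"
    have \<alpha>: "\<alpha> = \<alpha>' + unit_exp i"
      using 2 by (simp add: \<alpha>'_def diff_unit_add in_keys_iff)
    have "keys \<alpha>' \<subseteq> {1..n}" "i \<in> {1..n}"
      using less.prems(1) by (auto simp: \<alpha> keys_add_unit)
    then have "weyl_word n (int (mon_degree \<alpha>') - int (mon_degree \<beta>) + 1) (\<lambda>p. X i * mo \<alpha>' \<beta> p)"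
      using less.prems(2) by (intro weyl_word.mult less.hyps) (auto simp: \<alpha>)
    then show ?thesis by (simp add: X_mo \<alpha>[symmetric]) (simp add: \<alpha> algebra_simps)
  next
    case (3 i)
    define \<beta>' where "\<beta>' = \<beta> - unit_exp i"
    have \<beta>: "\<beta> = \<beta>' + unit_exp i"
      using 3 by (simp add: \<beta>'_def diff_unit_add in_keys_iff)
    have "keys \<beta>' \<subseteq> {1..n}" "i \<in> {1..n}"
      using less.prems(2) by (auto simp: \<beta> keys_add_unit)
    then have "weyl_word n (int (mon_degree \<alpha>) - int (mon_degree \<beta>') - 1) (\<lambda>p. pd i (mo \<alpha> \<beta>' p))"
      using less.prems(1) by (intro weyl_word.deriv less.hyps) (auto simp: \<beta>)
    moreover have "(\<lambda>p. pd i (mo \<alpha> \<beta>' p)) = mo \<alpha> \<beta>"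
      by (simp add: 3(1) \<beta> pd_mo_0)
    ultimately show ?thesis by (simp add: \<beta> algebra_simps)
  qed
qed

subsection \<open>Symmetrized operators\<close>

abbreviation act :: "(nat \<Rightarrow> nat) \<Rightarrow> (nat \<Rightarrow>\<^sub>0 nat) \<Rightarrow> nat \<Rightarrow>\<^sub>0 nat" where
  "act \<sigma> \<equiv> Poly_Mapping.map_key (inv \<sigma>)"

lemma lookup_act: "bij \<sigma> \<Longrightarrow> lookup (act \<sigma> \<alpha>) i = lookup \<alpha> (inv \<sigma> i)"
  by (simp add: lookup_map_key_bij bij_imp_bij_inv)

lemma conj_mo:
  assumes "bij \<sigma>"
  shows "conj_op \<sigma> (mo \<alpha> \<beta>) = mo (act \<sigma> \<alpha>) (act \<sigma> \<beta>)"
proof (rule ext, rule poly_mapping_eqI)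
  fix p :: cpoly and \<gamma> :: "nat \<Rightarrow>\<^sub>0 nat"
  have b: "bij (inv \<sigma>)" using assms by (rule bij_imp_bij_inv)
  let ?\<gamma> = "Poly_Mapping.map_key \<sigma> \<gamma>"
  let ?\<delta> = "?\<gamma> - \<alpha> + \<beta>" and ?\<delta>' = "\<gamma> - act \<sigma> \<alpha> + act \<sigma> \<beta>"
  have le: "(\<forall>i. lookup \<alpha> i \<le> lookup ?\<gamma> i) \<longleftrightarrow> (\<forall>i. lookup (act \<sigma> \<alpha>) i \<le> lookup \<gamma> i)"
    using assms by (simp add: lookup_map_key_bij lookup_act)
      (metis bij_inv_eq_iff)
  have \<delta>: "act \<sigma> ?\<delta> = ?\<delta>'"
    using assms by (auto simp: poly_mapping_eq_iff fun_eq_iff lookup_act lookup_add lookup_minus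
        lookup_map_key_bij bij_is_surj surj_f_inv_f)
  have k: "keys (act \<sigma> \<beta>) = \<sigma> ` keys \<beta>"
    using assms b by (simp add: keys_map_key bij_is_inj bij_vimage_eq_inv_image inv_inv_eq)
  have "ffacts ?\<delta>' (act \<sigma> \<beta>) = ffacts ?\<delta> \<beta>"
    unfolding ffacts_def k \<delta>[symmetric] using assms
    by (subst prod.reindex) (auto simp: lookup_act bij_is_inj intro: inj_on_subset[OF bij_is_inj])
  then show "lookup (conj_op \<sigma> (mo \<alpha> \<beta>) p) \<gamma> = lookup (mo (act \<sigma> \<alpha>) (act \<sigma> \<beta>) p) \<gamma>"
    using assms b by (simp add: conj_op_def lookup_perm_vars lookup_mo le \<delta>)
qed

lemma sym_op_mo_apply:
  "sym_op m (mo \<alpha> \<beta>) p = (\<Sum>\<sigma> | \<sigma> permutes {1..m}. mo (act \<sigma> \<alpha>) (act \<sigma> \<beta>) p)"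
  unfolding sym_op_def sum_op_apply
  by (rule sum.cong) (auto simp: conj_mo permutes_bij)

text \<open>
  In a normally ordered operator the factor \<open>x\<^sub>k\<^sup>a \<partial>\<^sub>k\<^sup>b\<close> commutes with the rest, and it only shifts and
  rescales coefficients.
\<close>
lemma lookup_mo_split:
  assumes "lookup \<alpha> k = 0" and "lookup \<beta> k = 0"
  shows "lookup (mo (\<alpha> + single k a) (\<beta> + single k b) p) \<gamma> =
    (if a \<le> lookup \<gamma> k then of_nat (ffact (lookup \<gamma> k - a + b) b) *
       lookup (mo \<alpha> \<beta> p) (\<gamma> - single k a + single k b) else 0)"
proof (cases "a \<le> lookup \<gamma> k")
  case True
  let ?\<gamma> = "\<gamma> - single k a + single k b"
  define \<delta> where "\<delta> = ?\<gamma> - \<alpha> + \<beta>"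
  have 1: "(\<forall>i. lookup (\<alpha> + single k a) i \<le> lookup \<gamma> i) \<longleftrightarrow> (\<forall>i. lookup \<alpha> i \<le> lookup ?\<gamma> i)"
  proof (rule all_cong1)
    fix i
    show "lookup (\<alpha> + single k a) i \<le> lookup \<gamma> i \<longleftrightarrow> lookup \<alpha> i \<le> lookup ?\<gamma> i"
      using True assms by (cases "i = k") (simp_all add: lookup_add lookup_minus lookup_single)
  qed
  have 2: "\<gamma> - (\<alpha> + single k a) + (\<beta> + single k b) = \<delta>"
  proof (rule poly_mapping_eqI)
    fix i
    show "lookup (\<gamma> - (\<alpha> + single k a) + (\<beta> + single k b)) i = lookup \<delta> i"
      using assms by (cases "i = k") (simp_all add: \<delta>_def lookup_add lookup_minus lookup_single)
  qed
  have 3: "ffacts \<delta> (\<beta> + single k b) = ffact (lookup \<gamma> k - a + b) b * ffacts \<delta> \<beta>"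
  proof -
    let ?S = "insert k (keys \<beta>)"
    have k: "k \<notin> keys \<beta>" using assms by (simp add: in_keys_iff)
    have "keys (\<beta> + single k b) \<subseteq> ?S"
      by (auto simp: in_keys_iff lookup_add lookup_single when_def split: if_splits)
    then have "ffacts \<delta> (\<beta> + single k b) = (\<Prod>i\<in>?S. ffact (lookup \<delta> i) (lookup (\<beta> + single k b) i))"
      by (intro ffacts_superset) auto
    also have "\<dots> = ffact (lookup \<delta> k) b * (\<Prod>i\<in>keys \<beta>. ffact (lookup \<delta> i) (lookup (\<beta> + single k b) i))"
      using k assms by (simp add: lookup_add)
    also have "(\<Prod>i\<in>keys \<beta>. ffact (lookup \<delta> i) (lookup (\<beta> + single k b) i)) = ffacts \<delta> \<beta>"
      unfolding ffacts_def
      by (rule prod.cong) (use k in \<open>auto simp: lookup_add lookup_single when_def\<close>)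
    also have "lookup \<delta> k = lookup \<gamma> k - a + b"
      using assms by (simp add: \<delta>_def lookup_add lookup_minus)
    finally show ?thesis .
  qed
  show ?thesis
    unfolding lookup_mo 1 2 3 using True by (simp flip: \<delta>_def)
next
  case False
  then have "\<not> lookup (\<alpha> + single k a) k \<le> lookup \<gamma> k" by (simp add: lookup_add)
  then have "\<not> (\<forall>i. lookup (\<alpha> + single k a) i \<le> lookup \<gamma> i)" by blast
  then show ?thesis using False by (simp only: lookup_mo[of "\<alpha> + single k a"] if_False)
qed

lemma act_single:
  assumes "bij \<sigma>"
  shows "act \<sigma> (\<alpha> + single k a) = act \<sigma> \<alpha> + single (\<sigma> k) a"
proof (rule poly_mapping_eqI)
  fix i
  have "inv \<sigma> i = k \<longleftrightarrow> i = \<sigma> k" using assms by (metis bij_inv_eq_iff)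
  then show "lookup (act \<sigma> (\<alpha> + single k a)) i = lookup (act \<sigma> \<alpha> + single (\<sigma> k) a) i"
    using assms by (auto simp: lookup_act lookup_add lookup_single when_def)
qed

lemma lookup_sym_op_mo_split:
  assumes "m < k" and "lookup \<alpha> k = 0" and "lookup \<beta> k = 0"
  shows "lookup (sym_op m (mo (\<alpha> + single k a) (\<beta> + single k b)) p) \<gamma> =
    (if a \<le> lookup \<gamma> k then of_nat (ffact (lookup \<gamma> k - a + b) b) *
       lookup (sym_op m (mo \<alpha> \<beta>) p) (\<gamma> - single k a + single k b) else 0)"
proof -
  have "lookup (mo (act \<sigma> (\<alpha> + single k a)) (act \<sigma> (\<beta> + single k b)) p) \<gamma> =
    (if a \<le> lookup \<gamma> k then of_nat (ffact (lookup \<gamma> k - a + b) b) *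
       lookup (mo (act \<sigma> \<alpha>) (act \<sigma> \<beta>) p) (\<gamma> - single k a + single k b) else 0)"
    if \<sigma>: "\<sigma> permutes {1..m}" for \<sigma>
  proof -
    have b: "bij \<sigma>" by (rule permutes_bij[OF \<sigma>])
    have k: "\<sigma> k = k" "inv \<sigma> k = k"
      using permutes_not_in[OF \<sigma>] permutes_not_in[OF permutes_inv[OF \<sigma>]] assms(1) by auto
    show ?thesis
      unfolding act_single[OF b] k(1)
      by (rule lookup_mo_split) (simp_all add: lookup_act[OF b] k(2) assms)
  qed
  then have "lookup (sym_op m (mo (\<alpha> + single k a) (\<beta> + single k b)) p) \<gamma> =
    (\<Sum>\<sigma> | \<sigma> permutes {1..m}. if a \<le> lookup \<gamma> k then of_nat (ffact (lookup \<gamma> k - a + b) b) *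
       lookup (mo (act \<sigma> \<alpha>) (act \<sigma> \<beta>) p) (\<gamma> - single k a + single k b) else 0)"
    unfolding sym_op_mo_apply lookup_sum by (intro sum.cong) auto
  then show ?thesis
    by (simp add: sym_op_mo_apply lookup_sum sum_distrib_left)
qed

text \<open>
  Every permutation of \<open>m + 1\<close> letters is a transposition with the last letter followed by a
  permutation of the first \<open>m\<close> ones.
\<close>
lemma sym_op_Suc:
  "sym_op (Suc m) D = (\<Sum>k\<in>{1..Suc m}. sym_op m (conj_op (transp k (Suc m)) D))"
proof -
  have ins: "{1..Suc m} = insert (Suc m) {1..m}" by auto
  let ?f = "\<lambda>\<sigma>. conj_op (inv \<sigma>) D"
  have "sym_op (Suc m) D = (\<Sum>\<sigma> | \<sigma> permutes insert (Suc m) {1..m}. ?f \<sigma>)"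
    unfolding sym_op_def ins[symmetric] by (rule sum_permutations_inverse)
  also have "\<dots> = (\<Sum>k\<in>insert (Suc m) {1..m}. \<Sum>q | q permutes {1..m}. ?f (transp (Suc m) k \<circ> q))"
    by (rule sum_over_permutations_insert) auto
  also have "\<dots> = (\<Sum>k\<in>{1..Suc m}. sym_op m (conj_op (transp k (Suc m)) D))"
    unfolding ins[symmetric]
  proof (rule sum.cong[OF refl])
    fix k
    let ?t = "transp k (Suc m)"
    have "(\<Sum>q | q permutes {1..m}. ?f (transp (Suc m) k \<circ> q)) =
        (\<Sum>q | q permutes {1..m}. conj_op (inv q) (conj_op ?t D))"
    proof (rule sum.cong[OF refl])
      fix q assume "q \<in> {q. q permutes {1..m}}"
      then have "bij q" by (auto intro: permutes_bij)
      then show "?f (transp (Suc m) k \<circ> q) = conj_op (inv q) (conj_op ?t D)"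
        by (simp add: conj_op_conj_op bij_imp_bij_inv o_inv_distrib transpose_commute)
    qed
    also have "\<dots> = sym_op m (conj_op ?t D)"
      unfolding sym_op_def by (rule sum_permutations_inverse[symmetric])
    finally show "(\<Sum>q | q permutes {1..m}. ?f (transp (Suc m) k \<circ> q)) =
        sym_op m (conj_op ?t D)" .
  qed
  finally show ?thesis .
qed

lemma sym_op_0: "sym_op m 0 = 0"
  and sym_op_add: "sym_op m (D + E) = sym_op m D + sym_op m E"
  and sym_op_scale: "sym_op m (op_scale c D) = op_scale c (sym_op m D)"
proof -
  have "sym_op m 0 = (\<Sum>\<sigma> | \<sigma> permutes {1..m}. 0)"
    unfolding sym_op_def by (rule sum.cong) (auto simp only: mem_Collect_eq conj_op_0 permutes_bij)
  then show "sym_op m 0 = 0" by (simp only: sum.neutral_const)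
  have "sym_op m (D + E) = (\<Sum>\<sigma> | \<sigma> permutes {1..m}. conj_op \<sigma> D + conj_op \<sigma> E)"
    unfolding sym_op_def by (rule sum.cong) (auto simp only: mem_Collect_eq conj_op_add permutes_bij)
  then show "sym_op m (D + E) = sym_op m D + sym_op m E"
    by (simp only: sum.distrib sym_op_def)
  have "sym_op m (op_scale c D) = (\<Sum>\<sigma> | \<sigma> permutes {1..m}. op_scale c (conj_op \<sigma> D))"
    unfolding sym_op_def by (rule sum.cong) (auto simp only: mem_Collect_eq conj_op_scale permutes_bij)
  then show "sym_op m (op_scale c D) = op_scale c (sym_op m D)"
    by (simp only: sym_op_def oper.scale_sum_right)
qed

lemma mo_pd_commute:
  assumes "lookup \<alpha> k = 0" and "lookup \<beta> k = 0"
  shows "mo \<alpha> \<beta> (pd k p) = pd k (mo \<alpha> \<beta> p)"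
proof (rule poly_mapping_eqI)
  fix \<gamma>
  let ?\<delta> = "\<gamma> - \<alpha> + \<beta>"
  have le: "(\<forall>i. lookup \<alpha> i \<le> lookup (\<gamma> + unit_exp k) i) \<longleftrightarrow> (\<forall>i. lookup \<alpha> i \<le> lookup \<gamma> i)"
  proof (rule all_cong1)
    fix i
    show "lookup \<alpha> i \<le> lookup (\<gamma> + unit_exp k) i \<longleftrightarrow> lookup \<alpha> i \<le> lookup \<gamma> i"
      using assms by (cases "i = k") (simp_all add: lookup_add lookup_single)
  qed
  have \<delta>: "\<gamma> + unit_exp k - \<alpha> + \<beta> = ?\<delta> + unit_exp k"
  proof (rule poly_mapping_eqI)
    fix i
    show "lookup (\<gamma> + unit_exp k - \<alpha> + \<beta>) i = lookup (?\<delta> + unit_exp k) i"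
      using assms by (cases "i = k") (simp_all add: lookup_add lookup_minus lookup_single)
  qed
  have ff: "ffacts (?\<delta> + unit_exp k) \<beta> = ffacts ?\<delta> \<beta>"
    unfolding ffacts_def
    by (rule prod.cong) (use assms(2) in \<open>auto simp: in_keys_iff lookup_add lookup_single when_def\<close>)
  have k: "lookup ?\<delta> k = lookup \<gamma> k"
    using assms by (simp add: lookup_add lookup_minus)
  show "lookup (mo \<alpha> \<beta> (pd k p)) \<gamma> = lookup (pd k (mo \<alpha> \<beta> p)) \<gamma>"
    unfolding lookup_mo lookup_pd le \<delta> ff k by simp
qed

lemma sym_op_mo_pd_commute:
  assumes "m < k" and "lookup \<alpha> k = 0" and "lookup \<beta> k = 0"
  shows "sym_op m (mo \<alpha> \<beta>) ((pd k ^^ j) p) = (pd k ^^ j) (sym_op m (mo \<alpha> \<beta>) p)"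
proof (induction j)
  case (Suc j)
  have 1: "sym_op m (mo \<alpha> \<beta>) (pd k q) = pd k (sym_op m (mo \<alpha> \<beta>) q)" for q
    unfolding sym_op_mo_apply lin_sum[OF lin_pd]
  proof (rule sum.cong[OF refl])
    fix \<sigma>
    assume "\<sigma> \<in> {\<sigma>. \<sigma> permutes {1..m}}"
    then have \<sigma>: "\<sigma> permutes {1..m}" by simp
    have "inv \<sigma> k = k"
      using permutes_not_in[OF permutes_inv[OF \<sigma>]] assms(1) by auto
    then show "mo (act \<sigma> \<alpha>) (act \<sigma> \<beta>) (pd k q) = pd k (mo (act \<sigma> \<alpha>) (act \<sigma> \<beta>) q)"
      using assms by (intro mo_pd_commute) (simp_all add: lookup_act permutes_bij[OF \<sigma>])
  qed
  show ?case using Suc by (simp add: 1)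
qed simp

lemma lookup_pd_pow:
  "lookup ((pd k ^^ j) p) \<gamma> = of_nat (ffact (lookup \<gamma> k + j) j) * lookup p (\<gamma> + single k j)"
proof -
  have "(pd k ^^ j) p = mo 0 (single k j) p"
  proof (induction j)
    case (Suc j)
    have "single k j + unit_exp k = single k (Suc j)"
      by (simp add: single_add[symmetric] One_nat_def)
    then show ?case using Suc pd_mo_0[of k "single k j" p] by simp
  qed (simp add: mo_0_0)
  then show ?thesis by (simp add: lookup_mo ffacts_def lookup_add)
qed

subsection \<open>Leading coefficients of lowest weight vectors\<close>

text \<open>
  The symmetrization over \<open>S\<^bsub>m+1\<^esub>\<close> of \<open>x\<^sup>\<alpha> \<partial>\<^sup>\<beta>\<close> kills \<open>w\<close>. It consists of copies of the symmetrization
  over \<open>S\<^sub>m\<close>, one for each \<open>k\<close> that does not occur in \<open>\<alpha>\<close> and \<open>\<beta>\<close>, and of terms in which a factor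
  \<open>x\<^sub>k\<^sup>a \<partial>\<^sub>k\<^sup>b\<close> has become \<open>x\<^bsub>m+1\<^esub>\<^sup>a \<partial>\<^bsub>m+1\<^esub>\<^sup>b\<close>. The operators that remain after splitting off such a
  factor involve fewer variables. The hypothesis on the degrees, which compares the operator with the
  distance from the leading order \<open>j\<close>, is preserved in this step, so that an induction on the number of
  variables applies to all the coefficients at once.
\<close>
lemma sym_op_coefficient_vanishes:
  assumes w: "lowest (Suc m) (Suc m) w"
    and ord: "\<And>\<gamma>. lookup w \<gamma> \<noteq> 0 \<Longrightarrow> lookup \<gamma> (Suc m) \<le> j"
  shows "keys \<alpha> \<subseteq> {1..m} \<Longrightarrow> keys \<beta> \<subseteq> {1..m} \<Longrightarrow>
    int (mon_degree \<alpha>) - int (mon_degree \<beta>) < int (lookup \<gamma> (Suc m)) - int j \<Longrightarrow>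
    lookup (sym_op m (mo \<alpha> \<beta>) w) \<gamma> = 0"
proof (induction "card (keys \<alpha> \<union> keys \<beta>)" arbitrary: \<alpha> \<beta> \<gamma> rule: less_induct)
  case less
  let ?n = "Suc m"
  let ?S = "keys \<alpha> \<union> keys \<beta>"
  let ?L = "lookup (sym_op m (mo \<alpha> \<beta>) w) \<gamma>"
  have n0: "lookup \<alpha> ?n = 0" "lookup \<beta> ?n = 0"
    using less.prems(1,2) by (auto simp: subset_iff in_keys_iff)
  show ?case
  proof (cases "lookup \<gamma> ?n \<le> j")
    case False
    have "lookup (mo (act \<sigma> \<alpha>) (act \<sigma> \<beta>) w) \<gamma> = 0" if \<sigma>: "\<sigma> permutes {1..m}" for \<sigma>
    proof -
      have "inv \<sigma> ?n = ?n"
        using permutes_not_in[OF permutes_inv[OF \<sigma>]] by auto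
      then have "lookup (\<gamma> - act \<sigma> \<alpha> + act \<sigma> \<beta>) ?n = lookup \<gamma> ?n"
        using n0 by (simp add: lookup_add lookup_minus lookup_act permutes_bij[OF \<sigma>])
      then have "lookup w (\<gamma> - act \<sigma> \<alpha> + act \<sigma> \<beta>) = 0"
        using ord False by metis
      then show ?thesis by (simp add: lookup_mo)
    qed
    then show ?thesis by (simp add: sym_op_mo_apply lookup_sum)
  next
    case True
    define d where "d = int (mon_degree \<alpha>) - int (mon_degree \<beta>)"
    have "d < 0" using less.prems(3) True by (simp add: d_def)
    have "mo \<alpha> \<beta> \<in> weyl_part ?n d"
      unfolding d_def using less.prems(1,2)
      by (intro weyl_part_word mo_weyl_word) (auto simp: subset_iff)
    then have "sym_op ?n (mo \<alpha> \<beta>) w = 0"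
      using lowestD[OF w sym_op_inv_ops sym_op_weyl_part \<open>d < 0\<close>] by blast
    then have sum0: "(\<Sum>k\<in>{1..?n}.
        lookup (sym_op m (conj_op (transp k ?n) (mo \<alpha> \<beta>)) w) \<gamma>) = 0"
      by (simp only: sym_op_Suc sum_op_apply lookup_sum[symmetric] lookup_zero)
    \<comment> \<open>a transposition of two variables that the operator does not involve\<close>
    have out: "conj_op (transp k ?n) (mo \<alpha> \<beta>) = mo \<alpha> \<beta>" if "k \<notin> ?S" for k
    proof -
      have "act (transp k ?n) \<delta> = \<delta>"
        if "lookup \<delta> k = 0" "lookup \<delta> ?n = 0" for \<delta> :: "nat \<Rightarrow>\<^sub>0 nat"
        by (rule poly_mapping_eqI) (use that in \<open>auto simp: lookup_map_key_bij Transposition.transpose_def\<close>)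
      then show ?thesis using that n0 by (simp add: conj_mo in_keys_iff)
    qed
    have ins: "lookup (sym_op m (conj_op (transp k ?n) (mo \<alpha> \<beta>)) w) \<gamma> = 0"
      if k: "k \<in> ?S" for k
    proof -
      let ?t = "transp k ?n"
      have kn: "k \<noteq> ?n" using k n0 by (auto simp: in_keys_iff)
      define a b \<alpha>' \<beta>' where "a = lookup \<alpha> k" and "b = lookup \<beta> k"
        and "\<alpha>' = \<alpha> - single k a" and "\<beta>' = \<beta> - single k b"
      have dec: "\<alpha> = \<alpha>' + single k a" "\<beta> = \<beta>' + single k b"
        by (auto simp: a_def b_def \<alpha>'_def \<beta>'_def poly_mapping_eq_iff fun_eq_iff lookup_add
            lookup_minus lookup_single when_def)
      have zero: "lookup \<alpha>' k = 0" "lookup \<beta>' k = 0" "lookup \<alpha>' ?n = 0" "lookup \<beta>' ?n = 0"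
        using n0 by (simp_all add: a_def b_def \<alpha>'_def \<beta>'_def lookup_minus)
      have "act ?t \<delta> = \<delta>" if "lookup \<delta> k = 0" "lookup \<delta> ?n = 0" for \<delta> :: "nat \<Rightarrow>\<^sub>0 nat"
        by (rule poly_mapping_eqI) (use that in \<open>auto simp: lookup_map_key_bij Transposition.transpose_def\<close>)
      then have conj: "conj_op ?t (mo \<alpha> \<beta>) = mo (\<alpha>' + single ?n a) (\<beta>' + single ?n b)"
        unfolding conj_mo[OF bij_transpose] dec act_single[OF bij_transpose] using zero by simp
      have "keys \<alpha>' \<union> keys \<beta>' \<subseteq> ?S - {k}"
        using zero(1,2) by (auto simp: in_keys_iff dec lookup_add)
      then have card: "card (keys \<alpha>' \<union> keys \<beta>') < card ?S"
        using k by (intro psubset_card_mono) auto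
      have keys': "keys \<alpha>' \<subseteq> {1..m}" "keys \<beta>' \<subseteq> {1..m}"
        using \<open>keys \<alpha>' \<union> keys \<beta>' \<subseteq> ?S - {k}\<close> less.prems(1,2) by auto
      show ?thesis
      proof (cases "a \<le> lookup \<gamma> ?n")
        case True
        have "int (mon_degree \<alpha>') - int (mon_degree \<beta>') <
            int (lookup (\<gamma> - single ?n a + single ?n b) ?n) - int j"
          using less.prems(3) True by (simp add: dec lookup_add lookup_minus of_nat_diff)
        then have "lookup (sym_op m (mo \<alpha>' \<beta>') w) (\<gamma> - single ?n a + single ?n b) = 0"
          by (rule less.hyps[OF card keys'])
        then show ?thesis
          unfolding conj using lookup_sym_op_mo_split[of m ?n \<alpha>' \<beta>' a b w \<gamma>] zero by simp
      next
        case False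
        then show ?thesis
          unfolding conj using lookup_sym_op_mo_split[of m ?n \<alpha>' \<beta>' a b w \<gamma>] zero by simp
      qed
    qed
    have "(\<Sum>k\<in>{1..?n}. lookup (sym_op m (conj_op (transp k ?n) (mo \<alpha> \<beta>)) w) \<gamma>) =
        (\<Sum>k\<in>{1..?n} - ?S. ?L)"
    proof (rule sum.mono_neutral_cong_right)
      show "\<forall>k\<in>{1..?n} - ({1..?n} - ?S).
          lookup (sym_op m (conj_op (transp k ?n) (mo \<alpha> \<beta>)) w) \<gamma> = 0"
        using ins by blast
      fix k assume "k \<in> {1..?n} - ?S"
      then have "conj_op (transp k ?n) (mo \<alpha> \<beta>) = mo \<alpha> \<beta>"
        by (intro out) blast
      then show "lookup (sym_op m (conj_op (transp k ?n) (mo \<alpha> \<beta>)) w) \<gamma> = ?L"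
        by (simp only:)
    qed auto
    then have "of_nat (card ({1..?n} - ?S)) * ?L = 0"
      unfolding sum0 by simp
    moreover have "?n \<in> {1..?n} - ?S" using n0 by (auto simp: in_keys_iff)
    then have "card ({1..?n} - ?S) \<noteq> 0" by (metis card_0_eq empty_iff finite_Diff finite_atLeastAtMost)
    ultimately show ?thesis by simp
  qed
qed

text \<open>
  Up to the factor \<open>j!\<close>, the vector \<open>\<partial>\<^sub>n\<^sup>j w\<close> is the coefficient of \<open>x\<^sub>n\<^sup>j\<close> in \<open>w\<close>. For this coefficient
  the previous lemma requires nothing but a negative degree of the operator.
\<close>
lemma leading_coefficient_lowest:
  assumes w: "lowest (Suc m) (Suc m) w"
    and ord: "\<And>\<gamma>. lookup w \<gamma> \<noteq> 0 \<Longrightarrow> lookup \<gamma> (Suc m) \<le> j"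
  shows "lowest (Suc m) m ((pd (Suc m) ^^ j) w)"
proof -
  let ?n = "Suc m"
  let ?p = "(pd ?n ^^ j) w"
  have "sym_op m D ?p = 0" if D: "D \<in> oper.span (mo_set ?n d)" and "d < 0" for D d
    using D
  proof (induction rule: span_op_induct)
    case (base D)
    then obtain \<alpha> \<beta> where D: "D = mo \<alpha> \<beta>" "keys \<alpha> \<subseteq> {1..?n}" "keys \<beta> \<subseteq> {1..?n}"
      "int (mon_degree \<alpha>) - int (mon_degree \<beta>) = d" by (auto simp: mo_set_def)
    define a b \<alpha>' \<beta>' where "a = lookup \<alpha> ?n" and "b = lookup \<beta> ?n"
      and "\<alpha>' = \<alpha> - single ?n a" and "\<beta>' = \<beta> - single ?n b"
    have dec: "\<alpha> = \<alpha>' + single ?n a" "\<beta> = \<beta>' + single ?n b"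
      by (auto simp: a_def b_def \<alpha>'_def \<beta>'_def poly_mapping_eq_iff fun_eq_iff lookup_add
          lookup_minus lookup_single when_def)
    have zero: "lookup \<alpha>' ?n = 0" "lookup \<beta>' ?n = 0"
      by (simp_all add: a_def b_def \<alpha>'_def \<beta>'_def lookup_minus)
    have "keys \<alpha>' \<subseteq> keys \<alpha> - {?n}" "keys \<beta>' \<subseteq> keys \<beta> - {?n}"
      using zero by (auto simp: in_keys_iff dec lookup_add)
    then have keys': "keys \<alpha>' \<subseteq> {1..m}" "keys \<beta>' \<subseteq> {1..m}"
      using D(2,3) by (auto simp: subset_iff le_Suc_eq)
    show ?case
    proof (rule poly_mapping_eqI)
      fix \<gamma>
      let ?\<gamma> = "\<gamma> - single ?n a + single ?n b"
      have "lookup (sym_op m (mo \<alpha>' \<beta>') w) (?\<gamma> + single ?n j) = 0" if "a \<le> lookup \<gamma> ?n"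
      proof (rule sym_op_coefficient_vanishes[OF w ord keys'])
        show "int (mon_degree \<alpha>') - int (mon_degree \<beta>') < int (lookup (?\<gamma> + single ?n j) ?n) - int j"
          using D(4) \<open>d < 0\<close> that by (simp add: dec lookup_add lookup_minus of_nat_diff)
      qed
      then have "lookup (sym_op m (mo \<alpha>' \<beta>') ?p) ?\<gamma> = 0" if "a \<le> lookup \<gamma> ?n"
        using that zero by (simp add: sym_op_mo_pd_commute lookup_pd_pow)
      then show "lookup (sym_op m D ?p) \<gamma> = lookup 0 \<gamma>"
        unfolding D(1) dec using lookup_sym_op_mo_split[of m ?n \<alpha>' \<beta>' a b ?p \<gamma>] zero by simp
    qed
  next
    case zero
    show ?case unfolding sym_op_0 by (rule zero_fun_apply)
  next
    case (add D E)
    then show ?case unfolding sym_op_add by simp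
  next
    case (scale c D)
    then show ?case unfolding sym_op_scale by (simp add: op_scale_def)
  qed
  then have sym0: "sym_op m D ?p = 0" if "D \<in> weyl_part ?n d" and "d < 0" for D d
    using that weyl_part_mo by blast
  have "D ?p = 0" if D: "D \<in> inv_ops ?n m" "D \<in> weyl_part ?n d" "d < 0" for D d
  proof -
    have "cscale (fact m) (D ?p) = 0"
      using sym0[OF D(2,3)] unfolding sym_op_invariant[OF D(1)] by (simp add: op_scale_def)
    then show ?thesis by simp
  qed
  then show ?thesis by (auto simp: lowest_def)
qed

section \<open>Antisymmetric polynomials\<close>

definition antisym :: "nat set set \<Rightarrow> cpoly \<Rightarrow> bool" where
  "antisym P q \<longleftrightarrow> (\<forall>A\<in>P. \<forall>k\<in>A. \<forall>l\<in>A. k \<noteq> l \<longrightarrow> perm_vars (transp k l) q = - q)"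

lemma antisym_lookup:
  assumes "antisym P q" and "A \<in> P" and "k \<in> A" and "l \<in> A" and "k \<noteq> l"
  shows "lookup q (Poly_Mapping.map_key (transp k l) \<gamma>) = - lookup q \<gamma>"
  using assms lookup_perm_vars[of "transp k l" q \<gamma>] by (auto simp: antisym_def)

lemma antisym_vanishes:
  assumes "antisym P q" and "A \<in> P" and "k \<in> A" and "l \<in> A" and "k \<noteq> l"
    and "lookup \<gamma> k = lookup \<gamma> l"
  shows "lookup q \<gamma> = 0"
proof -
  have "Poly_Mapping.map_key (transp k l) \<gamma> = \<gamma>"
    by (rule poly_mapping_eqI) (use assms(6) in \<open>auto simp: lookup_map_key_bij Transposition.transpose_def\<close>)
  then show ?thesis using antisym_lookup[OF assms(1-5), of \<gamma>] by simp
qed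

lemma antisym_inj_on: "antisym P q \<Longrightarrow> A \<in> P \<Longrightarrow> lookup q \<gamma> \<noteq> 0 \<Longrightarrow> inj_on (lookup \<gamma>) A"
  by (rule inj_onI) (metis antisym_vanishes)

lemma antisym_inv_op:
  assumes "partition_on {1..m} P" and "antisym P q" and "D \<in> inv_ops n m"
  shows "antisym P (D q)"
  unfolding antisym_def
proof (intro ballI impI)
  fix A k l
  assume *: "A \<in> P" "k \<in> A" "l \<in> A" "k \<noteq> l"
  then have "transp k l permutes {1..m}"
    using assms(1) by (intro permutes_swap_id) (auto simp: partition_on_def)
  then have "perm_vars (transp k l) (D q) = D (perm_vars (transp k l) q)"
    by (rule inv_ops_commute[OF assms(3)])
  also have "\<dots> = - D q"
    using * assms(2) by (simp add: antisym_def lin_uminus[OF inv_ops_lin[OF assms(3)]])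
  finally show "perm_vars (transp k l) (D q) = - D q" .
qed

lemma choose_two_Suc: "Suc c choose 2 = c + (c choose 2)"
  by (simp add: numeral_2_eq_2)

lemma sum_distinct_nats:
  fixes S :: "nat set"
  assumes "finite S"
  shows "card S choose 2 \<le> \<Sum>S" and "\<Sum>S = card S choose 2 \<Longrightarrow> S = {..<card S}"
proof -
  have "card S choose 2 \<le> \<Sum>S \<and> (\<Sum>S = card S choose 2 \<longrightarrow> S = {..<card S})"
    using assms
  proof (induction rule: finite_linorder_max_induct)
    case (insert b A)
    have "A \<subseteq> {..<b}" using insert.hyps(2) by auto
    then have cb: "card A \<le> b" using card_mono[of "{..<b}" A] by simp
    have b: "b \<notin> A" using insert.hyps(2) by auto
    show ?case
    proof (intro conjI impI)
      show "card (insert b A) choose 2 \<le> \<Sum>(insert b A)"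
        using cb b insert.IH insert.hyps(1) by (simp add: choose_two_Suc)
      assume "\<Sum>(insert b A) = card (insert b A) choose 2"
      then have "b + \<Sum>A = card A + (card A choose 2)"
        using b insert.hyps(1) by (simp add: choose_two_Suc)
      then have "b = card A" "\<Sum>A = card A choose 2" using cb insert.IH by linarith+
      then show "insert b A = {..<card (insert b A)}"
        using b insert.IH insert.hyps(1) by (auto simp: lessThan_Suc)
    qed
  qed simp
  then show "card S choose 2 \<le> \<Sum>S" and "\<Sum>S = card S choose 2 \<Longrightarrow> S = {..<card S}" by auto
qed

definition specht_degree :: "nat set set \<Rightarrow> nat" where
  "specht_degree P = (\<Sum>A\<in>P. card A choose 2)"

lemma partition_finite:
  assumes "partition_on {1..m :: nat} P"
  shows "finite P" and "A \<in> P \<Longrightarrow> finite A" and "A \<in> P \<Longrightarrow> A \<subseteq> {1..m}"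
    and "\<Union>P = {1..m}" and "disjoint P" and "{} \<notin> P"
  using assms finite_elements[of "{1..m}" P]
  by (auto simp: partition_on_def intro: finite_subset[of A "{1..m}"])

text \<open>
  The exponents on a block are distinct, so that their sum is at least \<open>0 + 1 + \<dots> + (|A| - 1)\<close>.
\<close>
lemma antisym_degree:
  assumes P: "partition_on {1..m} P" and q: "antisym P q" and nz: "lookup q \<gamma> \<noteq> 0"
  shows "specht_degree P \<le> mon_degree \<gamma>"
    and "mon_degree \<gamma> = specht_degree P \<Longrightarrow> A \<in> P \<Longrightarrow> lookup \<gamma> ` A = {..<card A}"
proof -
  note F = partition_finite[OF P]
  have im: "(\<Sum>i\<in>A. lookup \<gamma> i) = \<Sum>(lookup \<gamma> ` A)" "card (lookup \<gamma> ` A) = card A" if "A \<in> P" for A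
    using antisym_inj_on[OF q that nz] by (simp_all add: sum.reindex card_image)
  have ge: "card A choose 2 \<le> (\<Sum>i\<in>A. lookup \<gamma> i)" if "A \<in> P" for A
    using sum_distinct_nats(1)[of "lookup \<gamma> ` A"] im[OF that] F(2)[OF that] by simp
  have "mon_degree \<gamma> = (\<Sum>i\<in>keys \<gamma> \<union> {1..m}. lookup \<gamma> i)"
    by (rule mon_degree_superset) auto
  then have "(\<Sum>i\<in>{1..m}. lookup \<gamma> i) \<le> mon_degree \<gamma>"
    by (simp add: sum_mono2)
  moreover have "(\<Sum>i\<in>{1..m}. lookup \<gamma> i) = (\<Sum>A\<in>P. \<Sum>i\<in>A. lookup \<gamma> i)"
    unfolding F(4)[symmetric] using F by (subst sum.Union_disjoint) (auto simp: disjoint_def)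
  ultimately have deg: "(\<Sum>A\<in>P. \<Sum>i\<in>A. lookup \<gamma> i) \<le> mon_degree \<gamma>" by simp
  have "specht_degree P \<le> (\<Sum>A\<in>P. \<Sum>i\<in>A. lookup \<gamma> i)"
    unfolding specht_degree_def by (rule sum_mono) (rule ge)
  then show "specht_degree P \<le> mon_degree \<gamma>" using deg by simp
  assume eq: "mon_degree \<gamma> = specht_degree P" and A: "A \<in> P"
  have "(\<Sum>i\<in>A. lookup \<gamma> i) = card A choose 2"
  proof (rule ccontr)
    assume "(\<Sum>i\<in>A. lookup \<gamma> i) \<noteq> card A choose 2"
    then have "card A choose 2 < (\<Sum>i\<in>A. lookup \<gamma> i)" using ge[OF A] by simp
    then have "specht_degree P < (\<Sum>A\<in>P. \<Sum>i\<in>A. lookup \<gamma> i)"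
      unfolding specht_degree_def using ge A F(1) by (intro sum_strict_mono_ex1) auto
    then show False using deg eq by simp
  qed
  then show "lookup \<gamma> ` A = {..<card A}"
    using sum_distinct_nats(2)[of "lookup \<gamma> ` A"] im[OF A] F(2)[OF A] by simp
qed

text \<open>
  In the lowest possible degree, all the monomials are conjugate under the permutations that
  preserve the blocks, so that one coefficient determines the others.
\<close>
lemma antisym_unique:
  assumes P: "partition_on {1..m} P" and q: "antisym P q" and "q \<in> polys m"
    and "hdeg (int (specht_degree P)) q"
    and \<gamma>\<^sub>0: "\<And>A. A \<in> P \<Longrightarrow> lookup \<gamma>\<^sub>0 ` A = {..<card A}" "keys \<gamma>\<^sub>0 \<subseteq> {1..m}"
    and "lookup q \<gamma>\<^sub>0 = 0"
  shows "q = 0"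
proof (rule poly_mapping_eqI)
  note F = partition_finite[OF P]
  fix \<gamma>
  have "lookup q \<gamma> = 0"
  proof (induction "card {i\<in>{1..m}. lookup \<gamma> i \<noteq> lookup \<gamma>\<^sub>0 i}" arbitrary: \<gamma> rule: less_induct)
    case less
    show ?case
    proof (rule ccontr)
      assume nz: "lookup q \<gamma> \<noteq> 0"
      then have "mon_degree \<gamma> = specht_degree P" using hdegD[OF assms(4)] by force
      then have im: "lookup \<gamma> ` A = {..<card A}" if "A \<in> P" for A
        using antisym_degree(2)[OF P q nz] that by blast
      have "\<gamma> \<noteq> \<gamma>\<^sub>0" using nz assms(7) by auto
      then obtain i where i: "lookup \<gamma> i \<noteq> lookup \<gamma>\<^sub>0 i" by (metis poly_mapping_eqI)
      have im1: "i \<in> {1..m}"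
      proof (rule ccontr)
        assume "i \<notin> {1..m}"
        then have "lookup \<gamma> i = 0" "lookup \<gamma>\<^sub>0 i = 0"
          using polysD[OF assms(3) nz, of i] \<gamma>\<^sub>0(2) by (auto simp: in_keys_iff subset_iff)
        then show False using i by simp
      qed
      then obtain A where A: "A \<in> P" "i \<in> A" using F(4) by blast
      then have "lookup \<gamma>\<^sub>0 i \<in> lookup \<gamma> ` A" using im \<gamma>\<^sub>0(1) by blast
      then obtain k where k: "k \<in> A" "lookup \<gamma> k = lookup \<gamma>\<^sub>0 i" by auto
      have ik: "i \<noteq> k" using k i by auto
      have "inj_on (lookup \<gamma>\<^sub>0) A"
        using \<gamma>\<^sub>0(1)[OF A(1)] F(2)[OF A(1)] by (simp add: eq_card_imp_inj_on)
      then have k0: "lookup \<gamma>\<^sub>0 k \<noteq> lookup \<gamma>\<^sub>0 i" using k(1) A(2) ik by (auto dest: inj_onD)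
      let ?\<gamma> = "Poly_Mapping.map_key (transp i k) \<gamma>"
      have lk: "lookup ?\<gamma> j = (if j = i then lookup \<gamma>\<^sub>0 i else if j = k then lookup \<gamma> i else lookup \<gamma> j)" for j
        using k(2) by (simp add: lookup_map_key_bij Transposition.transpose_def)
      have "{j\<in>{1..m}. lookup ?\<gamma> j \<noteq> lookup \<gamma>\<^sub>0 j} \<subseteq> {j\<in>{1..m}. lookup \<gamma> j \<noteq> lookup \<gamma>\<^sub>0 j} - {i}"
        using k(2) k0 by (auto simp: lk split: if_splits)
      moreover have "i \<in> {j\<in>{1..m}. lookup \<gamma> j \<noteq> lookup \<gamma>\<^sub>0 j}" using i im1 by simp
      ultimately have "card {j\<in>{1..m}. lookup ?\<gamma> j \<noteq> lookup \<gamma>\<^sub>0 j} < card {j\<in>{1..m}. lookup \<gamma> j \<noteq> lookup \<gamma>\<^sub>0 j}"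
        by (intro psubset_card_mono) auto
      then have "lookup q ?\<gamma> = 0" by (rule less.hyps)
      then show False using antisym_lookup[OF q A(1) A(2) k(1) ik, of \<gamma>] nz by simp
    qed
  qed
  then show "lookup q \<gamma> = lookup 0 \<gamma>" by simp
qed

section \<open>Specht polynomials\<close>

lemma mult_as_sum:
  fixes p q :: cpoly
  shows "p * q = (\<Sum>m\<in>keys p. single m (lookup p m) * q)"
  by (subst poly_mapping_as_sum[of p]) (simp add: sum_distrib_right)

lemma perm_vars_single_mult:
  assumes "bij \<sigma>"
  shows "perm_vars \<sigma> (single \<alpha> c * q) = single (act \<sigma> \<alpha>) c * perm_vars \<sigma> q"
proof (rule poly_mapping_eqI)
  fix \<gamma> :: "nat \<Rightarrow>\<^sub>0 nat"
  let ?\<gamma> = "Poly_Mapping.map_key \<sigma> \<gamma>"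
  have le: "(\<forall>i. lookup \<alpha> i \<le> lookup ?\<gamma> i) \<longleftrightarrow> (\<forall>i. lookup (act \<sigma> \<alpha>) i \<le> lookup \<gamma> i)"
    using assms by (simp add: lookup_map_key_bij lookup_act) (metis bij_inv_eq_iff)
  have "Poly_Mapping.map_key \<sigma> (\<gamma> - act \<sigma> \<alpha>) = ?\<gamma> - \<alpha>"
    using assms by (auto simp: poly_mapping_eq_iff fun_eq_iff lookup_act lookup_minus
        lookup_map_key_bij bij_is_inj)
  then show "lookup (perm_vars \<sigma> (single \<alpha> c * q)) \<gamma> = lookup (single (act \<sigma> \<alpha>) c * perm_vars \<sigma> q) \<gamma>"
    using assms by (simp add: lookup_perm_vars lookup_single_mult le)
qed

lemma perm_vars_1: "bij \<sigma> \<Longrightarrow> perm_vars \<sigma> 1 = 1"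
proof (rule poly_mapping_eqI)
  fix \<gamma> :: "nat \<Rightarrow>\<^sub>0 nat"
  assume b: "bij \<sigma>"
  have "Poly_Mapping.map_key \<sigma> \<gamma> = 0 \<longleftrightarrow> \<gamma> = 0"
    using inj_eq[OF inj_map_key[OF b], of \<gamma> 0] b by (simp add: bij_is_inj)
  then show "lookup (perm_vars \<sigma> 1) \<gamma> = lookup 1 \<gamma>"
    by (simp add: lookup_perm_vars[OF b] lookup_one)
qed

lemma perm_vars_mult:
  assumes "bij \<sigma>"
  shows "perm_vars \<sigma> (p * q) = perm_vars \<sigma> p * perm_vars \<sigma> q"
proof -
  have 1: "perm_vars \<sigma> (single m c) = single (act \<sigma> m) c" for m and c :: complex
    using perm_vars_single_mult[OF assms, of m c 1] by (simp add: perm_vars_1[OF assms])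
  have "perm_vars \<sigma> p * perm_vars \<sigma> q =
      (\<Sum>m\<in>keys p. perm_vars \<sigma> (single m (lookup p m))) * perm_vars \<sigma> q"
    by (subst poly_mapping_as_sum[of p]) (simp add: lin_sum[OF lin_perm_vars[OF assms]])
  also have "\<dots> = (\<Sum>m\<in>keys p. perm_vars \<sigma> (single m (lookup p m) * q))"
    by (simp only: perm_vars_single_mult[OF assms] 1 sum_distrib_right)
  also have "\<dots> = perm_vars \<sigma> (p * q)"
    by (subst mult_as_sum[of p q]) (simp only: lin_sum[OF lin_perm_vars[OF assms]])
  finally show ?thesis by simp
qed

lemma perm_vars_prod: "bij \<sigma> \<Longrightarrow> perm_vars \<sigma> (\<Prod>i\<in>I. f i) = (\<Prod>i\<in>I. perm_vars \<sigma> (f i))"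
  by (induction I rule: infinite_finite_induct) (simp_all add: perm_vars_1 perm_vars_mult)

lemma perm_vars_X_diff: "bij \<sigma> \<Longrightarrow> perm_vars \<sigma> (X i - X j) = X (\<sigma> i) - X (\<sigma> j)"
  using perm_vars_X_mult[of \<sigma> i 1] perm_vars_X_mult[of \<sigma> j 1]
  by (simp add: lin_diff[OF lin_perm_vars] perm_vars_1)

definition vandermonde :: "nat set \<Rightarrow> cpoly" where
  "vandermonde A = (\<Prod>(k, l)\<in>{(k, l). k \<in> A \<and> l \<in> A \<and> k < l}. X k - X l)"

lemma specht_vandermonde: "specht P = (\<Prod>A\<in>P. vandermonde A)"
  by (simp add: specht_def vandermonde_def)

text \<open>
  The transposition permutes the factors up to sign. The pairs whose order it reverses are \<open>(k, l)\<close>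
  itself and, for each \<open>j\<close> between \<open>k\<close> and \<open>l\<close>, the two pairs \<open>(k, j)\<close> and \<open>(j, l)\<close>: an odd number.
\<close>
lemma vandermonde_transpose:
  assumes "finite A" and "k \<in> A" and "l \<in> A" and "k < l"
  shows "perm_vars (transp k l) (vandermonde A) = - vandermonde A"
proof -
  let ?t = "transp k l"
  define E where "E = {(i, j). i \<in> A \<and> j \<in> A \<and> i < j}"
  define g where "g = (\<lambda>(i, j). X i - X j)"
  \<comment> \<open>the action on pairs, with the components put into increasing order\<close>
  define sw where "sw = (\<lambda>(i, j). if ?t i < ?t j then (?t i, ?t j) else (?t j, ?t i))"
  define I where "I = {e\<in>E. ?t (snd e) < ?t (fst e)}"
  have finE: "finite E"
    by (rule finite_subset[of _ "A \<times> A"]) (use assms(1) in \<open>auto simp: E_def\<close>)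
  have tA: "?t i \<in> A \<longleftrightarrow> i \<in> A" for i
    using assms(2,3) by (auto simp: Transposition.transpose_def)
  have tt: "?t i = ?t j \<longleftrightarrow> i = j" for i j
    by (metis transpose_involutory)
  have sw: "sw e \<in> E \<and> sw (sw e) = e" if "e \<in> E" for e
  proof -
    obtain i j where e: "e = (i, j)" "i \<in> A" "j \<in> A" "i < j"
      using \<open>e \<in> E\<close> by (auto simp: E_def)
    have m: "?t i \<in> A" "?t j \<in> A" using e tA by auto
    show ?thesis
    proof (cases "?t i < ?t j")
      case True
      then show ?thesis using e m by (simp add: E_def sw_def)
    next
      case False
      moreover have "?t j \<noteq> ?t i" using tt[of j i] e by simp
      ultimately show ?thesis using e m by (simp add: E_def sw_def)
    qed
  qed
  then have bij: "bij_betw sw E E"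
    by (intro bij_betw_byWitness[where f' = sw]) auto
  have sgn: "X (?t (fst e)) - X (?t (snd e)) = (if e \<in> I then - 1 else 1) * g (sw e)" if "e \<in> E" for e
    using that by (auto simp: I_def g_def sw_def E_def not_less)
  have "perm_vars ?t (vandermonde A) = (\<Prod>e\<in>E. X (?t (fst e)) - X (?t (snd e)))"
    by (simp add: vandermonde_def E_def perm_vars_prod perm_vars_X_diff case_prod_unfold)
  also have "\<dots> = (\<Prod>e\<in>E. (if e \<in> I then - 1 else 1) * g (sw e))"
    by (rule prod.cong) (auto simp only: sgn)
  also have "\<dots> = (\<Prod>e\<in>E. if e \<in> I then - 1 else 1) * (\<Prod>e\<in>E. g (sw e))"
    by (rule prod.distrib)
  also have "(\<Prod>e\<in>E. g (sw e)) = vandermonde A"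
    unfolding prod.reindex_bij_betw[OF bij] by (simp add: vandermonde_def E_def g_def)
  also have "(\<Prod>e\<in>E. if e \<in> I then - 1 else 1 :: cpoly) = (- 1) ^ card I"
  proof -
    have "{e\<in>E. e \<in> I} = I" by (auto simp: I_def)
    then show ?thesis using finE by (simp add: prod.If_cases Int_def)
  qed
  also have "(- 1 :: cpoly) ^ card I = - 1"
  proof -
    define J where "J = {j\<in>A. k < j \<and> j < l}"
    have finJ: "finite J" using assms(1) by (simp add: J_def)
    have "I = insert (k, l) (Pair k ` J \<union> (\<lambda>j. (j, l)) ` J)"
    proof (intro set_eqI iffI)
      fix e assume "e \<in> I"
      then obtain i j where e: "e = (i, j)" "i \<in> A" "j \<in> A" "i < j" "?t j < ?t i"
        by (auto simp: I_def E_def)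
      then show "e \<in> insert (k, l) (Pair k ` J \<union> (\<lambda>j. (j, l)) ` J)"
        using assms(4) by (auto simp: J_def Transposition.transpose_def split: if_splits)
    next
      fix e assume "e \<in> insert (k, l) (Pair k ` J \<union> (\<lambda>j. (j, l)) ` J)"
      then show "e \<in> I"
        using assms(2-4) by (auto simp: I_def E_def J_def)
    qed
    moreover have "card (Pair k ` J \<union> (\<lambda>j. (j, l)) ` J) = 2 * card J"
      using finJ by (subst card_Un_disjoint) (auto simp: J_def card_image inj_on_def)
    moreover have "(k, l) \<notin> Pair k ` J \<union> (\<lambda>j. (j, l)) ` J"
      by (auto simp: J_def)
    ultimately have "card I = Suc (2 * card J)" using finJ by simp
    then show ?thesis by simp
  qed
  finally show ?thesis by simp
qed

lemma vandermonde_fixed: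
  assumes "k \<notin> A" and "l \<notin> A"
  shows "perm_vars (transp k l) (vandermonde A) = vandermonde A"
proof -
  have "transp k l i = i" if "i \<in> A" for i
    using that assms by (metis transpose_apply_other)
  then show ?thesis
    unfolding vandermonde_def
    by (simp add: perm_vars_prod case_prod_unfold perm_vars_X_diff)
qed

lemma specht_antisym:
  assumes P: "partition_on {1..m} P"
  shows "antisym P (specht P)"
  unfolding antisym_def
proof (intro ballI impI)
  note F = partition_finite[OF P]
  have main: "perm_vars (transp k l) (specht P) = - specht P"
    if A: "A \<in> P" "k \<in> A" "l \<in> A" "k < l" for A k l
  proof -
    have "perm_vars (transp k l) (vandermonde B) = vandermonde B" if "B \<in> P - {A}" for B
    proof (rule vandermonde_fixed)
      have "A \<inter> B = {}" using that A F(5) by (auto simp: disjoint_def)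
      then show "k \<notin> B" "l \<notin> B" using A by auto
    qed
    then have "(\<Prod>B\<in>P - {A}. perm_vars (transp k l) (vandermonde B)) =
        (\<Prod>B\<in>P - {A}. vandermonde B)"
      by (rule prod.cong[OF refl])
    moreover have "perm_vars (transp k l) (specht P) =
        (\<Prod>B\<in>P. perm_vars (transp k l) (vandermonde B))"
      unfolding specht_vandermonde by (rule perm_vars_prod[OF bij_transpose])
    ultimately show ?thesis
      unfolding prod.remove[OF F(1) A(1)] vandermonde_transpose[OF F(2)[OF A(1)] A(2-4)]
      by (simp add: specht_vandermonde prod.remove[OF F(1) A(1)])
  qed
  fix A k l
  assume "A \<in> P" "k \<in> A" "l \<in> A" "k \<noteq> l"
  then show "perm_vars (transp k l) (specht P) = - specht P"
    using main[of A k l] main[of A l k] by (metis linorder_neqE_nat transpose_commute)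
qed

lemma keys_mult_obtain:
  assumes "lookup (p * q :: cpoly) \<gamma> \<noteq> 0"
  obtains \<alpha> \<beta> where "\<gamma> = \<alpha> + \<beta>" and "lookup p \<alpha> \<noteq> 0" and "lookup q \<beta> \<noteq> 0"
  using keys_mult[of p q] assms by (auto simp: in_keys_iff subset_iff)

lemma polys_mult:
  assumes "p \<in> polys n" and "q \<in> polys n"
  shows "p * q \<in> polys n"
proof (rule polysI)
  fix \<gamma> i
  assume nz: "lookup (p * q) \<gamma> \<noteq> 0" and i: "lookup \<gamma> i \<noteq> 0"
  from nz obtain \<alpha> \<beta> where *: "\<gamma> = \<alpha> + \<beta>" "lookup p \<alpha> \<noteq> 0" "lookup q \<beta> \<noteq> 0"
    by (rule keys_mult_obtain)
  then have "lookup \<alpha> i \<noteq> 0 \<or> lookup \<beta> i \<noteq> 0" using i by (auto simp: lookup_add)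
  then show "i \<in> {1..n}"
    using polysD[OF assms(1) *(2)] polysD[OF assms(2) *(3)] by blast
qed

lemma hdeg_mult:
  assumes "hdeg e p" and "hdeg e' q"
  shows "hdeg (e + e') (p * q)"
proof (rule hdegI)
  fix \<gamma>
  assume "lookup (p * q) \<gamma> \<noteq> 0"
  then obtain \<alpha> \<beta> where *: "\<gamma> = \<alpha> + \<beta>" "lookup p \<alpha> \<noteq> 0" "lookup q \<beta> \<noteq> 0"
    by (rule keys_mult_obtain)
  then show "int (mon_degree \<gamma>) = e + e'"
    using hdegD[OF assms(1) *(2)] hdegD[OF assms(2) *(3)] by simp
qed

lemma polys_1: "1 \<in> polys n"
  by (rule polysI) (auto simp: lookup_one when_def split: if_splits)

lemma hdeg_1: "hdeg 0 1"
  by (rule hdegI) (auto simp: lookup_one when_def split: if_splits)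

lemma polys_prod: "(\<And>i. i \<in> I \<Longrightarrow> f i \<in> polys n) \<Longrightarrow> (\<Prod>i\<in>I. f i) \<in> polys n"
  by (induction I rule: infinite_finite_induct) (simp_all add: polys_1 polys_mult)

lemma hdeg_prod:
  "finite I \<Longrightarrow> (\<And>i. i \<in> I \<Longrightarrow> hdeg (e i) (f i)) \<Longrightarrow> hdeg (\<Sum>i\<in>I. e i) (\<Prod>i\<in>I. f i)"
  by (induction I rule: finite_induct) (simp_all add: hdeg_1 hdeg_mult)

lemma polys_X_diff: "i \<in> {1..n} \<Longrightarrow> j \<in> {1..n} \<Longrightarrow> X i - X j \<in> polys n"
  using polys_add[OF polys_X[OF polys_1] polys_cscale[OF polys_X[OF polys_1]], of i n j "- 1"]
  by (simp add: cscale_minus1)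

lemma hdeg_X_diff: "hdeg 1 (X i - X j)"
  using hdeg_diff[OF hdeg_X[OF hdeg_1] hdeg_X[OF hdeg_1], of i j] by simp

lemma X_diff_nonzero:
  assumes "i \<noteq> j"
  shows "X i - X j \<noteq> 0"
proof -
  have "unit_exp j \<noteq> unit_exp i"
    using assms by (metis lookup_single_eq lookup_single_not_eq zero_neq_one)
  then have "lookup (X i - X j) (unit_exp i) = 1"
    by (simp add: X_def lookup_minus lookup_single)
  then show ?thesis by auto
qed

lemma vandermonde_nonzero:
  assumes "finite A"
  shows "vandermonde A \<noteq> 0"
proof -
  have "finite {(k, l). k \<in> A \<and> l \<in> A \<and> k < l}"
    by (rule finite_subset[of _ "A \<times> A"]) (use assms in auto)
  moreover have "X k - X l \<noteq> 0" if "k < l" for k l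
    using that by (intro X_diff_nonzero) simp
  ultimately show ?thesis
    unfolding vandermonde_def by (subst prod_zero_iff) auto
qed

lemma vandermonde_polys: "A \<subseteq> {1..n} \<Longrightarrow> vandermonde A \<in> polys n"
  unfolding vandermonde_def by (rule polys_prod) (auto intro!: polys_X_diff)

lemma vandermonde_insert:
  assumes "finite A" and "\<And>k. k \<in> A \<Longrightarrow> k < b"
  shows "vandermonde (insert b A) = vandermonde A * (\<Prod>k\<in>A. X k - X b)"
proof -
  let ?E = "{(k, l). k \<in> A \<and> l \<in> A \<and> k < l}"
  have fin: "finite ?E" by (rule finite_subset[of _ "A \<times> A"]) (use assms(1) in auto)
  have "b \<notin> A" using assms(2) by blast
  then have dec: "{(k, l). k \<in> insert b A \<and> l \<in> insert b A \<and> k < l} = ?E \<union> (\<lambda>k. (k, b)) ` A"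
    using assms(2) by (auto dest: less_asym)
  have "(\<Prod>(k, l)\<in>?E \<union> (\<lambda>k. (k, b)) ` A. X k - X l) =
      (\<Prod>(k, l)\<in>?E. X k - X l) * (\<Prod>(k, l)\<in>(\<lambda>k. (k, b)) ` A. X k - X l)"
    using fin assms(1) \<open>b \<notin> A\<close> by (intro prod.union_disjoint) auto
  also have "(\<Prod>(k, l)\<in>(\<lambda>k. (k, b)) ` A. X k - X l) = (\<Prod>k\<in>A. X k - X b)"
    by (subst prod.reindex) (auto simp: inj_on_def)
  finally show ?thesis by (simp only: vandermonde_def dec)
qed

lemma vandermonde_hdeg: "finite A \<Longrightarrow> hdeg (int (card A choose 2)) (vandermonde A)"
proof (induction rule: finite_linorder_max_induct)
  case empty
  then show ?case by (simp add: vandermonde_def hdeg_1 numeral_2_eq_2)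
next
  case (insert b A)
  have b: "b \<notin> A" using insert.hyps(2) by blast
  have "hdeg (\<Sum>k\<in>A. 1) (\<Prod>k\<in>A. X k - X b)"
    by (rule hdeg_prod[OF insert.hyps(1) hdeg_X_diff])
  then have "hdeg (int (card A choose 2) + int (card A)) (vandermonde A * (\<Prod>k\<in>A. X k - X b))"
    using hdeg_mult[OF insert.IH] by simp
  then show ?case
    using insert.hyps b by (simp add: vandermonde_insert choose_two_Suc add.commute)
qed

lemma specht_facts:
  assumes P: "partition_on {1..m} P"
  shows specht_nonzero: "specht P \<noteq> 0"
    and specht_polys: "specht P \<in> polys m"
    and specht_hdeg: "hdeg (int (specht_degree P)) (specht P)"
proof -
  note F = partition_finite[OF P]
  show "specht P \<noteq> 0"
    unfolding specht_vandermonde using F(1,2) vandermonde_nonzero by simp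
  show "specht P \<in> polys m"
    unfolding specht_vandermonde using F(3) by (intro polys_prod vandermonde_polys)
  show "hdeg (int (specht_degree P)) (specht P)"
    unfolding specht_vandermonde specht_degree_def of_nat_sum
    using F(1,2) by (intro hdeg_prod vandermonde_hdeg)
qed

lemma polys_mono: "m \<le> n \<Longrightarrow> polys m \<subseteq> polys n"
  by (fastforce simp: polys_def)

text \<open>
  An invariant operator of negative degree would produce an antisymmetric polynomial of a degree
  that is too low for one.
\<close>
lemma specht_lowest:
  assumes P: "partition_on {1..m} P"
  shows "lowest n m (specht P)"
proof -
  have "D (specht P) = 0" if D: "D \<in> inv_ops n m" "D \<in> weyl_part n d" "d < 0" for D d
  proof (rule poly_mapping_eqI, rule ccontr)
    fix \<gamma>
    assume "lookup (D (specht P)) \<gamma> \<noteq> lookup 0 \<gamma>"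
    then have nz: "lookup (D (specht P)) \<gamma> \<noteq> 0" by simp
    have "specht_degree P \<le> mon_degree \<gamma>"
      by (rule antisym_degree(1)[OF P antisym_inv_op[OF P specht_antisym[OF P] D(1)] nz])
    moreover have "int (mon_degree \<gamma>) = int (specht_degree P) + d"
      by (rule hdegD[OF weyl_part_hdeg[OF D(2) specht_hdeg[OF P]] nz])
    ultimately show False using D(3) by simp
  qed
  then show ?thesis by (auto simp: lowest_def)
qed

text \<open>
  Both polynomials are antisymmetric of the lowest possible degree. Subtract the multiple of the
  Specht polynomial that removes one of its monomials.
\<close>
lemma specht_degree_0_op:
  assumes P: "partition_on {1..n} P" and D: "D \<in> inv_ops n n" "D \<in> weyl_part n 0"
  shows "\<exists>c. D (specht P) = cscale c (specht P)"
proof -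
  let ?s = "specht P"
  obtain \<gamma>\<^sub>0 where \<gamma>0: "lookup ?s \<gamma>\<^sub>0 \<noteq> 0"
    using specht_nonzero[OF P] by (metis lookup_zero poly_mapping_eqI)
  define c where "c = lookup (D ?s) \<gamma>\<^sub>0 / lookup ?s \<gamma>\<^sub>0"
  have op: "D + op_scale (- c) id \<in> inv_ops n n" "D + op_scale (- c) id \<in> weyl_part n 0"
    using D inv_ops_add[OF D(1) inv_ops_scale[OF inv_ops_id]]
      weyl_part_add[OF D(2) weyl_part_scale[OF weyl_part_word[OF weyl_word.one]]] by blast+
  have eq: "(D + op_scale (- c) id) ?s = D ?s - cscale c ?s"
    by (simp add: op_scale_def)
  have "D ?s - cscale c ?s = 0"
  proof (rule antisym_unique[OF P])
    show "antisym P (D ?s - cscale c ?s)"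
      unfolding eq[symmetric] by (rule antisym_inv_op[OF P specht_antisym[OF P] op(1)])
    show "D ?s - cscale c ?s \<in> polys n"
      unfolding eq[symmetric] by (rule weyl_polys[OF inv_ops_weyl[OF op(1)] specht_polys[OF P]])
    show "hdeg (int (specht_degree P)) (D ?s - cscale c ?s)"
      unfolding eq[symmetric] using weyl_part_hdeg[OF op(2) specht_hdeg[OF P]] by simp
    show "lookup \<gamma>\<^sub>0 ` A = {..<card A}" if "A \<in> P" for A
      using antisym_degree(2)[OF P specht_antisym[OF P] \<gamma>0 _ that] hdegD[OF specht_hdeg[OF P] \<gamma>0]
      by simp
    show "keys \<gamma>\<^sub>0 \<subseteq> {1..n}"
      using polysD[OF specht_polys[OF P] \<gamma>0] by (auto simp: in_keys_iff)
    show "lookup (D ?s - cscale c ?s) \<gamma>\<^sub>0 = 0"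
      using \<gamma>0 by (simp add: lookup_minus c_def)
  qed
  then show ?thesis by auto
qed

lemma specht_simple:
  assumes P: "partition_on {1..n} P"
  shows "simple_submod n n (cyclic n n (specht P))"
  using P by (intro simple_cyclic[where d = "int (specht_degree P)"] order_refl specht_polys
      specht_nonzero specht_hdeg specht_lowest specht_degree_0_op)

subsection \<open>Orders in one variable\<close>

lemma X_pow: "X n ^ a = single (single n a) 1"
  by (induction a) (simp_all add: X_def mult_single single_add[symmetric] One_nat_def)

lemma lookup_X_pow_mult:
  "lookup (X n ^ a * p) \<gamma> = (if a \<le> lookup \<gamma> n then lookup p (\<gamma> - single n a) else 0)"
proof -
  have "(\<forall>i. lookup (single n a) i \<le> lookup \<gamma> i) \<longleftrightarrow> a \<le> lookup \<gamma> n"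
    by (auto simp: lookup_single when_def)
  then show ?thesis by (simp add: X_pow lookup_single_mult)
qed

lemma lower_orderI: "(\<And>\<gamma>. lookup p \<gamma> \<noteq> 0 \<Longrightarrow> lookup \<gamma> n < a) \<Longrightarrow> lower_order n a p"
  and lower_orderD: "lower_order n a p \<Longrightarrow> lookup p \<gamma> \<noteq> 0 \<Longrightarrow> lookup \<gamma> n < a"
  by (auto simp: lower_order_def in_keys_iff)

lemma lower_order_iff_pd: "lower_order n a p \<longleftrightarrow> (pd n ^^ a) p = 0"
proof
  assume p: "lower_order n a p"
  show "(pd n ^^ a) p = 0"
    by (rule poly_mapping_eqI) (use lower_orderD[OF p] in \<open>force simp: lookup_pd_pow lookup_add\<close>)
next
  assume 0: "(pd n ^^ a) p = 0"
  show "lower_order n a p"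
  proof (rule lower_orderI, rule ccontr)
    fix \<gamma>
    assume nz: "lookup p \<gamma> \<noteq> 0" and "\<not> lookup \<gamma> n < a"
    then have "\<gamma> = (\<gamma> - single n a) + single n a"
      by (auto simp: poly_mapping_eq_iff fun_eq_iff lookup_add lookup_minus lookup_single when_def)
    then have "lookup ((pd n ^^ a) p) (\<gamma> - single n a) \<noteq> 0"
      using nz by (simp add: lookup_pd_pow ffact_eq_0_iff)
    then show False using 0 by simp
  qed
qed

lemma lower_order_add:
  assumes "lower_order n a p" and "lower_order n a q"
  shows "lower_order n a (p + q)"
proof (rule lower_orderI)
  fix \<gamma>
  assume "lookup (p + q) \<gamma> \<noteq> 0"
  then have "lookup p \<gamma> \<noteq> 0 \<or> lookup q \<gamma> \<noteq> 0" by (auto simp: lookup_add)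
  then show "lookup \<gamma> n < a" using assms lower_orderD by blast
qed

lemma lower_order_cscale: "lower_order n a p \<Longrightarrow> lower_order n a (cscale c p)"
  by (rule lower_orderI) (auto dest: lower_orderD)

lemma lower_order_mono: "lower_order n a p \<Longrightarrow> a \<le> b \<Longrightarrow> lower_order n b p"
  by (rule lower_orderI) (auto dest: lower_orderD)

lemma lower_order_X_mult: "lower_order n a p \<Longrightarrow> lower_order n (Suc a) (X n * p)"
proof (rule lower_orderI)
  fix \<gamma>
  assume p: "lower_order n a p" and "lookup (X n * p) \<gamma> \<noteq> 0"
  then have "lookup p (\<gamma> - unit_exp n) \<noteq> 0" by (auto simp: lookup_X_mult split: if_splits)
  then show "lookup \<gamma> n < Suc a" using lower_orderD[OF p] by (fastforce simp: lookup_minus)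
qed

lemma lower_order_X_mult_other: "lower_order n a p \<Longrightarrow> k \<noteq> n \<Longrightarrow> lower_order n a (X k * p)"
proof (rule lower_orderI)
  fix \<gamma>
  assume p: "lower_order n a p" and "k \<noteq> n" and "lookup (X k * p) \<gamma> \<noteq> 0"
  then have "lookup p (\<gamma> - unit_exp k) \<noteq> 0" by (auto simp: lookup_X_mult split: if_splits)
  then show "lookup \<gamma> n < a"
    using lower_orderD[OF p] \<open>k \<noteq> n\<close> by (fastforce simp: lookup_minus lookup_single)
qed

lemma polys_lower_order: "p \<in> polys m \<Longrightarrow> m < n \<Longrightarrow> lower_order n 1 p"
  by (rule lower_orderI) (metis atLeastAtMost_iff less_one not_less polysD zero_less_iff_neq_zero)

lemma lower_order_X_pow_mult: "lower_order n 1 p \<Longrightarrow> lower_order n (Suc a) (X n ^ a * p)"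
proof (induction a)
  case (Suc a)
  then show ?case using lower_order_X_mult by (simp add: mult.assoc)
qed (simp add: One_nat_def)

text \<open>
  Each of the factors contributes \<open>- x\<^sub>n\<close> to the leading term.
\<close>
lemma mult_prod_X_diff_expansion:
  assumes "finite A" and "n \<notin> A" and "lower_order n 1 p"
  shows "\<exists>p'. p * (\<Prod>k\<in>A. X k - X n) = cscale ((- 1) ^ card A) (X n ^ card A * p) + p' \<and>
    lower_order n (card A) p'"
  using assms(1,2)
proof (induction A rule: finite_induct)
  case empty
  show ?case by (intro exI[of _ 0]) (auto simp: lower_order_def)
next
  case (insert k A)
  let ?a = "card A"
  let ?T = "cscale ((- 1) ^ ?a) (X n ^ ?a * p)"
  obtain p' where p': "p * (\<Prod>k\<in>A. X k - X n) = ?T + p'" "lower_order n ?a p'"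
    using insert by auto
  have kn: "k \<noteq> n" using insert.prems by auto
  have "p * (\<Prod>k\<in>insert k A. X k - X n) = (X k - X n) * (p * (\<Prod>k\<in>A. X k - X n))"
    using insert.hyps by (simp add: algebra_simps)
  also have "\<dots> = (X k - X n) * (?T + p')"
    by (simp only: p'(1))
  also have "\<dots> = - (X n * ?T) + (X k * (?T + p') + cscale (- 1) (X n * p'))"
    by (simp add: cscale_minus1 algebra_simps)
  also have "- (X n * ?T) = cscale ((- 1) ^ Suc ?a) (X n ^ Suc ?a * p)"
  proof -
    have "- (X n * ?T) = cscale (- 1) (cscale ((- 1) ^ ?a) (X n * (X n ^ ?a * p)))"
      by (simp only: cscale_minus1 lin_cscale[OF lin_X])
    then show ?thesis by (simp add: mult.assoc)
  qed
  finally have "p * (\<Prod>k\<in>insert k A. X k - X n) =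
      cscale ((- 1) ^ Suc ?a) (X n ^ Suc ?a * p) + (X k * (?T + p') + cscale (- 1) (X n * p'))" .
  moreover have "lower_order n (Suc ?a) (X k * (?T + p') + cscale (- 1) (X n * p'))"
    by (intro lower_order_add lower_order_X_mult_other lower_order_cscale lower_order_X_mult
        lower_order_X_pow_mult assms(3) kn p'(2) lower_order_mono[OF p'(2)]) simp
  ultimately show ?case using insert.hyps by auto
qed

lemma ffact_self: "ffact k b * fact (k - b) = fact k" if "b \<le> k"
  using that
proof (induction b)
  case (Suc b)
  then have "fact (k - b) = (k - b) * fact (k - Suc b)"
    by (metis Suc_diff_Suc Suc_le_lessD fact_Suc of_nat_id)
  then show ?case using Suc by (simp add: mult.assoc)
qed simp

lemma pd_pow_X_pow:
  assumes "lower_order n 1 p"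
  shows "(pd n ^^ a) (X n ^ a * p) = cscale (fact a) p"
proof (rule poly_mapping_eqI)
  fix \<gamma>
  show "lookup ((pd n ^^ a) (X n ^ a * p)) \<gamma> = lookup (cscale (fact a) p) \<gamma>"
  proof (cases "lookup p \<gamma> = 0")
    case False
    then have "lookup \<gamma> n = 0" using lower_orderD[OF assms] by fastforce
    moreover have "ffact a a = fact a" using ffact_self[of a a] by simp
    ultimately show ?thesis
      by (simp add: lookup_pd_pow lookup_X_pow_mult lookup_add)
  qed (simp add: lookup_pd_pow lookup_X_pow_mult lookup_add)
qed

lemma leading_term_expansion:
  assumes "(pd n ^^ a) w = cscale (fact a) p" and "lower_order n 1 p"
  shows "lower_order n a (w - X n ^ a * p)"
  unfolding lower_order_iff_pd
proof -
  have "lin (pd n ^^ a)"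
  proof (induction a)
    case (Suc a)
    show ?case unfolding funpow.simps by (rule lin_comp[OF lin_pd Suc])
  qed (simp add: lin_def)
  then show "(pd n ^^ a) (w - X n ^ a * p) = 0"
    by (simp add: lin_diff assms pd_pow_X_pow)
qed

section \<open>Isomorphisms of submodules\<close>

text \<open>
  As \<open>submod_iso\<close>, with the map as a parameter, so that elements can be transported along it.
\<close>
definition mod_iso :: "nat \<Rightarrow> nat \<Rightarrow> (cpoly \<Rightarrow> cpoly) \<Rightarrow> cpoly set \<Rightarrow> cpoly set \<Rightarrow> bool" where
  "mod_iso n m f M N \<longleftrightarrow> bij_betw f M N \<and> (\<forall>p\<in>M. \<forall>q\<in>M. f (p + q) = f p + f q) \<and>
     (\<forall>D\<in>inv_ops n m. \<forall>p\<in>M. f (D p) = D (f p))"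

lemma submod_iso_mod_iso: "submod_iso n m M N \<longleftrightarrow> (\<exists>f. mod_iso n m f M N)"
  by (simp add: submod_iso_def mod_iso_def)

lemma mod_iso_mem: "mod_iso n m f M N \<Longrightarrow> p \<in> M \<Longrightarrow> f p \<in> N"
  and mod_iso_op: "mod_iso n m f M N \<Longrightarrow> D \<in> inv_ops n m \<Longrightarrow> p \<in> M \<Longrightarrow> f (D p) = D (f p)"
  by (auto simp: mod_iso_def bij_betw_def)

lemma mod_iso_cscale:
  assumes "mod_iso n m f M N" and "p \<in> M"
  shows "f (cscale c p) = cscale c (f p)"
  using mod_iso_op[OF assms(1) inv_ops_scale[OF inv_ops_id] assms(2), of c] by (simp add: op_scale_def)

lemma mod_iso_0:
  assumes "mod_iso n m f M N" and "0 \<in> M"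
  shows "f 0 = 0"
  using mod_iso_cscale[OF assms, of 0] by simp

lemma mod_iso_eq_0_iff:
  assumes "mod_iso n m f M N" and "0 \<in> M" and "p \<in> M"
  shows "f p = 0 \<longleftrightarrow> p = 0"
  using mod_iso_0[OF assms(1,2)] assms by (metis bij_betw_def inj_onD mod_iso_def)

lemma mod_iso_inverse:
  assumes f: "mod_iso n m f M N" and M: "submod n m M"
  shows "mod_iso n m (inv_into M f) N M"
proof -
  have bij: "bij_betw f M N" using f by (simp add: mod_iso_def)
  let ?g = "inv_into M f"
  have gM: "?g y \<in> M" "f (?g y) = y" if "y \<in> N" for y
    using that bij by (metis bij_betw_def inv_into_into, metis bij_betw_inv_into_right)
  have gf: "?g (f x) = x" if "x \<in> M" for x
    using that bij by (metis bij_betw_inv_into_left)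
  have "?g (p + q) = ?g p + ?g q" if "p \<in> N" "q \<in> N" for p q
  proof -
    have "f (?g p + ?g q) = p + q" using f gM that by (simp add: mod_iso_def)
    then show ?thesis using gf[of "?g p + ?g q"] submodD(3)[OF M] gM that by metis
  qed
  moreover have "?g (D p) = D (?g p)" if "D \<in> inv_ops n m" "p \<in> N" for D p
  proof -
    have "f (D (?g p)) = D p" using mod_iso_op[OF f that(1)] gM that by simp
    then show ?thesis using gf[of "D (?g p)"] submodD(4)[OF M that(1)] gM that by metis
  qed
  ultimately show ?thesis
    using bij_betw_inv_into[OF bij] by (simp add: mod_iso_def)
qed

lemma mod_iso_lowest:
  assumes f: "mod_iso n m f M N" and "submod n m M" and "p \<in> M" and "m \<le> m'" and "lowest n m' p"
  shows "lowest n m' (f p)"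
  unfolding lowest_def
proof (intro allI impI ballI)
  fix d D
  assume "d < (0 :: int)" and D: "D \<in> inv_ops n m' \<inter> weyl_part n d"
  then have "f (D p) = D (f p)"
    using mod_iso_op[OF f _ assms(3)] inv_ops_mono[OF assms(4)] by blast
  moreover have "D p = 0" using D \<open>d < 0\<close> lowestD[OF assms(5)] by blast
  ultimately show "D (f p) = 0"
    using mod_iso_0[OF f submodD(2)[OF assms(2)]] by simp
qed

lemma mod_iso_hdeg:
  assumes f: "mod_iso n m f M N" and "m \<le> n" and "M \<subseteq> polys n" and "N \<subseteq> polys n"
    and "p \<in> M" and "hdeg e p"
  shows "hdeg e (f p)"
proof (rule hdeg_eulerI[where n = n])
  show "f p \<in> polys n" using assms mod_iso_mem by blast
  have "euler n (f p) = f (euler n p)"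
    using mod_iso_op[OF f euler_inv_ops[OF assms(2)] assms(5)] by simp
  then show "euler n (f p) = cscale (of_int e) (f p)"
    using euler_hdeg[of p n e] assms mod_iso_cscale[OF f assms(5)] by auto
qed

text \<open>
  Both modules are the quotient of the ring by the same left ideal.
\<close>
lemma cyclic_iso:
  assumes "\<And>D. D \<in> inv_ops n m \<Longrightarrow> D u = 0 \<longleftrightarrow> D w = 0"
  shows "submod_iso n m (cyclic n m u) (cyclic n m w)"
proof -
  have eq: "D u = E u \<longleftrightarrow> D w = E w" if "D \<in> inv_ops n m" "E \<in> inv_ops n m" for D E
  proof -
    have "D + op_scale (- 1) E \<in> inv_ops n m"
      using that by (intro inv_ops_add inv_ops_scale)
    from assms[OF this] show ?thesis by (simp add: op_scale_def cscale_minus1)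
  qed
  define f where "f y = (SOME D. D \<in> inv_ops n m \<and> y = D u) w" for y
  have f: "f (D u) = D w" if D: "D \<in> inv_ops n m" for D
  proof -
    let ?E = "SOME E. E \<in> inv_ops n m \<and> D u = E u"
    have "?E \<in> inv_ops n m \<and> D u = ?E u" by (rule someI[of _ D]) (use D in simp)
    then have "D w = ?E w" using eq D by blast
    then show ?thesis by (simp add: f_def)
  qed
  have "mod_iso n m f (cyclic n m u) (cyclic n m w)"
    unfolding mod_iso_def
  proof (intro conjI ballI)
    show "bij_betw f (cyclic n m u) (cyclic n m w)"
      unfolding bij_betw_def
    proof
      show "inj_on f (cyclic n m u)"
      proof (rule inj_onI)
        fix x y
        assume "x \<in> cyclic n m u" "y \<in> cyclic n m u" and fe: "f x = f y"
        then obtain D E where "D \<in> inv_ops n m" "x = D u" "E \<in> inv_ops n m" "y = E u"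
          by (metis cyclicE)
        then show "x = y" using f eq fe by metis
      qed
      show "f ` cyclic n m u = cyclic n m w"
      proof (intro set_eqI iffI)
        fix y assume "y \<in> f ` cyclic n m u"
        then show "y \<in> cyclic n m w" using f by (auto elim!: cyclicE intro: cyclicI)
      next
        fix y assume "y \<in> cyclic n m w"
        then obtain D where "D \<in> inv_ops n m" "y = D w" by (rule cyclicE)
        then show "y \<in> f ` cyclic n m u" using f cyclicI by (metis image_eqI)
      qed
    qed
  next
    fix x y
    assume "x \<in> cyclic n m u" "y \<in> cyclic n m u"
    then obtain D E where "D \<in> inv_ops n m" "x = D u" "E \<in> inv_ops n m" "y = E u"
      by (metis cyclicE)
    then show "f (x + y) = f x + f y"
      using f[OF inv_ops_add, of D E] f[of D] f[of E] by simp
  next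
    fix D x
    assume "D \<in> inv_ops n m" "x \<in> cyclic n m u"
    then obtain E where "E \<in> inv_ops n m" "x = E u" by (metis cyclicE)
    then show "f (D x) = D (f x)"
      using f[OF inv_ops_comp, of D E] f[of E] \<open>D \<in> inv_ops n m\<close> by simp
  qed
  then show ?thesis by (auto simp: submod_iso_mod_iso)
qed

text \<open>
  The Euler operator is invariant, so that an isomorphism preserves degrees; but there is nothing of
  degree \<open>d\<close> in the second module.
\<close>
lemma not_iso_of_degree_less:
  assumes u: "u \<in> polys n" "u \<noteq> 0" "hdeg d u" and w: "w \<in> polys n" "hdeg e w" "lowest n m w"
    and "m \<le> n" and "d < e" and f: "mod_iso n m f (cyclic n m u) (cyclic n m w)"
  shows False
proof -
  have sub: "cyclic n m u \<subseteq> polys n" "cyclic n m w \<subseteq> polys n"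
    using submodD(1)[OF submod_cyclic] u(1) w(1) by blast+
  have "hdeg d (f u)"
    by (rule mod_iso_hdeg[OF f assms(7) sub cyclic_self u(3)])
  then have "f u = hom_part d (f u)" using hom_part_hdeg by metis
  also have "\<dots> = 0"
  proof -
    obtain D where "D \<in> inv_ops n m" "f u = D w"
      using mod_iso_mem[OF f cyclic_self] by (rule cyclicE)
    then show ?thesis using lowest_cyclic_hom_part(1)[OF assms(7) w(2,3)] assms(8) by metis
  qed
  finally show False
    using mod_iso_eq_0_iff[OF f submodD(2)[OF submod_cyclic[OF u(1)]] cyclic_self] u(2) by simp
qed

lemma pd_inv_ops: "pd (Suc m) \<in> inv_ops (Suc m) m"
  and pd_weyl_part: "pd (Suc m) \<in> weyl_part (Suc m) (- 1)"
proof -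
  have "weyl_word (Suc m) (0 - 1) (\<lambda>p. pd (Suc m) (id p))"
    by (intro weyl_word.deriv weyl_word.one) auto
  then show w: "pd (Suc m) \<in> weyl_part (Suc m) (- 1)"
    by (intro weyl_part_word) simp
  show "pd (Suc m) \<in> inv_ops (Suc m) m"
  proof (rule inv_opsI)
    show "pd (Suc m) \<in> weyl (Suc m)" using w weyl_part_subset by blast
    fix \<sigma> assume \<sigma>: "\<sigma> permutes {1..m}"
    have "\<sigma> (Suc m) = Suc m" using permutes_not_in[OF \<sigma>] by auto
    then show "conj_op \<sigma> (pd (Suc m)) = pd (Suc m)"
      by (simp add: conj_op_def fun_eq_iff perm_vars_pd permutes_bij[OF \<sigma>])
  qed
qed

lemma pd_pow_inv_ops: "pd (Suc m) ^^ a \<in> inv_ops (Suc m) m"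
proof (induction a)
  case (Suc a)
  show ?case unfolding funpow.simps by (rule inv_ops_comp[OF pd_inv_ops Suc])
next
  case 0
  show ?case unfolding funpow.simps by (rule inv_ops_id)
qed

section \<open>Adding the last variable to a block\<close>

lemma partition_add_last:
  assumes P: "partition_on {1..m} P" and A: "A \<in> P \<or> A = {}"
  defines "Q \<equiv> insert (insert (Suc m) A) (P - {A})"
  shows "partition_on {1..Suc m} Q"
    and "specht Q = specht P * (\<Prod>k\<in>A. X k - X (Suc m))"
    and "specht_degree Q = specht_degree P + card A"
    and "mset_set Q = mset_set (P - {A}) + {#insert (Suc m) A#}"
proof -
  note F = partition_finite[OF P]
  have Am: "A \<subseteq> {1..m}" using A F(3) by auto
  then have finA: "finite A" by (rule finite_subset) simp
  have nA: "Suc m \<notin> A" using Am by auto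
  have PA: "B \<subseteq> {1..m}" if "B \<in> P - {A}" for B using that F(3) by blast
  have new: "insert (Suc m) A \<notin> P - {A}" using PA by fastforce
  have disj: "A \<inter> B = {}" if "B \<in> P - {A}" for B
    using that A F(5) by (auto simp: disjoint_def)
  have un: "A \<union> \<Union>(P - {A}) = {1..m}" using A F(4) by auto
  show "partition_on {1..Suc m} Q"
    unfolding partition_on_def
  proof (intro conjI)
    have "\<Union>Q = insert (Suc m) (A \<union> \<Union>(P - {A}))" by (auto simp: Q_def)
    then show "\<Union>Q = {1..Suc m}" using un by auto
    show "{} \<notin> Q" using F(6) by (auto simp: Q_def)
    show "disjoint Q"
      unfolding disjoint_def
    proof (intro ballI impI)
      have o: "insert (Suc m) A \<inter> B = {}" if "B \<in> P - {A}" for B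
        using disj[OF that] PA[OF that] by auto
      fix B C
      assume "B \<in> Q" "C \<in> Q" "B \<noteq> C"
      then consider "B = insert (Suc m) A" "C \<in> P - {A}" | "C = insert (Suc m) A" "B \<in> P - {A}"
        | "B \<in> P" "C \<in> P"
        unfolding Q_def by blast
      then show "B \<inter> C = {}"
        using o \<open>B \<noteq> C\<close> F(5) by cases (blast, blast, simp add: disjoint_def)
    qed
  qed
  have split: "(\<Prod>B\<in>P. vandermonde B) = vandermonde A * (\<Prod>B\<in>P - {A}. vandermonde B)"
    using A F(1,6) by (auto simp: prod.remove vandermonde_def)
  have vi: "vandermonde (insert (Suc m) A) = vandermonde A * (\<Prod>k\<in>A. X k - X (Suc m))"
    by (rule vandermonde_insert[OF finA]) (use Am in auto)
  have "specht Q = vandermonde (insert (Suc m) A) * (\<Prod>B\<in>P - {A}. vandermonde B)"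
    unfolding specht_vandermonde Q_def using F(1) new by (intro prod.insert) auto
  then show "specht Q = specht P * (\<Prod>k\<in>A. X k - X (Suc m))"
    by (simp add: specht_vandermonde split vi mult.assoc mult.left_commute mult.commute)
  have "specht_degree Q = (card (insert (Suc m) A) choose 2) + (\<Sum>B\<in>P - {A}. card B choose 2)"
    unfolding specht_degree_def Q_def using F(1) new by (intro sum.insert) auto
  moreover have "specht_degree P = (card A choose 2) + (\<Sum>B\<in>P - {A}. card B choose 2)"
    unfolding specht_degree_def using A F(1,6) by (auto simp: sum.remove numeral_2_eq_2)
  ultimately show "specht_degree Q = specht_degree P + card A"
    using finA nA by (simp add: choose_two_Suc)
  show "mset_set Q = mset_set (P - {A}) + {#insert (Suc m) A#}"
    unfolding Q_def using F(1) new by (simp add: mset_set.insert)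
qed

text \<open>
  The orthogonal projection to \<open>K\<close> commutes with \<open>\<D>\<^sub>m\<close>, in particular with \<open>\<partial>\<^sub>n\<close>. Hence \<open>u\<close>, the
  projection of \<open>s\<^sub>Q\<close>, is killed by all that kills \<open>s\<^sub>Q\<close>, and the leading coefficient of \<open>s\<^sub>Q\<close> is not
  changed, as it belongs to \<open>K\<close>. It follows that \<open>u \<noteq> 0\<close>, and then the simplicity of \<open>\<D>\<^sub>n s\<^sub>Q\<close> shows
  that \<open>u\<close> and \<open>s\<^sub>Q\<close> have the same annihilator.
\<close>
lemma projected_specht:
  fixes m :: nat
  assumes P: "partition_on {1..m} P" and A: "A \<in> P \<or> A = {}"
  defines "n \<equiv> Suc m"
  defines "Q \<equiv> insert (insert n A) (P - {A})"
  defines "K \<equiv> cyclic n m (specht P)"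
  obtains u where "u \<in> K" and "hdeg (int (specht_degree P + card A)) u" and "lowest n n u"
    and "(pd n ^^ card A) u = cscale ((- 1) ^ card A * fact (card A)) (specht P)"
    and "\<And>D. D \<in> inv_ops n n \<Longrightarrow> D u = 0 \<longleftrightarrow> D (specht Q) = 0"
proof -
  note pal = partition_add_last[OF P A, folded n_def, folded Q_def]
  let ?a = "card A"
  let ?s = "specht P"
  have mn: "m \<le> n" by (simp add: n_def)
  have Am: "A \<subseteq> {1..m}" using A partition_finite(3)[OF P, of A] by auto
  then have finA: "finite A" by (rule finite_subset) simp
  have nA: "n \<notin> A" using Am by (auto simp: n_def)
  have sn: "?s \<in> polys n" using specht_polys[OF P] polys_mono[OF mn] by blast
  have K: "submod n m K" unfolding K_def by (rule submod_cyclic[OF sn])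
  have sK: "?s \<in> K" unfolding K_def by (rule cyclic_self)
  have s1: "lower_order n 1 ?s" by (rule polys_lower_order[OF specht_polys[OF P]]) (simp add: n_def)
  have hQ: "hdeg (int (specht_degree P + ?a)) (specht Q)"
    using specht_hdeg[OF pal(1)] pal(3) by simp
  obtain u where u: "u \<in> K" "hdeg (int (specht_degree P + ?a)) u" "\<And>y. y \<in> K \<Longrightarrow> ip (specht Q - u) y = 0"
    using submod_projection[OF K mn hQ] by blast
  have proj: "D u = D (specht Q)" if D: "D \<in> inv_ops n m" "D (specht Q) \<in> K" for D
  proof -
    let ?y = "D (specht Q - u)"
    have y: "?y = D (specht Q) - D u" by (rule lin_diff[OF inv_ops_lin[OF D(1)]])
    then have yK: "?y \<in> K" using submod_diff[OF K D(2) submodD(4)[OF K D(1) u(1)]] by simp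
    obtain D' where D': "D' \<in> inv_ops n m" "\<And>p q. ip (D p) q = ip p (D' q)"
      using inv_ops_adjoint[OF mn D(1)] by blast
    have "ip ?y ?y = 0" using D'(2) u(3)[OF submodD(4)[OF K D'(1) yK]] by metis
    then show ?thesis using y by (simp add: ip_self)
  qed
  obtain p' where p': "specht Q = cscale ((- 1) ^ ?a) (X n ^ ?a * ?s) + p'" "lower_order n ?a p'"
    using mult_prod_X_diff_expansion[OF finA nA s1] pal(2) by (metis n_def)
  have linp: "lin (pd n ^^ b)" for b
    using inv_ops_lin[OF pd_pow_inv_ops] by (simp add: n_def)
  have pa: "(pd n ^^ ?a) (specht Q) = cscale ((- 1) ^ ?a * fact ?a) ?s"
    using p'(2) by (simp add: p'(1) lin_add[OF linp] lin_cscale[OF linp] pd_pow_X_pow[OF s1]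
        lower_order_iff_pd)
  have pu: "(pd n ^^ b) u = (pd n ^^ b) (specht Q)" if "(pd n ^^ b) (specht Q) \<in> K" for b
    using proj[of "pd n ^^ b", OF _ that] pd_pow_inv_ops by (simp add: n_def)
  have ua: "(pd n ^^ ?a) u = cscale ((- 1) ^ ?a * fact ?a) ?s"
    using pu[of ?a] submod_cscale[OF K sK] by (simp add: pa)
  have imp: "D u = 0" if "D \<in> inv_ops n n" "D (specht Q) = 0" for D
    using proj[of D] that submodD(2)[OF K] inv_ops_mono[OF mn] by auto
  have low: "lowest n n u"
    unfolding lowest_def
    using imp lowestD[OF specht_lowest[OF pal(1), of n, folded n_def]] by blast
  have "u \<noteq> 0"
  proof
    assume "u = 0"
    then have "cscale ((- 1) ^ ?a * fact ?a) ?s = 0" using ua lin_zero[OF linp] by metis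
    then show False using specht_nonzero[OF P] by simp
  qed
  have "D (specht Q) = 0" if D: "D \<in> inv_ops n n" "D u = 0" for D
  proof (rule ccontr)
    assume ne: "D (specht Q) \<noteq> 0"
    have Qn: "partition_on {1..n} Q" using pal(1) by (simp add: n_def)
    have sQ: "submod n n (cyclic n n (specht Q))" by (rule submod_cyclic[OF specht_polys[OF Qn]])
    have DQ: "D (specht Q) \<in> cyclic n n (specht Q)" by (rule cyclicI[OF D(1)])
    have "submod n n (cyclic n n (D (specht Q)))"
      using submodD(1)[OF sQ] DQ by (intro submod_cyclic) blast
    moreover have "cyclic n n (D (specht Q)) \<subseteq> cyclic n n (specht Q)"
      by (rule cyclic_subset[OF sQ DQ])
    moreover have "cyclic n n (D (specht Q)) \<noteq> {0}" using cyclic_self ne by blast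
    ultimately have "cyclic n n (D (specht Q)) = cyclic n n (specht Q)"
      using specht_simple[OF Qn] by (auto simp: simple_submod_def)
    then have "specht Q \<in> cyclic n n (D (specht Q))" using cyclic_self by metis
    then obtain E where E: "E \<in> inv_ops n n" "specht Q = E (D (specht Q))" by (rule cyclicE)
    have "(E \<circ> D) + op_scale (- 1) id \<in> inv_ops n n"
      by (intro inv_ops_add inv_ops_scale inv_ops_comp inv_ops_id E(1) D(1))
    moreover have "((E \<circ> D) + op_scale (- 1) id) (specht Q) = 0"
      using E(2) by (simp add: op_scale_def cscale_minus1)
    ultimately have "((E \<circ> D) + op_scale (- 1) id) u = 0" by (rule imp)
    then have "u = E (D u)" by (simp add: op_scale_def cscale_minus1)
    then show False using D(2) lin_zero[OF inv_ops_lin[OF E(1)]] \<open>u \<noteq> 0\<close> by simp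
  qed
  then show ?thesis using that u(1,2) low ua imp by blast
qed

section \<open>The possible orders of lowest weight vectors\<close>

text \<open>
  The simplest elements of \<open>\<D>\<^sub>n\<^sup>-\<close>: symmetric sums that lower one exponent by 1.
\<close>
lemma lowering_op:
  fixes n a :: nat
  defines "L \<equiv> (\<Sum>i\<in>{1..n}. mo (single i a) (single i (Suc a)))"
  shows "L \<in> inv_ops n n" and "L \<in> weyl_part n (- 1)"
    and "lookup (L w) \<gamma> = (\<Sum>i\<in>{1..n}. of_nat (ffact (Suc (lookup \<gamma> i)) (Suc a)) * lookup w (\<gamma> + unit_exp i))"
proof -
  show wp: "L \<in> weyl_part n (- 1)"
    unfolding L_def
  proof (rule weyl_part_sum, rule weyl_part_word)
    fix i assume i: "i \<in> {1..n}"
    have "weyl_word n (int (mon_degree (single i a)) - int (mon_degree (single i (Suc a))))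
        (mo (single i a) (single i (Suc a)))"
      by (rule mo_weyl_word) (use i in auto)
    then show "weyl_word n (- 1) (mo (single i a) (single i (Suc a)))" by simp
  qed
  show "L \<in> inv_ops n n"
  proof (rule inv_opsI)
    show "L \<in> weyl n" using wp weyl_part_subset by blast
    fix \<sigma> assume \<sigma>: "\<sigma> permutes {1..n}"
    have b: "bij \<sigma>" by (rule permutes_bij[OF \<sigma>])
    have act: "act \<sigma> (single i c) = single (\<sigma> i) c" for i c
      using act_single[OF b, of 0 i c] bij_is_inj[OF bij_imp_bij_inv[OF b]] by simp
    have "conj_op \<sigma> L = (\<Sum>i\<in>{1..n}. mo (single (\<sigma> i) a) (single (\<sigma> i) (Suc a)))"
      unfolding L_def conj_op_sum[OF b] conj_mo[OF b] act ..
    also have "\<dots> = L"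
      unfolding L_def using sum.permute[OF \<sigma>, of "\<lambda>i. mo (single i a) (single i (Suc a))"]
      by (simp add: comp_def)
    finally show "conj_op \<sigma> L = L" .
  qed
  show "lookup (L w) \<gamma> = (\<Sum>i\<in>{1..n}. of_nat (ffact (Suc (lookup \<gamma> i)) (Suc a)) * lookup w (\<gamma> + unit_exp i))"
    unfolding L_def sum_op_apply lookup_sum
  proof (rule sum.cong[OF refl])
    fix i
    show "lookup (mo (single i a) (single i (Suc a)) w) \<gamma> =
        of_nat (ffact (Suc (lookup \<gamma> i)) (Suc a)) * lookup w (\<gamma> + unit_exp i)"
    proof (cases "a \<le> lookup \<gamma> i")
      case True
      then have "\<gamma> - single i a + single i (Suc a) = \<gamma> + unit_exp i"
        by (auto simp: poly_mapping_eq_iff fun_eq_iff lookup_add lookup_minus lookup_single when_def)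
      then show ?thesis
        using True lookup_mo_split[of 0 i 0 a "Suc a" w \<gamma>] by (simp add: mo_0_0 del: ffact.simps)
    next
      case False
      then have "ffact (Suc (lookup \<gamma> i)) (Suc a) = 0" by (simp only: ffact_eq_0_iff)
      then show ?thesis
        using False lookup_mo_split[of 0 i 0 a "Suc a" w \<gamma>] by (simp del: ffact.simps)
    qed
  qed
qed

text \<open>
  The lowering operators weight the index \<open>i\<close> by a falling factorial that depends on the exponent
  \<open>t\<close> of \<open>x\<^sub>i\<close>. For varying \<open>a\<close> these weights form a triangular matrix with nonzero diagonal, so that the
  contributions of the different \<open>t\<close> vanish separately. Thus \<open>w\<close> is killed by the operator that lowers
  exponents \<open>t + 1\<close> to \<open>t\<close> and annihilates everything else, a root vector of \<open>\<gg>\<ll>\<^sub>\<infinity>\<close>.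
\<close>
lemma lowest_level_sum:
  assumes w: "lowest n n w"
  shows "(\<Sum>i\<in>{i\<in>{1..n}. lookup \<gamma> i = t}. lookup w (\<gamma> + unit_exp i)) = 0"
proof (rule ccontr)
  define g where "g t = (\<Sum>i\<in>{i\<in>{1..n}. lookup \<gamma> i = t}. lookup w (\<gamma> + unit_exp i))" for t
  assume "(\<Sum>i\<in>{i\<in>{1..n}. lookup \<gamma> i = t}. lookup w (\<gamma> + unit_exp i)) \<noteq> 0"
  then have t: "g t \<noteq> 0" by (simp add: g_def)
  have sub: "{t. g t \<noteq> 0} \<subseteq> lookup \<gamma> ` {1..n}"
  proof
    fix s assume "s \<in> {t. g t \<noteq> 0}"
    then have "g s \<noteq> 0" by simp
    then have "{i\<in>{1..n}. lookup \<gamma> i = s} \<noteq> {}" unfolding g_def by (metis sum.empty)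
    then show "s \<in> lookup \<gamma> ` {1..n}" by auto
  qed
  then have fin: "finite {t. g t \<noteq> 0}" by (rule finite_subset) simp
  define a where "a = Max {t. g t \<noteq> 0}"
  have ga: "g a \<noteq> 0" using Max_in[OF fin] t by (auto simp: a_def)
  have gz: "g s = 0" if "s > a" for s
    using Max_ge[OF fin, of s] that by (auto simp: a_def)
  let ?T = "lookup \<gamma> ` {1..n}"
  have "(\<Sum>i\<in>{1..n}. mo (single i a) (single i (Suc a))) w = 0"
    using lowestD[OF w lowering_op(1,2)] by simp
  then have "0 = (\<Sum>i\<in>{1..n}. of_nat (ffact (Suc (lookup \<gamma> i)) (Suc a)) * lookup w (\<gamma> + unit_exp i))"
    using lowering_op(3)[where n = n and a = a and w = w and \<gamma> = \<gamma>] by simp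
  also have "\<dots> = (\<Sum>s\<in>?T. \<Sum>i\<in>{i\<in>{1..n}. lookup \<gamma> i = s}.
      of_nat (ffact (Suc (lookup \<gamma> i)) (Suc a)) * lookup w (\<gamma> + unit_exp i))"
    by (rule sum.image_gen) simp
  also have "\<dots> = (\<Sum>s\<in>?T. of_nat (ffact (Suc s) (Suc a)) * g s)"
    unfolding g_def sum_distrib_left by (intro sum.cong) auto
  also have "\<dots> = (\<Sum>s\<in>?T. if s = a then of_nat (ffact (Suc a) (Suc a)) * g a else 0)"
  proof (rule sum.cong[OF refl])
    fix s
    consider "s < a" | "s = a" | "s > a" by linarith
    then show "of_nat (ffact (Suc s) (Suc a)) * g s = (if s = a then of_nat (ffact (Suc a) (Suc a)) * g a else 0)"
    proof cases
      case 1
      then have "ffact (Suc s) (Suc a) = 0" by (simp only: ffact_eq_0_iff)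
      then show ?thesis using 1 by (simp del: ffact.simps)
    qed (simp_all add: gz del: ffact.simps)
  qed
  also have "\<dots> = of_nat (ffact (Suc a) (Suc a)) * g a"
    using sub ga by (subst sum.delta) auto
  finally have "ffact (Suc a) (Suc a) = 0" using ga by (simp del: ffact.simps)
  then show False by (simp only: ffact_eq_0_iff)
qed

text \<open>
  Suppose that \<open>j > 0\<close> is not a block size, and lower an exponent from \<open>j\<close> to \<open>j - 1\<close>. Starting from the
  leading monomial \<open>x\<^sub>n\<^sup>j \<mu>\<close>, one reaches \<open>x\<^sub>n\<^bsup>j-1\<^esup> \<mu>\<close>. The other monomials that lead there have the
  exponent \<open>j\<close> in some block in place of \<open>j - 1\<close>. But a block with the exponent \<open>j - 1\<close> in \<open>\<mu>\<close> has more than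
  \<open>j\<close> elements, and so contains the exponent \<open>j\<close> already; by antisymmetry the coefficient is zero.
  So nothing cancels the leading term.
\<close>
lemma order_is_block_size:
  fixes m :: nat
  assumes P: "partition_on {1..m} P"
  defines "n \<equiv> Suc m"
  assumes w: "lowest n n w" "antisym P w" and lead: "(pd n ^^ j) w = cscale c (specht P)" "c \<noteq> 0"
    and "j \<noteq> 0"
  shows "\<exists>A\<in>P. card A = j"
proof (rule ccontr)
  assume no: "\<not> (\<exists>A\<in>P. card A = j)"
  let ?s = "specht P"
  obtain \<mu> where \<mu>: "lookup ?s \<mu> \<noteq> 0"
    using specht_nonzero[OF P] by (metis lookup_zero poly_mapping_eqI)
  have \<mu>n: "lookup \<mu> n = 0"
    using polysD[OF specht_polys[OF P] \<mu>, of n] by (auto simp: n_def)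
  have im: "lookup \<mu> ` A = {..<card A}" if "A \<in> P" for A
    using antisym_degree(2)[OF P specht_antisym[OF P] \<mu> _ that] hdegD[OF specht_hdeg[OF P] \<mu>] by simp
  obtain t where t: "j = Suc t" using \<open>j \<noteq> 0\<close> by (cases j) auto
  define \<gamma> where "\<gamma> = \<mu> + single n t"
  have \<gamma>n: "lookup \<gamma> n = t" and \<gamma>i: "i \<noteq> n \<Longrightarrow> lookup \<gamma> i = lookup \<mu> i" for i
    using \<mu>n by (simp_all add: \<gamma>_def lookup_add lookup_single)
  have top: "lookup w (\<gamma> + unit_exp n) \<noteq> 0"
  proof -
    have "\<gamma> + unit_exp n = \<mu> + single n j"
      by (simp add: \<gamma>_def t add.assoc single_add[symmetric] One_nat_def)
    moreover have "lookup ((pd n ^^ j) w) \<mu> \<noteq> 0" using \<mu> lead by simp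
    then have "lookup w (\<mu> + single n j) \<noteq> 0" by (auto simp: lookup_pd_pow)
    ultimately show ?thesis by simp
  qed
  have others: "lookup w (\<gamma> + unit_exp i) = 0" if i: "i \<in> {1..n}" "lookup \<gamma> i = t" "i \<noteq> n" for i
  proof -
    have "i \<in> {1..m}" using i by (auto simp: n_def)
    then obtain A where A: "A \<in> P" "i \<in> A" using partition_finite(4)[OF P] by blast
    have "n \<notin> A" using partition_finite(3)[OF P A(1)] by (auto simp: n_def)
    have "lookup \<mu> i = t" using i \<gamma>i by simp
    then have "t < card A" using im[OF A(1)] A(2) by blast
    then have "j < card A" using no A(1) t by (metis Suc_lessI)
    then have "j \<in> lookup \<mu> ` A" using im[OF A(1)] by blast
    then obtain k where k: "k \<in> A" "lookup \<mu> k = j" by auto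
    have "k \<noteq> n" "k \<noteq> i" using k \<open>n \<notin> A\<close> \<open>lookup \<mu> i = t\<close> t by auto
    then have "lookup (\<gamma> + unit_exp i) k = lookup (\<gamma> + unit_exp i) i"
      using k i(2) t \<gamma>i[of k] by (simp add: lookup_add lookup_single)
    then show ?thesis
      using antisym_vanishes[OF w(2) A(1) k(1) A(2)] \<open>k \<noteq> i\<close> by blast
  qed
  have "(\<Sum>i\<in>{i\<in>{1..n}. lookup \<gamma> i = t}. lookup w (\<gamma> + unit_exp i)) =
      (\<Sum>i\<in>{n}. lookup w (\<gamma> + unit_exp i))"
    by (rule sum.mono_neutral_right) (use others \<gamma>n in \<open>auto simp: n_def\<close>)
  then show False using lowest_level_sum[OF w(1), of \<gamma> t] top by simp
qed

lemma exact_order: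
  assumes "w \<noteq> 0"
  obtains j where "(pd n ^^ j) w \<noteq> 0" and "(pd n ^^ Suc j) w = 0"
proof -
  have "lower_order n (Suc (Max ((\<lambda>\<gamma>. lookup \<gamma> n) ` keys w))) w"
    by (rule lower_orderI) (auto simp: less_Suc_eq_le in_keys_iff intro!: Max_ge)
  then have ex: "\<exists>a. lower_order n a w" by blast
  define a where "a = (LEAST a. lower_order n a w)"
  have a: "lower_order n a w" unfolding a_def by (rule LeastI_ex[OF ex])
  have "a \<noteq> 0"
  proof
    assume "a = 0"
    then have "(pd n ^^ 0) w = 0" using a by (simp only: lower_order_iff_pd)
    then show False using assms by simp
  qed
  then obtain j where j: "a = Suc j" by (cases a) auto
  have "\<not> lower_order n j w" using not_less_Least[of j "\<lambda>a. lower_order n a w"] j by (simp add: a_def)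
  then show ?thesis using that a j lower_order_iff_pd by metis
qed

section \<open>Adding boxes\<close>

lemma add_box_inj: "add_box lam r = add_box lam r' \<Longrightarrow> r = r'"
  by (metis add_box_def fun_upd_apply n_not_Suc_n Suc_eq_plus1)

lemma addable_rows_distinct:
  assumes "is_partition n (add_box lam r)" and "is_partition n' (add_box lam s)"
    and "1 \<le> r" and "1 \<le> s" and "lam r = lam s"
  shows "r = s"
proof -
  have "False" if "is_partition k (add_box lam s)" "1 \<le> r" "r < s" "lam r = lam s" for k r s
  proof -
    have "add_box lam s s \<le> add_box lam s r" using that unfolding is_partition_def by simp
    then show False using that by (simp add: add_box_def)
  qed
  then show ?thesis using assms by (metis linorder_neqE_nat)
qed

lemma finite_box_extensions: "finite (box_extensions n lam)"
proof -
  let ?R = "{r. 1 \<le> r \<and> is_partition n (add_box lam r)}"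
  have "lam r \<le> n" if r: "r \<in> ?R" for r
  proof -
    have "add_box lam r r \<le> (\<Sum>i | add_box lam r i \<noteq> 0. add_box lam r i)"
      using r by (intro member_le_sum) (auto simp: is_partition_def add_box_def)
    then show ?thesis using r by (simp add: is_partition_def add_box_def)
  qed
  then have "lam ` ?R \<subseteq> {..n}" by auto
  then have "finite (lam ` ?R)" by (rule finite_subset) simp
  moreover have "inj_on lam ?R"
    by (rule inj_onI) (auto dest: addable_rows_distinct)
  ultimately have "finite ?R" by (rule finite_imageD)
  moreover have "box_extensions n lam \<subseteq> add_box lam ` ?R" by (auto simp: box_extensions_def)
  ultimately show ?thesis by (metis finite_imageI finite_subset)
qed

lemma is_partition_add_box:
  assumes lam: "is_partition m lam" and "1 \<le> r" and first: "\<And>i. 1 \<le> i \<Longrightarrow> i < r \<Longrightarrow> lam i \<noteq> lam r"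
  shows "is_partition (Suc m) (add_box lam r)"
proof -
  have mono: "lam j \<le> lam i" if "1 \<le> i" "i \<le> j" for i j
    using lam that by (auto simp: is_partition_def)
  have set: "{i. add_box lam r i \<noteq> 0} = insert r {i. lam i \<noteq> 0}"
    by (auto simp: add_box_def)
  have fin: "finite {i. lam i \<noteq> 0}" using lam by (simp add: is_partition_def)
  have "(\<Sum>i\<in>insert r {i. lam i \<noteq> 0}. add_box lam r i) =
      (\<Sum>i\<in>insert r {i. lam i \<noteq> 0}. lam i + (if i = r then 1 else 0))"
    by (rule sum.cong) (auto simp: add_box_def)
  also have "\<dots> = (\<Sum>i\<in>insert r {i. lam i \<noteq> 0}. lam i) + 1"
    using fin by (simp add: sum.distrib sum.delta del: sum.insert)
  also have "(\<Sum>i\<in>insert r {i. lam i \<noteq> 0}. lam i) = (\<Sum>i | lam i \<noteq> 0. lam i)"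
    using fin by (intro sum.mono_neutral_right) auto
  finally have sum: "(\<Sum>i | add_box lam r i \<noteq> 0. add_box lam r i) = Suc m"
    unfolding set using lam by (simp add: is_partition_def)
  have "add_box lam r j \<le> add_box lam r i" if "1 \<le> i" "i \<le> j" for i j
  proof (cases "j = r \<and> i \<noteq> r")
    case True
    then have "lam r < lam i" using first[of i] mono[of i r] that by fastforce
    then show ?thesis using True by (simp add: add_box_def)
  next
    case False
    then show ?thesis using mono[OF that] that by (auto simp: add_box_def)
  qed
  moreover have "finite {i. add_box lam r i \<noteq> 0}" unfolding set using fin by simp
  moreover have "add_box lam r 0 = 0" using lam assms(2) by (simp add: is_partition_def add_box_def)
  ultimately show ?thesis
    unfolding is_partition_def using sum by blast
qed

text \<open>
  Among the rows of equal length, the first one can be extended.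
\<close>
lemma addable_row_exists:
  assumes lam: "is_partition m lam" and "1 \<le> i"
  obtains r where "1 \<le> r" and "lam r = lam i" and "is_partition (Suc m) (add_box lam r)"
proof -
  define r where "r = (LEAST r. 1 \<le> r \<and> lam r = lam i)"
  have r: "1 \<le> r \<and> lam r = lam i"
    unfolding r_def by (rule LeastI[of _ i]) (use assms(2) in simp)
  have "lam k \<noteq> lam r" if "1 \<le> k" "k < r" for k
    using not_less_Least[of k "\<lambda>r. 1 \<le> r \<and> lam r = lam i"] that r by (auto simp: r_def)
  then show ?thesis using that r is_partition_add_box[OF lam] by blast
qed

lemma zero_row_exists:
  assumes "is_partition m lam"
  obtains i where "1 \<le> i" and "lam i = 0"
proof -
  have "finite (insert 0 {i. lam i \<noteq> 0})" using assms by (simp add: is_partition_def)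
  then obtain i where "i \<notin> insert 0 {i. lam i \<noteq> 0}" using ex_new_if_finite infinite_UNIV_nat by blast
  then show ?thesis using that[of i] by (auto simp: One_nat_def)
qed

lemma has_block_sizes_set:
  assumes "has_block_sizes P lam" and "finite P" and "finite {i. lam i \<noteq> 0}"
  shows "card ` P = lam ` {i. lam i \<noteq> 0}"
  using arg_cong[OF assms(1)[unfolded has_block_sizes_def], of set_mset] assms(2,3) by simp

lemma has_block_sizes_degree:
  assumes "has_block_sizes P lam"
  shows "specht_degree P = (\<Sum>i | lam i \<noteq> 0. lam i choose 2)"
proof -
  have "specht_degree P = (\<Sum>x\<in>#image_mset card (mset_set P). x choose 2)"
    by (simp add: specht_degree_def sum_unfold_sum_mset multiset.map_comp comp_def)
  also have "\<dots> = (\<Sum>i | lam i \<noteq> 0. lam i choose 2)"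
    using assms by (simp add: has_block_sizes_def sum_unfold_sum_mset multiset.map_comp comp_def)
  finally show ?thesis .
qed

lemma has_block_sizes_add_box:
  assumes P: "partition_on {1..m} P" and hb: "has_block_sizes P lam" and fin: "finite {i. lam i \<noteq> 0}"
    and A: "A \<in> P \<or> A = {}" and cA: "card A = lam r"
  shows "has_block_sizes (insert (insert (Suc m) A) (P - {A})) (add_box lam r)"
proof -
  let ?S = "{i. lam i \<noteq> 0}"
  note F = partition_finite[OF P]
  have Am: "A \<subseteq> {1..m}" using A F(3) by auto
  then have finA: "finite A" by (rule finite_subset) simp
  have nA: "Suc m \<notin> A" using Am by auto
  have old: "image_mset card (mset_set (P - {A})) = image_mset lam (mset_set (?S - {r}))"
  proof (cases "lam r = 0")
    case True
    then have "A = {}" using cA finA by simp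
    then show ?thesis using True hb F(6) by (simp add: has_block_sizes_def)
  next
    case False
    then have "A \<in> P" using A cA by auto
    then have "mset_set P = add_mset A (mset_set (P - {A}))"
      using F(1) by (simp add: mset_set.remove)
    moreover have "mset_set ?S = add_mset r (mset_set (?S - {r}))"
      using False fin by (simp add: mset_set.remove)
    ultimately show ?thesis using hb cA by (simp add: has_block_sizes_def)
  qed
  have set: "{i. add_box lam r i \<noteq> 0} = insert r (?S - {r})"
    by (auto simp: add_box_def)
  have "image_mset (add_box lam r) (mset_set (?S - {r})) = image_mset lam (mset_set (?S - {r}))"
    using fin by (intro image_mset_cong) (auto simp: add_box_def)
  moreover have "mset_set (insert r (?S - {r})) = add_mset r (mset_set (?S - {r}))"
    by (rule mset_set.insert) (use fin in auto)
  moreover have "card (insert (Suc m) A) = add_box lam r r"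
    using finA nA cA by (simp add: add_box_def)
  moreover have "image_mset card (mset_set (P - {A}) + {#insert (Suc m) A#}) =
      add_mset (card (insert (Suc m) A)) (image_mset card (mset_set (P - {A})))"
    by simp
  ultimately show ?thesis
    unfolding has_block_sizes_def set partition_add_last(4)[OF P A]
    by (simp only: old image_mset_add_mset)
qed

section \<open>Branching\<close>

text \<open>
  Orthogonality makes the components unique. For their existence, project the homogeneous parts of an
  element of \<open>N\<close> to the sum of the \<open>F i\<close>; what remains is orthogonal to all of them, hence zero.
\<close>
lemma orthogonal_direct_sum:
  assumes N: "submod n m N" and "m \<le> n" and I: "finite I"
    and F: "\<And>i. i \<in> I \<Longrightarrow> submod n m (F i)" "\<And>i. i \<in> I \<Longrightarrow> F i \<subseteq> N"
    and orth: "\<And>i j p q. i \<in> I \<Longrightarrow> j \<in> I \<Longrightarrow> i \<noteq> j \<Longrightarrow> p \<in> F i \<Longrightarrow> q \<in> F j \<Longrightarrow> ip p q = 0"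
    and full: "\<And>y. y \<in> N \<Longrightarrow> (\<And>i q. i \<in> I \<Longrightarrow> q \<in> F i \<Longrightarrow> ip y q = 0) \<Longrightarrow> y = 0"
  shows "direct_sum_of I F N"
proof -
  define S where "S = {y. \<exists>f\<in>Pi\<^sub>E I F. y = (\<Sum>i\<in>I. f i)}"
  have SN: "S \<subseteq> N"
  proof
    fix y assume "y \<in> S"
    then obtain f where f: "f \<in> Pi\<^sub>E I F" "y = (\<Sum>i\<in>I. f i)" by (auto simp: S_def)
    show "y \<in> N"
      unfolding f(2) by (rule submod_sum[OF N]) (use PiE_mem[OF f(1)] F(2) in blast)
  qed
  have inS: "(\<Sum>i\<in>I. f i) \<in> S" if "\<And>i. i \<in> I \<Longrightarrow> f i \<in> F i" for f
    unfolding S_def mem_Collect_eq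
    by (rule bexI[of _ "restrict f I"]) (use that in auto)
  have S: "submod n m S"
    unfolding submod_def
  proof (intro conjI ballI)
    show "S \<subseteq> polys n" using SN submodD(1)[OF N] by blast
    show "0 \<in> S" using inS[of "\<lambda>_. 0"] submodD(2)[OF F(1)] by simp
  next
    fix p q assume "p \<in> S" "q \<in> S"
    then obtain f g where fg: "f \<in> Pi\<^sub>E I F" "p = (\<Sum>i\<in>I. f i)" "g \<in> Pi\<^sub>E I F" "q = (\<Sum>i\<in>I. g i)"
      by (auto simp: S_def)
    have "(\<Sum>i\<in>I. f i + g i) \<in> S"
      by (rule inS) (intro submodD(3)[OF F(1)] PiE_mem[OF fg(1)] PiE_mem[OF fg(3)])
    then show "p + q \<in> S" by (simp add: fg sum.distrib)
  next
    fix D p assume D: "D \<in> inv_ops n m" and "p \<in> S"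
    then obtain f where f: "f \<in> Pi\<^sub>E I F" "p = (\<Sum>i\<in>I. f i)" by (auto simp: S_def)
    have "(\<Sum>i\<in>I. D (f i)) \<in> S"
      by (rule inS) (use f(1) submodD(4)[OF F(1) D] in auto)
    then show "D p \<in> S" by (simp add: f(2) lin_sum[OF inv_ops_lin[OF D]])
  qed
  have FS: "q \<in> S" if i: "i \<in> I" "q \<in> F i" for i q
  proof -
    have "(\<Sum>j\<in>I. if j = i then q else 0) \<in> S"
      by (rule inS) (use i submodD(2)[OF F(1)] in auto)
    then show ?thesis using i I by simp
  qed
  have hS: "hom_part e y \<in> S" if y: "y \<in> N" for e y
  proof -
    obtain u where u: "u \<in> S" "\<And>z. z \<in> S \<Longrightarrow> ip (hom_part e y - u) z = 0"
      using submod_projection[OF S assms(2) hdeg_hom_part[of e y]] by blast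
    have "hom_part e y - u \<in> N"
      using submod_diff[OF N submod_hom_part[OF N assms(2) y]] SN u(1) by blast
    then have "hom_part e y - u = 0" by (rule full) (use u(2) FS in blast)
    then show ?thesis using u(1) by simp
  qed
  have NS: "y \<in> S" if "y \<in> N" for y
    using submod_sum[OF S, of "(\<lambda>\<gamma>. int (mon_degree \<gamma>)) ` keys y" "\<lambda>e. hom_part e y"] hS[OF that]
    by (simp only: sum_comps[symmetric])
  have unique: "f = g"
    if fg: "f \<in> Pi\<^sub>E I F" "g \<in> Pi\<^sub>E I F" "(\<Sum>i\<in>I. f i) = (\<Sum>i\<in>I. g i)" for f g
  proof (rule PiE_ext[OF fg(1,2)])
    fix i assume i: "i \<in> I"
    define h where "h j = f j - g j" for j
    have h: "h j \<in> F j" if "j \<in> I" for j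
      unfolding h_def using submod_diff[OF F(1)[OF that]] fg(1,2) that by blast
    have "0 = ip (\<Sum>j\<in>I. h j) (h i)"
      using fg(3) by (simp add: h_def sum_subtractf)
    also have "\<dots> = (\<Sum>j\<in>I. if j = i then ip (h i) (h i) else 0)"
      unfolding ip_sum_left by (rule sum.cong) (use orth h i in auto)
    also have "\<dots> = ip (h i) (h i)" using I i by simp
    finally show "f i = g i" by (simp add: ip_self h_def)
  qed
  show ?thesis
    unfolding direct_sum_of_def
  proof (intro conjI ballI)
    show "finite I" by (rule I)
    show "F i \<subseteq> N" if "i \<in> I" for i using F(2)[OF that] .
    show "(\<Sum>i\<in>I. f i) \<in> N" if "f \<in> Pi\<^sub>E I F" for f
      using that SN by (auto simp: S_def)
    show "\<exists>!f. f \<in> Pi\<^sub>E I F \<and> y = (\<Sum>i\<in>I. f i)" if "y \<in> N" for y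
      using NS[OF that] unique unfolding S_def by blast
  qed
qed

text \<open>
  Write the inner product as \<open>\<langle>D u, E w\<rangle> = \<langle>u, D\<^sup>* E w\<rangle>\<close>, and use that \<open>\<D>\<^sub>m w\<close> begins in degree \<open>e > d\<close>.
\<close>
lemma lowest_orthogonal:
  assumes "m \<le> n" and u: "hdeg d u" "lowest n m u" and w: "hdeg e w" "lowest n m w" and "d < e"
    and p: "p \<in> cyclic n m u" and q: "q \<in> cyclic n m w"
  shows "ip p q = 0"
proof -
  obtain D where D: "D \<in> inv_ops n m" "p = D u" using p by (rule cyclicE)
  obtain E where E: "E \<in> inv_ops n m" "q = E w" using q by (rule cyclicE)
  obtain D' where D': "D' \<in> inv_ops n m" "\<And>p q. ip (D p) q = ip p (D' q)"
    using inv_ops_adjoint[OF assms(1) D(1)] by blast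
  let ?z = "(D' \<circ> E) w"
  have "hom_part d ?z = 0"
    by (rule lowest_cyclic_hom_part(1)[OF assms(1) w inv_ops_comp[OF D'(1) E(1)] \<open>d < e\<close>])
  then show ?thesis
    using D(2) E(2) D'(2) ip_hom_part[OF u(1), of ?z] by simp
qed

lemma orthogonal_complement_submod:
  assumes N: "submod n m N" and "m \<le> n" and F: "\<And>i. i \<in> I \<Longrightarrow> submod n m (F i)"
  shows "submod n m {y\<in>N. \<forall>i\<in>I. \<forall>q\<in>F i. ip y q = 0}"
  unfolding submod_def
proof (intro conjI ballI)
  fix D p
  assume D: "D \<in> inv_ops n m" and p: "p \<in> {y\<in>N. \<forall>i\<in>I. \<forall>q\<in>F i. ip y q = 0}"
  obtain D' where D': "D' \<in> inv_ops n m" "\<And>p q. ip (D p) q = ip p (D' q)"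
    using inv_ops_adjoint[OF assms(2) D] by blast
  show "D p \<in> {y\<in>N. \<forall>i\<in>I. \<forall>q\<in>F i. ip y q = 0}"
    using p submodD(4)[OF N D] submodD(4)[OF F D'(1)] by (auto simp: D'(2))
qed (use submodD(1,2,3)[OF N] in \<open>auto simp: ip_add_left\<close>)

theorem theorem5p6:
  fixes n :: nat and lam :: "nat \<Rightarrow> nat" and N :: "cpoly set" and v :: cpoly
  assumes "n \<ge> 2"
    and "is_partition (n - 1) lam"
    and "N = cyclic n (n - 1) v" and "N \<subseteq> polys n"
    and "corresponds n (n - 1) N lam"
    and "ann_neg n (n - 1) N = range (\<lambda>c. cscale c v)"
  shows "\<exists>M :: (nat \<Rightarrow> nat) \<Rightarrow> cpoly set.
     direct_sum_of (box_extensions n lam) M N \<and>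
     (\<forall>\<mu> \<in> box_extensions n lam. corresponds n n (M \<mu>) \<mu>) \<and>
     (\<forall>\<mu> \<in> box_extensions n lam. \<forall>\<nu> \<in> box_extensions n lam.
        \<mu> \<noteq> \<nu> \<longrightarrow> \<not> submod_iso n n (M \<mu>) (M \<nu>)) \<and>
     (\<forall>r \<ge> 1. is_partition n (add_box lam r) \<longrightarrow>
        (\<exists>v\<^sub>\<mu> v'. M (add_box lam r) = cyclic n n v\<^sub>\<mu> \<and>
           v\<^sub>\<mu> \<noteq> 0 \<and> homogeneous v\<^sub>\<mu> \<and> v\<^sub>\<mu> \<in> ann_neg n n N \<and>
           v\<^sub>\<mu> = X n ^ lam r * v + v' \<and> lower_order n (lam r) v' \<and>
           poly_degree v\<^sub>\<mu> = (\<Sum>i | lam i \<noteq> 0. lam i choose 2) + lam r))"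
proof -
  define m where "m = n - 1"
  have n: "n = Suc m" and mn: "m \<le> n" using assms(1) by (auto simp: m_def)
  have lam: "is_partition m lam" and finlam: "finite {i. lam i \<noteq> 0}"
    using assms(2) by (auto simp: m_def is_partition_def)
  obtain P f where P: "partition_on {1..m} P" and hb: "has_block_sizes P lam"
    and N: "submod n m N" and f: "mod_iso n m f N (cyclic n m (specht P))"
    using assms(5) unfolding corresponds_def simple_submod_def submod_iso_mod_iso m_def[symmetric] by blast
  define s where "s = specht P"
  define d where "d = int (specht_degree P)"
  define N\<^sub>1 where "N\<^sub>1 = cyclic n m s"
  define g where "g = inv_into N f"
  have sn: "s \<in> polys n" using specht_polys[OF P] polys_mono[OF mn] by (auto simp: s_def)
  have N1: "submod n m N\<^sub>1" unfolding N\<^sub>1_def by (rule submod_cyclic[OF sn])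
  have f: "mod_iso n m f N N\<^sub>1" using f by (simp add: N\<^sub>1_def s_def)
  have g: "mod_iso n m g N\<^sub>1 N" unfolding g_def by (rule mod_iso_inverse[OF f N])
  have fg: "f (g y) = y" if "y \<in> N\<^sub>1" for y
    unfolding g_def using f that by (metis bij_betw_inv_into_right mod_iso_def)
  have sN1: "s \<in> N\<^sub>1" unfolding N\<^sub>1_def by (rule cyclic_self)
  have Np: "N \<subseteq> polys n" and N1p: "N\<^sub>1 \<subseteq> polys n" using submodD(1) N N1 by blast+
  have ann: "\<exists>c. y = cscale c v" if "y \<in> N" "lowest n m y" for y
  proof -
    have "y \<in> ann_neg n (n - 1) N" using that by (simp add: ann_neg_iff m_def[symmetric])
    then show ?thesis unfolding assms(6) by blast
  qed

  have "lowest n m (g s)"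
    by (rule mod_iso_lowest[OF g N1 sN1 order_refl]) (simp add: s_def specht_lowest[OF P])
  then obtain k where gs: "g s = cscale k v" using ann mod_iso_mem[OF g sN1] by blast
  have k: "k \<noteq> 0"
  proof
    assume "k = 0"
    then have "g s = 0" using gs by simp
    then have "s = 0" using mod_iso_eq_0_iff[OF g submodD(2)[OF N1] sN1] by simp
    then show False using specht_nonzero[OF P] by (simp add: s_def)
  qed
  have v_gs: "v = cscale (1 / k) (g s)" using k by (simp add: gs)
  have vN: "v \<in> N" using assms(3) cyclic_self by simp
  have v_low: "lowest n m v" and v_deg: "hdeg d v"
    using \<open>lowest n m (g s)\<close> mod_iso_hdeg[OF g mn N1p Np sN1, of d] specht_hdeg[OF P]
    by (auto simp: v_gs s_def d_def intro: lowest_cscale hdeg_cscale)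
  have fv: "f v = cscale (1 / k) s"
    unfolding v_gs using mod_iso_cscale[OF f mod_iso_mem[OF g sN1]] fg[OF sN1] by simp
  have v1: "lower_order n 1 v"
    using lowestD[OF v_low] pd_inv_ops[of m] pd_weyl_part[of m] by (simp add: n lower_order_iff_pd One_nat_def)
  have pdp: "pd n ^^ a \<in> inv_ops n m" for a using pd_pow_inv_ops by (simp add: n)
  note linp = inv_ops_lin[OF pdp]

  \<comment> \<open>one lowest weight vector for each box, transported from the projections of Specht polynomials\<close>
  have "\<forall>\<mu>\<in>box_extensions n lam. \<exists>w r. r \<ge> 1 \<and> \<mu> = add_box lam r \<and> w \<in> N \<and> w \<noteq> 0 \<and>
      hdeg (d + int (lam r)) w \<and> lowest n n w \<and> (pd n ^^ lam r) w = cscale (fact (lam r)) v \<and>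
      corresponds n n (cyclic n n w) \<mu>"
  proof
    fix \<mu> assume "\<mu> \<in> box_extensions n lam"
    then obtain r where r: "r \<ge> 1" "\<mu> = add_box lam r" "is_partition n \<mu>"
      by (auto simp: box_extensions_def)
    have "\<exists>A. (A \<in> P \<or> A = {}) \<and> card A = lam r"
    proof (cases "lam r = 0")
      case False
      then have "lam r \<in> card ` P"
        using has_block_sizes_set[OF hb partition_finite(1)[OF P] finlam] by simp
      then obtain A where "A \<in> P" "lam r = card A" by (rule imageE)
      then show ?thesis by (intro exI[of _ A]) simp
    next
      case True
      then show ?thesis by (intro exI[of _ "{}"]) simp
    qed
    then obtain A where A: "A \<in> P \<or> A = {}" "card A = lam r" by blast
    define Q where "Q = insert (insert n A) (P - {A})"
    have Q: "partition_on {1..n} Q" "has_block_sizes Q \<mu>"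
      using partition_add_last(1)[OF P A(1)] has_block_sizes_add_box[OF P hb finlam A]
      by (simp_all add: Q_def n r(2))
    obtain u where u: "u \<in> N\<^sub>1" "hdeg (d + int (lam r)) u" "lowest n n u"
      "(pd n ^^ lam r) u = cscale ((- 1) ^ lam r * fact (lam r)) s"
      "\<And>D. D \<in> inv_ops n n \<Longrightarrow> D u = 0 \<longleftrightarrow> D (specht Q) = 0"
    proof (rule projected_specht[OF P A(1), folded n, folded Q_def s_def, folded N\<^sub>1_def, unfolded A(2) of_nat_add, folded d_def])
      fix u
      assume "u \<in> N\<^sub>1" "hdeg (d + int (lam r)) u" "lowest n n u"
        "(pd n ^^ lam r) u = cscale ((- 1) ^ lam r * fact (lam r)) s"
        "\<And>D. D \<in> inv_ops n n \<Longrightarrow> D u = 0 \<longleftrightarrow> D (specht Q) = 0"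
      then show thesis by (rule that)
    qed
    \<comment> \<open>the sign comes from the expansion of the product of the differences, \<open>k\<close> from \<open>g s\<close>\<close>
    define w where "w = cscale ((- 1) ^ lam r / k) (g u)"
    have guN: "g u \<in> N" by (rule mod_iso_mem[OF g u(1)])
    have wN: "w \<in> N" unfolding w_def by (rule submod_cscale[OF N guN])
    have Dw: "D w = 0 \<longleftrightarrow> D (specht Q) = 0" if D: "D \<in> inv_ops n n" for D
    proof -
      have Dm: "D \<in> inv_ops n m" using D inv_ops_mono[OF mn] by blast
      have "D w = cscale ((- 1) ^ lam r / k) (g (D u))"
        by (simp add: w_def lin_cscale[OF inv_ops_lin[OF D]] mod_iso_op[OF g Dm u(1)])
      then have "D w = 0 \<longleftrightarrow> g (D u) = 0" using k by simp
      then show ?thesis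
        using mod_iso_eq_0_iff[OF g submodD(2)[OF N1] submodD(4)[OF N1 Dm u(1)]] u(5)[OF D] by simp
    qed
    have w_deg: "hdeg (d + int (lam r)) w"
      unfolding w_def by (intro hdeg_cscale mod_iso_hdeg[OF g mn N1p Np u(1,2)])
    have w_low: "lowest n n w"
      unfolding w_def by (intro lowest_cscale mod_iso_lowest[OF g N1 u(1) mn u(3)])
    have "(pd n ^^ lam r) w = cscale ((- 1) ^ lam r / k) (g ((pd n ^^ lam r) u))"
      by (simp add: w_def lin_cscale[OF linp] mod_iso_op[OF g pdp u(1)])
    also have "\<dots> = cscale (((- 1) ^ lam r * (- 1) ^ lam r) * fact (lam r)) v"
      using k by (simp add: u(4) mod_iso_cscale[OF g sN1] gs)
    also have "(- 1) ^ lam r * (- 1) ^ lam r = (1 :: complex)"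
      by (simp add: power_mult_distrib[symmetric])
    finally have w_lead: "(pd n ^^ lam r) w = cscale (fact (lam r)) v" by simp
    have w0: "w \<noteq> 0"
    proof
      assume "w = 0"
      then have "id (specht Q) = 0" using Dw[OF inv_ops_id] by simp
      then show False using specht_nonzero[OF Q(1)] by simp
    qed
    have "simple_submod n n (cyclic n n w)"
    proof (rule simple_cyclic[OF order_refl _ w0 w_deg w_low])
      show "w \<in> polys n" using wN Np by blast
      fix D assume D: "D \<in> inv_ops n n" "D \<in> weyl_part n 0"
      obtain c where c: "D (specht Q) = cscale c (specht Q)"
        using specht_degree_0_op[OF Q(1) D] by blast
      have "D + op_scale (- c) id \<in> inv_ops n n"
        by (intro inv_ops_add inv_ops_scale inv_ops_id D(1))
      from Dw[OF this] have "D w - cscale c w = 0" by (simp add: op_scale_def c)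
      then show "\<exists>c. D w = cscale c w" by auto
    qed
    moreover have "submod_iso n n (cyclic n n w) (cyclic n n (specht Q))"
      by (rule cyclic_iso) (rule Dw)
    ultimately have "corresponds n n (cyclic n n w) \<mu>"
      unfolding corresponds_def using r(3) Q by blast
    then show "\<exists>w r. r \<ge> 1 \<and> \<mu> = add_box lam r \<and> w \<in> N \<and> w \<noteq> 0 \<and>
      hdeg (d + int (lam r)) w \<and> lowest n n w \<and> (pd n ^^ lam r) w = cscale (fact (lam r)) v \<and>
      corresponds n n (cyclic n n w) \<mu>"
      using r wN w0 w_deg w_low w_lead by blast
  qed
  then obtain V row where V: "\<And>\<mu>. \<mu> \<in> box_extensions n lam \<Longrightarrow> row \<mu> \<ge> 1 \<and> \<mu> = add_box lam (row \<mu>) \<and>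
      V \<mu> \<in> N \<and> V \<mu> \<noteq> 0 \<and> hdeg (d + int (lam (row \<mu>))) (V \<mu>) \<and> lowest n n (V \<mu>) \<and>
      (pd n ^^ lam (row \<mu>)) (V \<mu>) = cscale (fact (lam (row \<mu>))) v \<and>
      corresponds n n (cyclic n n (V \<mu>)) \<mu>"
    by metis
  define M where "M \<mu> = cyclic n n (V \<mu>)" for \<mu>
  define I where "I = box_extensions n lam"
  note V = V[folded I_def]
  have Nn: "submod n n N" by (rule submod_restrict[OF N mn])
  have Vp: "V \<mu> \<in> polys n" if "\<mu> \<in> I" for \<mu> using V[OF that] Np by blast
  have Msub: "submod n n (M \<mu>)" if "\<mu> \<in> I" for \<mu>
    unfolding M_def by (rule submod_cyclic[OF Vp[OF that]])
  have MN: "M \<mu> \<subseteq> N" if "\<mu> \<in> I" for \<mu>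
    unfolding M_def using cyclic_subset[OF Nn] V[OF that] by blast
  have rows: "lam (row \<mu>) \<noteq> lam (row \<nu>)" if "\<mu> \<in> I" "\<nu> \<in> I" "\<mu> \<noteq> \<nu>" for \<mu> \<nu>
  proof
    assume eq: "lam (row \<mu>) = lam (row \<nu>)"
    have p: "is_partition n \<mu>" "is_partition n \<nu>"
      using that by (auto simp: I_def box_extensions_def)
    have "row \<mu> = row \<nu>"
    proof (rule addable_rows_distinct[where lam = lam, OF _ _ _ _ eq])
      show "is_partition n (add_box lam (row \<mu>))" "is_partition n (add_box lam (row \<nu>))"
        "1 \<le> row \<mu>" "1 \<le> row \<nu>" using p V[OF that(1)] V[OF that(2)] by auto
    qed
    then show False using V[OF that(1)] V[OF that(2)] that(3) by metis
  qed

  \<comment> \<open>The leading coefficient is a multiple of \<open>v\<close> for any lowest weight vector. Its order is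
    controlled in the image under \<open>f\<close>, whose elements are antisymmetric.\<close>
  have lead: "\<exists>j c. c \<noteq> 0 \<and> (pd n ^^ j) w = cscale c v \<and> e = d + int j \<and> (\<exists>r\<ge>1. lam r = j)"
    if w: "w \<in> N" "w \<noteq> 0" "hdeg e w" "lowest n n w" for w e
  proof -
    obtain j where j: "(pd n ^^ j) w \<noteq> 0" "(pd n ^^ Suc j) w = 0"
      by (rule exact_order[OF w(2)])
    have pN: "(pd n ^^ j) w \<in> N" by (rule submodD(4)[OF N pdp w(1)])
    have "lower_order n (Suc j) w" using j(2) by (simp only: lower_order_iff_pd)
    then have "\<And>\<gamma>. lookup w \<gamma> \<noteq> 0 \<Longrightarrow> lookup \<gamma> n \<le> j" using lower_orderD by fastforce
    then have "lowest n m ((pd n ^^ j) w)"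
      using leading_coefficient_lowest[of m w j] w(4) by (simp add: n)
    then obtain c where c: "(pd n ^^ j) w = cscale c v" using ann pN by blast
    then have c0: "c \<noteq> 0" using j(1) by auto
    have "hdeg (e - int j) ((pd n ^^ j) w)"
    proof (induction j)
      case (Suc j)
      have "hdeg (e - int j - 1) (pd n ((pd n ^^ j) w))" by (rule hdeg_pd[OF Suc])
      then show ?case by (simp add: algebra_simps)
    qed (simp add: w(3))
    then have e: "e = d + int j"
      using hdeg_unique[OF _ hdeg_cscale[OF v_deg, of c]] c j(1) by force
    have "\<exists>r\<ge>1. lam r = j"
    proof (cases "j = 0")
      case True
      then show ?thesis using zero_row_exists[OF lam] by metis
    next
      case False
      have fw: "f w \<in> N\<^sub>1" by (rule mod_iso_mem[OF f w(1)])
      then obtain D where D: "D \<in> inv_ops n m" "f w = D s" unfolding N\<^sub>1_def by (rule cyclicE)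
      have "antisym P (f w)"
        unfolding D(2) s_def by (rule antisym_inv_op[OF P specht_antisym[OF P] D(1)])
      moreover have "lowest n n (f w)" by (rule mod_iso_lowest[OF f N w(1) mn w(4)])
      moreover have "(pd n ^^ j) (f w) = cscale (c / k) s"
        using mod_iso_cscale[OF f vN, of c]
        by (simp add: mod_iso_op[OF f pdp w(1), symmetric] c fv)
      ultimately obtain A where A: "A \<in> P" "card A = j"
        using order_is_block_size[OF P, of "f w" j "c / k"] c0 k False by (auto simp: n s_def)
      then obtain i where i: "lam i \<noteq> 0" "lam i = j"
        using has_block_sizes_set[OF hb partition_finite(1)[OF P] finlam] by force
      then have "i \<noteq> 0" using lam by (metis is_partition_def)
      then show ?thesis using i by (intro exI[of _ i]) (simp add: One_nat_def)
    qed
    then show ?thesis using c c0 e by blast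
  qed

  have full: "y = 0" if y: "y \<in> N" and o: "\<And>\<mu> q. \<mu> \<in> I \<Longrightarrow> q \<in> M \<mu> \<Longrightarrow> ip y q = 0" for y
  proof (rule ccontr)
    define K where "K = {y\<in>N. \<forall>\<mu>\<in>I. \<forall>q\<in>M \<mu>. ip y q = 0}"
    assume "y \<noteq> 0"
    then have "K \<noteq> {0}" using y o by (auto simp: K_def)
    moreover have "submod n n K"
      unfolding K_def by (rule orthogonal_complement_submod[OF Nn order_refl Msub])
    ultimately obtain w e where w: "w \<in> K" "w \<noteq> 0" "hdeg e w" "lowest n n w"
      using exists_lowest[OF _ order_refl] by blast
    have wN: "w \<in> N" using w(1) by (simp add: K_def)
    obtain j c where jc: "c \<noteq> 0" "(pd n ^^ j) w = cscale c v" "e = d + int j" "\<exists>r\<ge>1. lam r = j"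
      using lead[OF wN w(2-4)] by blast
    then obtain r where r: "1 \<le> r" "lam r = j" "is_partition n (add_box lam r)"
      using addable_row_exists[OF lam] n by metis
    define \<mu> where "\<mu> = add_box lam r"
    have \<mu>: "\<mu> \<in> I" using r by (auto simp: \<mu>_def I_def box_extensions_def)
    have row: "row \<mu> = r" using V[OF \<mu>] add_box_inj by (metis \<mu>_def)
    have V\<mu>: "V \<mu> \<in> N" "hdeg e (V \<mu>)" "lowest n n (V \<mu>)" "(pd n ^^ j) (V \<mu>) = cscale (fact j) v"
      using V[OF \<mu>] unfolding row r(2) jc(3) by blast+
    \<comment> \<open>the leading terms cancel, but the degree would require the order \<open>j\<close> again\<close>
    let ?z = "w - cscale (c / fact j) (V \<mu>)"
    have zN: "?z \<in> N" by (intro submod_diff[OF N] submod_cscale[OF N] wN V\<mu>(1))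
    have z0: "(pd n ^^ j) ?z = 0"
      by (simp add: lin_diff[OF linp] lin_cscale[OF linp] jc(2) V\<mu>(4))
    have "?z = 0"
    proof (rule ccontr)
      assume "?z \<noteq> 0"
      moreover have "hdeg e ?z" by (intro hdeg_diff hdeg_cscale w(3) V\<mu>(2))
      moreover have "lowest n n ?z" by (rule lowest_lincomb[OF w(4) V\<mu>(3)])
      ultimately obtain j' c' where "c' \<noteq> 0" "(pd n ^^ j') ?z = cscale c' v" "e = d + int j'"
        using lead[OF zN] by blast
      then have "cscale c' v = 0" using z0 jc(3) by simp
      moreover have "v \<noteq> 0" using V\<mu>(4) jc(2) w(2) k gs mod_iso_eq_0_iff[OF g submodD(2)[OF N1] sN1]
          specht_nonzero[OF P] s_def by auto
      ultimately show False using \<open>c' \<noteq> 0\<close> by simp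
    qed
    then have "w \<in> M \<mu>" unfolding M_def
      using submod_cscale[OF submod_cyclic[OF Vp[OF \<mu>]] cyclic_self] by simp
    then have "ip w w = 0" using w(1) \<mu> by (auto simp: K_def)
    then show False using w(2) by (simp add: ip_self)
  qed

  have orth: "ip p q = 0"
    if "\<mu> \<in> I" "\<nu> \<in> I" "\<mu> \<noteq> \<nu>" "p \<in> M \<mu>" "q \<in> M \<nu>" for \<mu> \<nu> p q
  proof -
    have lt: "ip p q = 0" if "\<mu> \<in> I" "\<nu> \<in> I" "lam (row \<mu>) < lam (row \<nu>)" "p \<in> M \<mu>" "q \<in> M \<nu>" for \<mu> \<nu> p q
      using lowest_orthogonal[OF order_refl, of "d + int (lam (row \<mu>))" "V \<mu>" n "d + int (lam (row \<nu>))" "V \<nu>" p q]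
        V[OF that(1)] V[OF that(2)] that(3-5) by (simp add: M_def)
    show ?thesis
      using rows[OF that(1-3)] lt[OF that(1,2) _ that(4,5)] lt[OF that(2,1) _ that(5,4)] ip_commute[of p q]
      by (cases "lam (row \<mu>) < lam (row \<nu>)") auto
  qed

  have "direct_sum_of I M N"
  proof (rule orthogonal_direct_sum[OF Nn order_refl])
    show "finite I" unfolding I_def by (rule finite_box_extensions)
  qed (use Msub MN orth full in blast)+
  moreover have "\<forall>\<mu>\<in>I. corresponds n n (M \<mu>) \<mu>" using V by (simp add: M_def)
  moreover have "\<forall>\<mu>\<in>I. \<forall>\<nu>\<in>I. \<mu> \<noteq> \<nu> \<longrightarrow> \<not> submod_iso n n (M \<mu>) (M \<nu>)"
  proof (intro ballI impI notI)
    fix \<mu> \<nu>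
    assume \<mu>\<nu>: "\<mu> \<in> I" "\<nu> \<in> I" "\<mu> \<noteq> \<nu>" and "submod_iso n n (M \<mu>) (M \<nu>)"
    then obtain h where h: "mod_iso n n h (cyclic n n (V \<mu>)) (cyclic n n (V \<nu>))"
      by (auto simp: submod_iso_mod_iso M_def)
    note h' = mod_iso_inverse[OF h submod_cyclic[OF Vp[OF \<mu>\<nu>(1)]]]
    consider "lam (row \<mu>) < lam (row \<nu>)" | "lam (row \<nu>) < lam (row \<mu>)" using rows[OF \<mu>\<nu>] by linarith
    then show False
    proof cases
      case 1
      show False
        by (rule not_iso_of_degree_less[OF Vp[OF \<mu>\<nu>(1)] _ _ Vp[OF \<mu>\<nu>(2)] _ _ order_refl _ h])
          (use 1 V[OF \<mu>\<nu>(1)] V[OF \<mu>\<nu>(2)] in auto)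
    next
      case 2
      show False
        by (rule not_iso_of_degree_less[OF Vp[OF \<mu>\<nu>(2)] _ _ Vp[OF \<mu>\<nu>(1)] _ _ order_refl _ h'])
          (use 2 V[OF \<mu>\<nu>(1)] V[OF \<mu>\<nu>(2)] in auto)
    qed
  qed
  moreover have "\<exists>v\<^sub>\<mu> v'. M (add_box lam r) = cyclic n n v\<^sub>\<mu> \<and>
      v\<^sub>\<mu> \<noteq> 0 \<and> homogeneous v\<^sub>\<mu> \<and> v\<^sub>\<mu> \<in> ann_neg n n N \<and>
      v\<^sub>\<mu> = X n ^ lam r * v + v' \<and> lower_order n (lam r) v' \<and>
      poly_degree v\<^sub>\<mu> = (\<Sum>i | lam i \<noteq> 0. lam i choose 2) + lam r"
    if r: "r \<ge> 1" "is_partition n (add_box lam r)" for r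
  proof -
    define \<mu> where "\<mu> = add_box lam r"
    have \<mu>: "\<mu> \<in> I" using r by (auto simp: \<mu>_def I_def box_extensions_def)
    have row: "row \<mu> = r" using V[OF \<mu>] add_box_inj by (metis \<mu>_def)
    note V\<mu> = V[OF \<mu>, unfolded row]
    have deg: "mon_degree \<gamma> = specht_degree P + lam r" if "\<gamma> \<in> keys (V \<mu>)" for \<gamma>
      using V\<mu> that by (auto simp: hdeg_def d_def)
    have V0: "V \<mu> \<noteq> 0" using V\<mu> by blast
    have "mon_degree ` keys (V \<mu>) = (\<lambda>_. specht_degree P + lam r) ` keys (V \<mu>)"
      by (rule image_cong) (simp_all add: deg)
    also have "\<dots> = {specht_degree P + lam r}"
      using V0 by (simp add: image_constant_conv)
    finally have "mon_degree ` keys (V \<mu>) = {specht_degree P + lam r}" .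
    then have "poly_degree (V \<mu>) = (\<Sum>i | lam i \<noteq> 0. lam i choose 2) + lam r"
      using has_block_sizes_degree[OF hb] by (simp add: poly_degree_def)
    moreover have "homogeneous (V \<mu>)" using deg by (simp add: homogeneous_def)
    moreover have "lower_order n (lam r) (V \<mu> - X n ^ lam r * v)"
      by (rule leading_term_expansion[OF _ v1]) (use V\<mu> in blast)
    moreover have "V \<mu> \<in> ann_neg n n N" using V\<mu> unfolding ann_neg_iff by blast
    moreover have "V \<mu> = X n ^ lam r * v + (V \<mu> - X n ^ lam r * v)" by simp
    ultimately show ?thesis
      using V0 M_def unfolding \<mu>_def[symmetric] by blast
  qed
  ultimately show ?thesis
    unfolding I_def by blast
qed

end
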